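(* Let $(X,\oplus,\otimes)$ be a tropical semifield, let $n\ge 5$ and $N=3n-6$, and fix a base configuration of $n$ labeled points on $\mathbb{S}^2$, no four of which lie on a common circle. Let $T_1$ be its Delaunay triangulation, which has $N$ edges, and let $A_1\in X^{\times N}$ be a fixed labeling of the edges of $T_1$. For a generic spherical pure braid $\beta$ on $n$ strands based at this configuration, let $f_n(\beta)\in X^{\times N}$ be the final labeling obtained from $A_1$ by successively applying the flips of labels along the flip sequence induced by $\beta$. Then $f_n$ is a braid invariant: if $\beta$ and $\beta'$ are isotopic, then $f_n(\beta)=f_n(\beta')$ in $X^{\times N}$. Thus $f_n$ gives a well-defined map $SPB_n\to X^{\times N}$ on the spherical pure braid group $SPB_n$ on $n$ strands.
   Context: Tropical semifield: a linearly ordered abelian group $(X,+,\le)$ (for example $\mathbb{R}$) with $x\oplus y=\max(x,y)$ and $x\otimes y=x+y$. Delaunay triangulation: for a finite set $\{z_1,\dots,z_n\}\subset\mathbb{S}^2$, the Voronoi cell of $z_i$ is $\{z\in\mathbb{S}^2:\|z-z_i\|\le\|z-z_j\|\ \forall j\ne i\}$. The Delaunay triangulation has vertices $z_1,\dots,z_n$, with an edge joining two vertices whose Voronoi cells share an edge. If no four points lie on a common circle (great or small) of $\mathbb{S}^2$, it is a triangulation of $\mathbb{S}^2$ with $3n-6$ edges; equivalently, three points span a triangle iff one of the two open discs bounded by the circle through them contains no other point of the set. Flip: replacing a diagonal $d$ of a quadrilateral formed by two adjacent triangles of a triangulation by the other diagonal $d'$ of that quadrilateral. Flip of labels: a labeling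 of a triangulation assigns an element of $X$ to each edge. Under a flip in a quadrilateral with sides labeled $a,b,c,d$ in cyclic order and diagonal labeled $x$, the new diagonal receives the label $y$ determined by the tropical Ptolemy relation $x\otimes y=(a\otimes c)\oplus(b\otimes d)$, i.e. $y=\max(a+c,\,b+d)-x$. All other edges keep their labels. Braids: a spherical pure braid is a loop $(x_1(t),\dots,x_n(t))$, $t\in[0,1]$, of $n$ pairwise distinct points of $\mathbb{S}^2$ with $x_i(0)=x_i(1)$ for all $i$, starting and ending at the base configuration. Two braids are isotopic if they are homotopic as loops based at the base configuration, and $SPB_n$ is the group of isotopy classes. Generic braid: for all but finitely many $t$ no four of the points lie on a common circle; there are finitely many critical times $0<t_1<\dots<t_\ell<1$ at which some circle $C$ contains at least four of the points while one component of $\mathbb{S}^2\setminus C$ contains none of the points; and at each critical time there is exactly one such circle, it contains exactly four of the points, and the quadruple passes through the cocircular position, so that the Delaunay triangulation just after $t_i$ differs from that just before by the flip in the quadrilateral with these four vertices. Flip sequence: between consecutive critical times the Delaunay triangulation, with vertices labeled by strands, is constant up to isotopy of $\mathbb{S}^2$; denote it $T_{i+1}$ on $(t_i,t_{i+1})$, with $t_0=0$, $t_{\ell+1}=1$. The flip sequence induced by the braid is $T_1\to T_2\to\dots\to T_{\ell+1}$. Definition of $f_n$: starting from $A_1$ on $T_1$, let $A_{i+1}$ be the labeling of $T_{i+1}$ obtained from $A_i$ by the flip of labels along $T_i\to T_{i+1}$. Then $f_n(\beta):=A_{\ell+1}$, the labeling of the last triangulation. The last triangulation is again the Delaunay triangulation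 of the base configuration, so it equals $T_1$, and its labeling is regarded as an element of $X^{\times N}$ via the same fixed ordering of the edges of $T_1$. *)

theory Defs
  imports "HOL-Analysis.Analysis" "HOL-Algebra.Group"
begin

section \<open>Configurations of labeled points on the sphere\<close>

text \<open>A configuration of \<open>CARD('n)\<close> labeled points is a vector of type \<open>(real^3)^'n\<close>, so that the
  configuration space carries the usual Euclidean topology.\<close>

definition configuration_space :: "((real^3)^'n) set" where
  "configuration_space =
     {z. (\<forall>i. z $ i \<in> sphere 0 1) \<and> (\<forall>i j. i \<noteq> j \<longrightarrow> z $ i \<noteq> z $ j)}"

text \<open>For a unit vector \<open>u\<close> and \<open>\<bar>c\<bar> < 1\<close>, \<open>circle u c\<close> is a (great or small) circle of the sphere and
  \<open>disc u c\<close> is one of the two open discs bounded by it; the other disc is \<open>disc (- u) (- c)\<close>, and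
  \<open>circle (- u) (- c) = circle u c\<close>.\<close>

definition circle :: "real^3 \<Rightarrow> real \<Rightarrow> (real^3) set" where
  "circle u c = {x \<in> sphere 0 1. u \<bullet> x = c}"

definition disc :: "real^3 \<Rightarrow> real \<Rightarrow> (real^3) set" where
  "disc u c = {x \<in> sphere 0 1. u \<bullet> x > c}"

definition is_circle :: "(real^3) set \<Rightarrow> bool" where
  "is_circle C \<longleftrightarrow> (\<exists>u c. norm u = 1 \<and> \<bar>c\<bar> < 1 \<and> C = circle u c)"

definition no_four_cocircular :: "(real^3)^'n \<Rightarrow> bool" where
  "no_four_cocircular z \<longleftrightarrow>
     \<not> (\<exists>Q C. card Q = 4 \<and> is_circle C \<and> (\<forall>i\<in>Q. z $ i \<in> C))"

section \<open>Delaunay triangulations\<close>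

definition voronoi_cell :: "(real^3)^'n \<Rightarrow> 'n \<Rightarrow> (real^3) set" where
  "voronoi_cell z i = {x \<in> sphere 0 1. \<forall>j. j \<noteq> i \<longrightarrow> dist x (z $ i) \<le> dist x (z $ j)}"

text \<open>Edges and triangles are recorded by their vertex sets. Two Voronoi cells share an edge when
  they have a nondegenerate arc in common (as opposed to isolated points). Three points span a
  triangle when one of the two open discs bounded by the circle through them contains no point.
  On configurations without a critical circle (see below) the edges are exactly the sides of the
  triangles; only such configurations occur in flip sequences.\<close>

definition delaunay_edges :: "(real^3)^'n \<Rightarrow> 'n set set" where
  "delaunay_edges z = {{i, j} | i j. i \<noteq> j \<and>
     (\<exists>g. arc g \<and> path_image g \<subseteq> voronoi_cell z i \<inter> voronoi_cell z j)}"

definition delaunay_triangles :: "(real^3)^'n \<Rightarrow> 'n set set" where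
  "delaunay_triangles z = {D. card D = 3 \<and>
     (\<exists>u c. norm u = 1 \<and> \<bar>c\<bar> < 1 \<and> (\<forall>i\<in>D. z $ i \<in> circle u c) \<and> (\<forall>i. z $ i \<notin> disc u c))}"

type_synonym 'n triangulation = "'n set set \<times> 'n set set"

definition delaunay :: "(real^3)^'n \<Rightarrow> 'n triangulation" where
  "delaunay z = (delaunay_edges z, delaunay_triangles z)"

section \<open>Flips\<close>

text \<open>\<open>is_flip a b c d T T'\<close>: the quadrilateral with vertices \<open>a, b, c, d\<close> in cyclic order is the
  union of the triangles \<open>abc\<close> and \<open>acd\<close> of \<open>T\<close>, and \<open>T'\<close> arises from \<open>T\<close> by replacing its
  diagonal \<open>ac\<close> by \<open>bd\<close>.\<close>

definition is_flip ::
    "'n \<Rightarrow> 'n \<Rightarrow> 'n \<Rightarrow> 'n \<Rightarrow> 'n triangulation \<Rightarrow> 'n triangulation \<Rightarrow> bool" where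
  "is_flip a b c d T T' \<longleftrightarrow> distinct [a, b, c, d] \<and>
     {a, c} \<in> fst T \<and> {a, b, c} \<in> snd T \<and> {a, c, d} \<in> snd T \<and>
     fst T' = (fst T - {{a, c}}) \<union> {{b, d}} \<and>
     snd T' = (snd T - {{a, b, c}, {a, c, d}}) \<union> {{a, b, d}, {b, c, d}}"

text \<open>A labeling is a function on vertex sets of which only the values on the edges of the
  triangulation matter: after a flip the value at the removed diagonal \<open>ac\<close> is never read again
  unless a later flip reintroduces \<open>ac\<close>, and that flip overwrites it. The new label below is
  \<open>y\<close> with \<open>x \<otimes> y = (ab \<otimes> cd) \<oplus> (bc \<otimes> da)\<close> for \<open>\<oplus> = max\<close> and \<open>\<otimes> = +\<close>. It does not depend
  on which of the cyclic orders of the quadrilateral is used.\<close>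

definition flip_labels :: "'n triangulation \<Rightarrow> 'n triangulation \<Rightarrow>
    ('n set \<Rightarrow> 'x::linordered_ab_group_add) \<Rightarrow> ('n set \<Rightarrow> 'x)" where
  "flip_labels T T' A = (THE A'. \<exists>a b c d. is_flip a b c d T T' \<and>
     A' = A({b, d} := max (A {a, b} + A {c, d}) (A {b, c} + A {d, a}) - A {a, c}))"

section \<open>Spherical pure braids\<close>

definition pure_braid :: "(real^3)^'n \<Rightarrow> (real \<Rightarrow> (real^3)^'n) \<Rightarrow> bool" where
  "pure_braid p \<beta> \<longleftrightarrow> path \<beta> \<and> path_image \<beta> \<subseteq> configuration_space \<and>
     pathstart \<beta> = p \<and> pathfinish \<beta> = p"

definition isotopic :: "(real \<Rightarrow> (real^3)^'n) \<Rightarrow> (real \<Rightarrow> (real^3)^'n) \<Rightarrow> bool" where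
  "isotopic \<beta> \<beta>' \<longleftrightarrow> homotopic_paths configuration_space \<beta> \<beta>'"

definition isotopy_class :: "(real \<Rightarrow> (real^3)^'n) \<Rightarrow> (real \<Rightarrow> (real^3)^'n) set" where
  "isotopy_class \<beta> = {\<beta>'. isotopic \<beta> \<beta>'}"

definition SPB :: "(real^3)^'n \<Rightarrow> (real \<Rightarrow> (real^3)^'n) set monoid" where
  "SPB p = \<lparr>carrier = isotopy_class ` {\<beta>. pure_braid p \<beta>},
            mult = (\<lambda>c c'. \<Union>\<alpha>\<in>c. \<Union>\<beta>\<in>c'. isotopy_class (\<alpha> +++ \<beta>)),
            one = isotopy_class (linepath p p)\<rparr>"

lemma isotopy_class_eq_iff:
  assumes "pure_braid p \<alpha>"
  shows "isotopy_class \<alpha> = isotopy_class \<beta> \<longleftrightarrow> isotopic \<alpha> \<beta>"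
proof
  assume eq: "isotopy_class \<alpha> = isotopy_class \<beta>"
  have "\<alpha> \<in> isotopy_class \<alpha>"
    using assms by (simp add: isotopy_class_def isotopic_def pure_braid_def)
  with eq show "isotopic \<alpha> \<beta>"
    by (simp add: isotopy_class_def isotopic_def homotopic_paths_sym)
next
  assume "isotopic \<alpha> \<beta>"
  then show "isotopy_class \<alpha> = isotopy_class \<beta>"
    unfolding isotopy_class_def isotopic_def
    using homotopic_paths_trans homotopic_paths_sym by blast
qed

lemma pure_braid_join: "pure_braid p \<alpha> \<Longrightarrow> pure_braid p \<beta> \<Longrightarrow> pure_braid p (\<alpha> +++ \<beta>)"
  by (simp add: pure_braid_def path_image_join)

lemma pure_braid_reverse: "pure_braid p \<alpha> \<Longrightarrow> pure_braid p (reversepath \<alpha>)"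
  by (simp add: pure_braid_def)

lemma pure_braid_const: "p \<in> configuration_space \<Longrightarrow> pure_braid p (linepath p p)"
  by (simp add: pure_braid_def)

lemma SPB_mult:
  assumes "pure_braid p \<alpha>" "pure_braid p \<beta>"
  shows "isotopy_class \<alpha> \<otimes>\<^bsub>SPB p\<^esub> isotopy_class \<beta> = isotopy_class (\<alpha> +++ \<beta>)"
proof -
  have *: "isotopy_class (\<alpha>' +++ \<beta>') = isotopy_class (\<alpha> +++ \<beta>)"
    if "\<alpha>' \<in> isotopy_class \<alpha>" "\<beta>' \<in> isotopy_class \<beta>" for \<alpha>' \<beta>'
  proof -
    have "isotopic (\<alpha> +++ \<beta>) (\<alpha>' +++ \<beta>')"
      using that assms unfolding isotopy_class_def isotopic_def pure_braid_def
      by (intro homotopic_paths_join) simp_all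
    then show ?thesis
      by (simp only: isotopy_class_eq_iff[OF pure_braid_join[OF assms], symmetric])
  qed
  have mem: "\<alpha> \<in> isotopy_class \<alpha>" "\<beta> \<in> isotopy_class \<beta>"
    using assms by (simp_all add: isotopy_class_def isotopic_def pure_braid_def)
  have "(\<Union>\<alpha>'\<in>isotopy_class \<alpha>. \<Union>\<beta>'\<in>isotopy_class \<beta>. isotopy_class (\<alpha>' +++ \<beta>'))
      = (\<Union>\<alpha>'\<in>isotopy_class \<alpha>. \<Union>\<beta>'\<in>isotopy_class \<beta>. isotopy_class (\<alpha> +++ \<beta>))"
    using * by (intro SUP_cong refl)
  also have "\<dots> = isotopy_class (\<alpha> +++ \<beta>)"
    using mem by blast
  finally show ?thesis
    by (simp add: SPB_def)
qed

lemma group_SPB: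
  assumes p: "p \<in> configuration_space"
  shows "group (SPB p)"
proof (rule groupI)
  have car: "carrier (SPB p) = isotopy_class ` {\<beta>. pure_braid p \<beta>}"
    and one: "\<one>\<^bsub>SPB p\<^esub> = isotopy_class (linepath p p)"
    by (simp_all add: SPB_def)
  show "\<one>\<^bsub>SPB p\<^esub> \<in> carrier (SPB p)"
    using pure_braid_const[OF p] by (auto simp: car one)
  show "x \<otimes>\<^bsub>SPB p\<^esub> y \<in> carrier (SPB p)"
    if xy: "x \<in> carrier (SPB p)" "y \<in> carrier (SPB p)" for x y
  proof -
    obtain \<alpha> \<beta> where *: "pure_braid p \<alpha>" "pure_braid p \<beta>"
      "x = isotopy_class \<alpha>" "y = isotopy_class \<beta>"
      using xy unfolding car by blast
    show ?thesis
      unfolding *(3,4) SPB_mult[OF *(1,2)] car using pure_braid_join[OF *(1,2)] by blast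
  qed
  show "x \<otimes>\<^bsub>SPB p\<^esub> y \<otimes>\<^bsub>SPB p\<^esub> z = x \<otimes>\<^bsub>SPB p\<^esub> (y \<otimes>\<^bsub>SPB p\<^esub> z)"
    if xyz: "x \<in> carrier (SPB p)" "y \<in> carrier (SPB p)" "z \<in> carrier (SPB p)" for x y z
  proof -
    obtain \<alpha> \<beta> \<gamma> where *: "pure_braid p \<alpha>" "pure_braid p \<beta>" "pure_braid p \<gamma>"
      "x = isotopy_class \<alpha>" "y = isotopy_class \<beta>" "z = isotopy_class \<gamma>"
      using xyz unfolding car by blast
    have "isotopic (\<alpha> +++ (\<beta> +++ \<gamma>)) ((\<alpha> +++ \<beta>) +++ \<gamma>)"
      using *(1-3) unfolding isotopic_def pure_braid_def
      by (intro homotopic_paths_assoc) simp_all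
    then have "isotopy_class (\<alpha> +++ (\<beta> +++ \<gamma>)) = isotopy_class ((\<alpha> +++ \<beta>) +++ \<gamma>)"
      using isotopy_class_eq_iff[OF pure_braid_join[OF *(1) pure_braid_join[OF *(2,3)]]] by simp
    then show ?thesis
      by (simp only: *(4-6) SPB_mult[of p] pure_braid_join *(1-3))
  qed
  show "\<one>\<^bsub>SPB p\<^esub> \<otimes>\<^bsub>SPB p\<^esub> x = x" if x: "x \<in> carrier (SPB p)" for x
  proof -
    obtain \<alpha> where *: "pure_braid p \<alpha>" "x = isotopy_class \<alpha>"
      using x unfolding car by blast
    have "isotopic (linepath p p +++ \<alpha>) \<alpha>"
      using *(1) unfolding isotopic_def pure_braid_def
      by (intro homotopic_paths_lid') simp_all
    then have "isotopy_class (linepath p p +++ \<alpha>) = isotopy_class \<alpha>"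
      using isotopy_class_eq_iff[OF pure_braid_join[OF pure_braid_const[OF p] *(1)]] by simp
    then show ?thesis
      by (simp add: one *(2) SPB_mult[OF pure_braid_const[OF p] *(1)])
  qed
  show "\<exists>y\<in>carrier (SPB p). y \<otimes>\<^bsub>SPB p\<^esub> x = \<one>\<^bsub>SPB p\<^esub>" if x: "x \<in> carrier (SPB p)" for x
  proof -
    obtain \<alpha> where *: "pure_braid p \<alpha>" "x = isotopy_class \<alpha>"
      using x unfolding car by blast
    have "isotopic (reversepath \<alpha> +++ \<alpha>) (linepath p p)"
      using *(1) homotopic_paths_linv[of \<alpha> configuration_space]
      unfolding isotopic_def pure_braid_def by simp
    then have "isotopy_class (reversepath \<alpha>) \<otimes>\<^bsub>SPB p\<^esub> x = \<one>\<^bsub>SPB p\<^esub>"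
      using isotopy_class_eq_iff[OF pure_braid_join[OF pure_braid_reverse[OF *(1)] *(1)]]
      by (simp add: one *(2) SPB_mult[OF pure_braid_reverse[OF *(1)] *(1)])
    moreover have "isotopy_class (reversepath \<alpha>) \<in> carrier (SPB p)"
      using pure_braid_reverse[OF *(1)] by (simp add: car)
    ultimately show ?thesis ..
  qed
qed

section \<open>Generic braids and the induced flip sequence\<close>

definition critical_circle :: "(real^3)^'n \<Rightarrow> (real^3) set \<Rightarrow> bool" where
  "critical_circle z C \<longleftrightarrow> card {i. z $ i \<in> C} \<ge> 4 \<and>
     (\<exists>u c. norm u = 1 \<and> \<bar>c\<bar> < 1 \<and> C = circle u c \<and> (\<forall>i. z $ i \<notin> disc u c))"

definition critical_times :: "(real \<Rightarrow> (real^3)^'n) \<Rightarrow> real set" where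
  "critical_times \<beta> = {t \<in> {0..1}. \<exists>C. critical_circle (\<beta> t) C}"

definition generic_braid :: "(real^3)^'n \<Rightarrow> (real \<Rightarrow> (real^3)^'n) \<Rightarrow> bool" where
  "generic_braid p \<beta> \<longleftrightarrow> pure_braid p \<beta> \<and>
     finite {t \<in> {0..1}. \<not> no_four_cocircular (\<beta> t)} \<and>
     finite (critical_times \<beta>) \<and> critical_times \<beta> \<subseteq> {0<..<1} \<and>
     (\<forall>t \<in> critical_times \<beta>.
        (\<exists>!C. critical_circle (\<beta> t) C) \<and>
        (\<exists>C a b c d. critical_circle (\<beta> t) C \<and> card {i. \<beta> t $ i \<in> C} = 4 \<and>
           {i. \<beta> t $ i \<in> C} = {a, b, c, d} \<and>
           (\<forall>\<^sub>F s in at_left t. \<forall>\<^sub>F s' in at_right t.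
              is_flip a b c d (delaunay (\<beta> s)) (delaunay (\<beta> s')))))"

text \<open>\<open>time_mark \<beta> 0 = 0\<close>, \<open>time_mark \<beta> 1, \<dots>, time_mark \<beta> \<ell>\<close> are the critical times in increasing
  order, and \<open>time_mark \<beta> (\<ell> + 1) = 1\<close>, where \<open>\<ell> = card (critical_times \<beta>)\<close>.\<close>

definition time_mark :: "(real \<Rightarrow> (real^3)^'n) \<Rightarrow> nat \<Rightarrow> real" where
  "time_mark \<beta> i = ([0] @ sorted_list_of_set (critical_times \<beta>) @ [1]) ! i"

text \<open>Indices start at \<open>0\<close>: the flip sequence is
  \<open>flip_sequence \<beta> 0 \<rightarrow> \<dots> \<rightarrow> flip_sequence \<beta> (card (critical_times \<beta>))\<close>.\<close>

definition flip_sequence :: "(real \<Rightarrow> (real^3)^'n) \<Rightarrow> nat \<Rightarrow> 'n triangulation" where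
  "flip_sequence \<beta> i =
     (THE T. \<forall>s \<in> {time_mark \<beta> i <..< time_mark \<beta> (Suc i)}. delaunay (\<beta> s) = T)"

primrec label_sequence :: "(real \<Rightarrow> (real^3)^'n) \<Rightarrow>
    ('n set \<Rightarrow> 'x::linordered_ab_group_add) \<Rightarrow> nat \<Rightarrow> ('n set \<Rightarrow> 'x)" where
  "label_sequence \<beta> A 0 = A"
| "label_sequence \<beta> A (Suc i) =
     flip_labels (flip_sequence \<beta> i) (flip_sequence \<beta> (Suc i)) (label_sequence \<beta> A i)"

text \<open>\<open>X\<^sup>N\<close> is the set \<open>{..<N} \<rightarrow>\<^sub>E UNIV\<close>. The bijection \<open>e\<close> from \<open>{..<N}\<close> to the edges of
  the first triangulation is the fixed ordering of these edges; it is used to read both the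
  initial and the final labeling as elements of \<open>X\<^sup>N\<close>.\<close>

definition f_n :: "nat \<Rightarrow> (nat \<Rightarrow> 'n set) \<Rightarrow> (nat \<Rightarrow> 'x::linordered_ab_group_add) \<Rightarrow>
    (real \<Rightarrow> (real^3)^'n) \<Rightarrow> (nat \<Rightarrow> 'x)" where
  "f_n N e A1 \<beta> = (\<lambda>k\<in>{..<N}.
     label_sequence \<beta> (\<lambda>E. A1 (inv_into {..<N} e E)) (card (critical_times \<beta>)) (e k))"

end

theory Submission
  imports Defs
begin

text \<open>The Delaunay triangulation is the boundary of the convex hull, so it is governed by the signs of
  the volumes of the tetrahedra spanned by four points. Near an arbitrary configuration \<open>z\<close> the
  Delaunay triangulations only subdivide the cocircular faces of \<open>z\<close>. A labeling of a triangulation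
  of a polygon extends uniquely to a function on all diagonals that satisfies the tropical Ptolemy
  relation for every cyclic quadruple, and the flips of labels merely restrict this function to
  other triangulations. Hence labels have no monodromy near \<open>z\<close>, whatever the degeneracy of \<open>z\<close>, and
  a compactness argument shows that sufficiently close generic braids have the same final labeling.
  Generic braids are dense, because a braid can be approximated by moving one point at a time along
  arcs that meet the circles through the other points transversally. Therefore the final labeling
  is locally constant along a homotopy.\<close>

text \<open>A homotopy between generic braids may run through arbitrarily degenerate configurations,
  and it is not put into general position. In place of pentagon and commutation relations on strata
  of codimension two, labels are compared at any configuration \<open>z\<close> through a family of
  Ptolemy functions, one for each unit normal: the tropical analogue of lambda lengths of an ideal
  polygon. The obstacle is that such a family belongs to its centre \<open>z\<close>, while the
  centre has to move along the braid; \<open>relink\<close> changes centres by carrying labels along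
  a short transversal path that is near both. Two braids are compared by the relation
  \<open>link\<close> and not by equality of labels, since their triangulations at the same time may
  differ. The compactness arguments are \<open>Bolzano\<close> inductions on subintervals. A single
  point moves along a line in stereographic coordinates, where every circle becomes a quadratic
  equation in time: a nonzero discriminant is transversality, and the exceptional targets form a
  closed set with empty interior.\<close>

definition nrm :: "(real^3)^'n \<Rightarrow> 'n \<Rightarrow> 'n \<Rightarrow> 'n \<Rightarrow> real^3" where
  "nrm z a b c = cross3 (z $ b - z $ a) (z $ c - z $ a)"

definition vol :: "(real^3)^'n \<Rightarrow> 'n \<Rightarrow> 'n \<Rightarrow> 'n \<Rightarrow> 'n \<Rightarrow> real" where
  "vol z a b c x = nrm z a b c \<bullet> (z $ x - z $ a)"

text \<open>\<open>vol z a b c x\<close> is six times a signed volume, and \<open>otri z a b c\<close> says that the points \<open>a, b, c\<close>,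
  in counterclockwise order seen from outside, lie on a supporting plane of the convex hull.\<close>
definition otri :: "(real^3)^'n \<Rightarrow> 'n \<Rightarrow> 'n \<Rightarrow> 'n \<Rightarrow> bool" where
  "otri z a b c \<longleftrightarrow> a \<noteq> b \<and> b \<noteq> c \<and> a \<noteq> c \<and> (\<forall>x. vol z a b c x \<le> 0)"

definition general_position :: "(real^3)^'n \<Rightarrow> bool" where
  "general_position z \<longleftrightarrow> (\<forall>a b c x. distinct [a, b, c, x] \<longrightarrow> vol z a b c x \<noteq> 0)"

definition is_critical :: "(real^3)^'n \<Rightarrow> bool" where
  "is_critical z \<longleftrightarrow> (\<exists>C. critical_circle z C)"

section \<open>Algebra of normals and signed volumes\<close>

lemma nrm_rot: "nrm z b c a = nrm z a b c"
  unfolding nrm_def by (simp add: cross3_simps forall_3)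

lemma nrm_swap: "nrm z b a c = - nrm z a b c"
  unfolding nrm_def by (simp add: cross3_simps forall_3)

lemma nrm_swap': "nrm z a c b = - nrm z a b c"
  unfolding nrm_def by (simp add: cross3_simps forall_3)

lemma vol_rot: "vol z b c a x = vol z a b c x"
  unfolding vol_def nrm_def by (simp add: cross3_simps)

lemma vol_swap: "vol z b a c x = - vol z a b c x"
  unfolding vol_def nrm_def by (simp add: cross3_simps)

lemma vol_swap_last: "vol z a b x c = - vol z a b c x"
  unfolding vol_def nrm_def by (simp add: cross3_simps)

lemma vol_swap_mid: "vol z a c b x = - vol z a b c x"
  unfolding vol_def nrm_def by (simp add: cross3_simps)

lemma vol_refl [simp]: "vol z a b c a = 0" "vol z a b c b = 0" "vol z a b c c = 0"
  unfolding vol_def nrm_def by (simp_all add: cross3_simps)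

lemma vol_base:
  "nrm z a b c \<bullet> (z $ x - z $ b) = vol z a b c x"
  "nrm z a b c \<bullet> (z $ x - z $ c) = vol z a b c x"
  unfolding vol_def nrm_def by (simp_all add: cross3_simps)

lemma nrm_inner:
  "nrm z a b c \<bullet> (z $ b) = nrm z a b c \<bullet> (z $ a)"
  "nrm z a b c \<bullet> (z $ c) = nrm z a b c \<bullet> (z $ a)"
  unfolding nrm_def by (simp_all add: cross3_simps)

lemma otri_rot: "otri z a b c \<Longrightarrow> otri z b c a"
  unfolding otri_def by (auto simp: vol_rot)

lemma conf_norm: "z \<in> configuration_space \<Longrightarrow> z $ i \<bullet> z $ i = 1"
  by (simp add: configuration_space_def dot_square_norm)

lemma conf_norm': "z \<in> configuration_space \<Longrightarrow> norm (z $ i) = 1"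
  by (simp add: configuration_space_def)

lemma conf_inj: "z \<in> configuration_space \<Longrightarrow> z $ i = z $ j \<longleftrightarrow> i = j"
  by (auto simp: configuration_space_def)

text \<open>A line meets the sphere in at most two points: \<open>v = b - a\<close> and its multiple
  by \<open>k\<close> both solve \<open>2 * (a \<bullet> v) + v \<bullet> v = 0\<close>, which
  forces \<open>k = 0\<close> or \<open>k = 1\<close>.\<close>

lemma sphere_not_collinear:
  fixes a b c :: "'a::real_inner"
  assumes "a \<bullet> a = 1" "b \<bullet> b = 1" "c \<bullet> c = 1" "b \<noteq> a" "c \<noteq> a" "c \<noteq> b"
  shows "c - a \<noteq> k *\<^sub>R (b - a)"
proof
  assume h: "c - a = k *\<^sub>R (b - a)"
  have 1: "2 * (a \<bullet> (b - a)) + (b - a) \<bullet> (b - a) = 0"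
    using assms by (simp add: inner_diff_left inner_diff_right inner_commute)
  have "2 * (a \<bullet> (c - a)) + (c - a) \<bullet> (c - a) = 0"
    using assms by (simp add: inner_diff_left inner_diff_right inner_commute)
  then have "2 * k * (a \<bullet> (b - a)) + k * k * ((b - a) \<bullet> (b - a)) = 0"
    unfolding h by simp
  then have "k * (k - 1) * ((b - a) \<bullet> (b - a)) = 0"
    using 1 by algebra
  then have "k = 0 \<or> k = 1" using assms by auto
  then show False using h assms by auto
qed

lemma cross3_sphere_nonzero:
  fixes a b c :: "real^3"
  assumes "norm a = 1" "norm b = 1" "norm c = 1" "b \<noteq> a" "c \<noteq> a" "c \<noteq> b"
  shows "cross3 (b - a) (c - a) \<noteq> 0"
  using sphere_not_collinear[of a b c] assms
  unfolding cross_eq_0 collinear_lemma by (auto simp: dot_square_norm)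

lemma nrm_nonzero:
  assumes "z \<in> configuration_space" "a \<noteq> b" "b \<noteq> c" "a \<noteq> c"
  shows "nrm z a b c \<noteq> 0"
  unfolding nrm_def using assms conf_inj[OF assms(1)] conf_norm'[OF assms(1)]
  by (intro cross3_sphere_nonzero) auto

text \<open>With \<open>N = cross3 p q\<close>, the part of \<open>v\<close> orthogonal to
  \<open>N\<close> is a multiple of \<open>cross3 (cross3 N v) N\<close>, and
  \<open>cross3 N v\<close> is a combination of \<open>p\<close> and \<open>q\<close> whose
  coefficients vanish by hypothesis.\<close>

lemma orthogonal_parallel_cross:
  fixes v p q :: "real^3"
  assumes "v \<bullet> p = 0" "v \<bullet> q = 0" "cross3 p q \<noteq> 0"
  shows "v = ((v \<bullet> cross3 p q) / (cross3 p q \<bullet> cross3 p q)) *\<^sub>R cross3 p q"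
proof -
  let ?N = "cross3 p q"
  have "(?N \<bullet> ?N) *\<^sub>R v - (v \<bullet> ?N) *\<^sub>R ?N = cross3 (cross3 ?N v) ?N"
    by (simp add: cross3_simps forall_3)
  also have "cross3 ?N v = (v \<bullet> p) *\<^sub>R q - (v \<bullet> q) *\<^sub>R p"
    by (simp add: cross3_simps forall_3)
  finally have "(?N \<bullet> ?N) *\<^sub>R v = (v \<bullet> ?N) *\<^sub>R ?N" using assms by simp
  moreover have "?N \<bullet> ?N \<noteq> 0" using assms by simp
  ultimately show ?thesis
    by (metis (no_types, lifting) divide_inverse_commute scaleR_left_imp_eq scaleR_scaleR
        right_inverse scaleR_one)
qed

text \<open>Used to recognize normals: a functional that is constant on three points of a face is a
  multiple of their normal, so a unit normal is determined up to sign by three points of its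
  plane.\<close>

lemma parallel_nrm:
  assumes z: "z \<in> configuration_space" and d: "a \<noteq> b" "b \<noteq> c" "a \<noteq> c"
    and v: "v \<bullet> z $ b = v \<bullet> z $ a" "v \<bullet> z $ c = v \<bullet> z $ a"
  obtains k where "v = k *\<^sub>R nrm z a b c"
proof (rule that)
  show "v = ((v \<bullet> nrm z a b c) / (nrm z a b c \<bullet> nrm z a b c)) *\<^sub>R nrm z a b c"
    using nrm_nonzero[OF z d] v unfolding nrm_def
    by (intro orthogonal_parallel_cross) (simp_all add: inner_diff_right)
qed

lemma supporting_otri:
  assumes z: "z \<in> configuration_space" and d: "a \<noteq> b" "b \<noteq> c" "a \<noteq> c"
    and v: "v \<noteq> 0" "v \<bullet> z $ b = v \<bullet> z $ a" "v \<bullet> z $ c = v \<bullet> z $ a"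
    and le: "\<And>x. v \<bullet> z $ x \<le> v \<bullet> z $ a"
  shows "otri z a b c \<or> otri z b a c"
proof -
  obtain k where k: "v = k *\<^sub>R nrm z a b c" using parallel_nrm[OF z d v(2,3)] .
  have *: "k * vol z a b c x \<le> 0" for x
    using le[of x] unfolding k vol_def by (simp add: inner_diff_right algebra_simps)
  have "k \<noteq> 0" using k v by auto
  then consider "k > 0" | "k < 0" by linarith
  then show ?thesis
  proof cases
    case 1 then show ?thesis using * d unfolding otri_def by (auto simp: mult_le_0_iff)
  next
    case 2
    then have "vol z b a c x \<le> 0" for x using *[of x] by (auto simp: mult_le_0_iff vol_swap[of z b a c])
    then show ?thesis using d unfolding otri_def by auto
  qed
qed

text \<open>A plane through two distinct points is not tangent: at height 1 or -1 the equality case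
  of Cauchy-Schwarz leaves only one point of the sphere.\<close>

lemma circle_height_less_one:
  fixes u :: "real^3"
  assumes z: "z \<in> configuration_space" and "a \<noteq> b" and u1: "norm u = 1"
    and eq: "u \<bullet> z $ b = u \<bullet> z $ a"
  shows "\<bar>u \<bullet> z $ a\<bar> < 1"
proof -
  have "\<bar>u \<bullet> z $ a\<bar> \<le> 1" using Cauchy_Schwarz_ineq2[of u "z $ a"] u1 conf_norm'[OF z] by simp
  moreover have False if h: "\<bar>u \<bullet> z $ a\<bar> = 1"
  proof -
    have "z $ i = (u \<bullet> z $ a) *\<^sub>R u" if "u \<bullet> z $ i = u \<bullet> z $ a" for i
    proof -
      have "(z $ i - (u \<bullet> z $ a) *\<^sub>R u) \<bullet> (z $ i - (u \<bullet> z $ a) *\<^sub>R u)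
         = z $ i \<bullet> z $ i - 2 * (u \<bullet> z $ a) * (u \<bullet> z $ i) + (u \<bullet> z $ a)^2 * (u \<bullet> u)"
        by (simp add: inner_diff_left inner_diff_right inner_commute power2_eq_square algebra_simps)
      also have "\<dots> = 0" using h that conf_norm[OF z] u1
        by (auto simp: dot_square_norm power2_eq_square abs_if split: if_splits)
      finally show ?thesis by simp
    qed
    from this[of a] this[of b] have "z $ a = z $ b" by (metis eq)
    then show False using assms(2) conf_inj[OF z] by auto
  qed
  ultimately show ?thesis by (metis order_le_less)
qed

section \<open>Delaunay triangles and critical circles as supporting planes\<close>

lemma card_4_distinct:
  assumes "card Q = 4" obtains i j k x where "Q = {i, j, k, x}" "distinct [i, j, k, x]"
proof -
  obtain i Q' where Q': "Q = insert i Q'" "i \<notin> Q'" "card Q' = 3"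
    using assms card_Suc_eq[of Q 3] by auto
  obtain j k x where "Q' = {j, k, x}" "j \<noteq> k" "k \<noteq> x" "j \<noteq> x" using Q'(3) card_3_iff by metis
  then show ?thesis using Q' by (intro that) auto
qed

lemma coplanar_vol:
  assumes z: "z \<in> configuration_space" and d: "distinct [i, j, k, x]" and u0: "u \<noteq> 0"
    and u: "u \<bullet> z $ j = u \<bullet> z $ i" "u \<bullet> z $ k = u \<bullet> z $ i" "u \<bullet> z $ x = u \<bullet> z $ i"
  shows "vol z i j k x = 0"
proof -
  have ijk: "i \<noteq> j" "j \<noteq> k" "i \<noteq> k" using d by auto
  obtain k' where k': "u = k' *\<^sub>R nrm z i j k" using parallel_nrm[OF z ijk u(1,2)] .
  then have "k' * vol z i j k x = 0" "k' \<noteq> 0" using u u0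
    by (auto simp: vol_def inner_diff_right algebra_simps)
  then show ?thesis by simp
qed

text \<open>Dictionary between \<open>otri\<close> and circles: the plane of an outward triangle,
  written with its unit normal, cuts out a genuine circle with an empty disc, and the points on the
  circle are the zeros of \<open>vol z a b c\<close>.\<close>

lemma otri_circle:
  assumes z: "z \<in> configuration_space" and o: "otri z a b c"
  defines "u \<equiv> sgn (nrm z a b c)"
  shows "norm u = 1" "\<bar>u \<bullet> z $ a\<bar> < 1" "\<And>x. u \<bullet> z $ x \<le> u \<bullet> z $ a"
    "\<And>x. u \<bullet> z $ x = u \<bullet> z $ a \<longleftrightarrow> vol z a b c x = 0"
proof -
  have d: "a \<noteq> b" "b \<noteq> c" "a \<noteq> c" using o by (auto simp: otri_def)
  note nz = nrm_nonzero[OF z d]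
  show u1: "norm u = 1" using nz by (simp add: u_def norm_sgn)
  have *: "u \<bullet> z $ x - u \<bullet> z $ a = vol z a b c x / norm (nrm z a b c)" for x
    unfolding u_def vol_def sgn_div_norm by (simp add: inner_diff_right divide_inverse algebra_simps)
  show "u \<bullet> z $ x \<le> u \<bullet> z $ a" for x
  proof -
    have "vol z a b c x \<le> 0" using o by (auto simp: otri_def)
    then have "vol z a b c x / norm (nrm z a b c) \<le> 0" by (simp add: divide_nonpos_nonneg)
    then show ?thesis using *[of x] by linarith
  qed
  show "u \<bullet> z $ x = u \<bullet> z $ a \<longleftrightarrow> vol z a b c x = 0" for x
    using *[of x] nz by (metis divide_eq_0_iff eq_iff_diff_eq_0 norm_eq_zero)
  show "\<bar>u \<bullet> z $ a\<bar> < 1" using circle_height_less_one[OF z d(1) u1] *[of b] by simp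
qed

text \<open>A disc \<open>disc u c\<close> without points means that all points satisfy
  \<open>u \<bullet> x \<le> c\<close>, so empty discs are supporting planes; the two orientations
  of a triple account for the two discs of its circle.\<close>

lemma delaunay_triangles_eq:
  assumes z: "z \<in> configuration_space"
  shows "delaunay_triangles z = {{a, b, c} |a b c. otri z a b c}"
proof (intro equalityI subsetI)
  fix D assume "D \<in> delaunay_triangles z"
  then obtain u c where D: "card D = 3" "norm u = 1" "\<bar>c\<bar> < 1" "\<forall>i\<in>D. z $ i \<in> circle u c"
    "\<forall>i. z $ i \<notin> disc u c" by (auto simp: delaunay_triangles_def)
  obtain i j k where ijk: "D = {i, j, k}" "i \<noteq> j" "j \<noteq> k" "i \<noteq> k" using D(1) card_3_iff by metis
  have "u \<bullet> z $ j = u \<bullet> z $ i" "u \<bullet> z $ k = u \<bullet> z $ i"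
    using D(4) ijk(1) by (auto simp: circle_def)
  moreover have "u \<bullet> z $ x \<le> u \<bullet> z $ i" for x
    using D(4,5) ijk(1) conf_norm'[OF z] by (auto simp: circle_def disc_def not_less)
  moreover have "u \<noteq> 0" using D(2) by auto
  ultimately have "otri z i j k \<or> otri z j i k" using supporting_otri[OF z ijk(2-4)] by blast
  then show "D \<in> {{a, b, c} |a b c. otri z a b c}" using ijk(1) by (auto simp: insert_commute)
next
  fix D assume "D \<in> {{a, b, c} |a b c. otri z a b c}"
  then obtain a b c where D: "D = {a, b, c}" and o: "otri z a b c" by auto
  define u where "u = sgn (nrm z a b c)"
  note oc = otri_circle[OF z o, folded u_def]
  have "card D = 3" using o by (simp add: D otri_def)
  moreover have "\<forall>i\<in>D. z $ i \<in> circle u (u \<bullet> z $ a)"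
    using oc(4) conf_norm'[OF z] by (auto simp: D circle_def)
  moreover have "\<forall>i. z $ i \<notin> disc u (u \<bullet> z $ a)"
    using oc(3) by (auto simp: disc_def not_less)
  ultimately show "D \<in> delaunay_triangles z"
    unfolding delaunay_triangles_def using oc(1,2) by blast
qed

lemma is_critical_iff:
  fixes z :: "(real^3)^'n"
  assumes z: "z \<in> configuration_space"
  shows "is_critical z \<longleftrightarrow> (\<exists>a b c x. otri z a b c \<and> x \<notin> {a, b, c} \<and> vol z a b c x = 0)"
proof
  assume "is_critical z"
  then obtain u c C where C: "card {i. z $ i \<in> C} \<ge> 4" "norm u = 1" "\<bar>c\<bar> < 1" "C = circle u c"
    "\<forall>i. z $ i \<notin> disc u c" unfolding is_critical_def critical_circle_def by blast
  obtain Q where Q: "Q \<subseteq> {i. z $ i \<in> C}" "card Q = 4"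
    using obtain_subset_with_card_n[OF C(1)] by blast
  then obtain i j k x where Qe: "Q = {i, j, k, x}" and d: "distinct [i, j, k, x]"
    using card_4_distinct by metis
  have mem: "z $ i \<in> circle u c" "z $ j \<in> circle u c" "z $ k \<in> circle u c" "z $ x \<in> circle u c"
    using Q Qe C by auto
  have le: "u \<bullet> z $ y \<le> u \<bullet> z $ i" for y
    using C(5) mem conf_norm'[OF z] by (auto simp: circle_def disc_def not_less)
  have ijk: "i \<noteq> j" "j \<noteq> k" "i \<noteq> k" using d by auto
  have u: "u \<bullet> z $ j = u \<bullet> z $ i" "u \<bullet> z $ k = u \<bullet> z $ i" "u \<noteq> 0" "u \<bullet> z $ x = u \<bullet> z $ i"
    using mem C(2) by (auto simp: circle_def)
  have "vol z i j k x = 0" using coplanar_vol[OF z d u(3,1,2,4)] .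
  then have "vol z i j k x = 0" "vol z j i k x = 0" by (auto simp: vol_swap[of z j i k])
  moreover have "x \<notin> {i, j, k}" using d by auto
  ultimately show "\<exists>a b c x. otri z a b c \<and> x \<notin> {a, b, c} \<and> vol z a b c x = 0"
    using supporting_otri[OF z ijk u(3,1,2) le] by blast
next
  assume "\<exists>a b c x. otri z a b c \<and> x \<notin> {a, b, c} \<and> vol z a b c x = 0"
  then obtain a b c x where o: "otri z a b c" and x: "x \<notin> {a, b, c}" and v: "vol z a b c x = 0"
    by blast
  define u where "u = sgn (nrm z a b c)"
  note oc = otri_circle[OF z o, folded u_def]
  define C where "C = circle u (u \<bullet> z $ a)"
  have "{a, b, c, x} \<subseteq> {i. z $ i \<in> C}"
    using oc(4) v conf_norm'[OF z] by (auto simp: C_def circle_def)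
  moreover have "card {a, b, c, x} = 4" using o x by (auto simp: otri_def)
  ultimately have "card {i. z $ i \<in> C} \<ge> 4" by (metis card_mono finite)
  moreover have "\<forall>i. z $ i \<notin> disc u (u \<bullet> z $ a)"
    using oc(3) by (auto simp: disc_def not_less)
  ultimately show "is_critical z" unfolding is_critical_def critical_circle_def using oc(1,2) C_def by blast
qed

lemma no_four_cocircular_iff:
  assumes z: "z \<in> configuration_space"
  shows "no_four_cocircular z \<longleftrightarrow> general_position z"
proof -
  have "(\<exists>Q C. card Q = 4 \<and> is_circle C \<and> (\<forall>i\<in>Q. z $ i \<in> C))
     \<longleftrightarrow> (\<exists>a b c x. distinct [a, b, c, x] \<and> vol z a b c x = 0)" (is "?L = ?R")
  proof
    assume ?L
    then obtain Q u c where Q: "card Q = 4" "norm u = 1" "\<forall>i\<in>Q. z $ i \<in> circle u c"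
      unfolding is_circle_def by blast
    then obtain i j k x where Qe: "Q = {i, j, k, x}" and d: "distinct [i, j, k, x]"
      using card_4_distinct by metis
    have ijk: "i \<noteq> j" "j \<noteq> k" "i \<noteq> k" using d by auto
    have u: "u \<bullet> z $ j = u \<bullet> z $ i" "u \<bullet> z $ k = u \<bullet> z $ i" "u \<noteq> 0" "u \<bullet> z $ x = u \<bullet> z $ i"
      using Q Qe by (auto simp: circle_def)
    have "vol z i j k x = 0" using coplanar_vol[OF z d u(3,1,2,4)] .
    then show ?R using d by auto
  next
    assume ?R
    then obtain a b c x where d: "distinct [a, b, c, x]" and v: "vol z a b c x = 0" by blast
    define u where "u = sgn (nrm z a b c)"
    have nz: "nrm z a b c \<noteq> 0" using d by (intro nrm_nonzero[OF z]) auto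
    have u1: "norm u = 1" using nz by (simp add: u_def norm_sgn)
    have *: "u \<bullet> z $ y - u \<bullet> z $ a = vol z a b c y / norm (nrm z a b c)" for y
      unfolding u_def vol_def sgn_div_norm by (simp add: inner_diff_right divide_inverse algebra_simps)
    have eq: "u \<bullet> z $ b = u \<bullet> z $ a" "u \<bullet> z $ c = u \<bullet> z $ a" "u \<bullet> z $ x = u \<bullet> z $ a"
      using *[of b] *[of c] *[of x] v by auto
    have "\<bar>u \<bullet> z $ a\<bar> < 1" using circle_height_less_one[OF z _ u1 eq(1)] d by simp
    then have "is_circle (circle u (u \<bullet> z $ a))" using u1 unfolding is_circle_def by blast
    moreover have "\<forall>i\<in>{a, b, c, x}. z $ i \<in> circle u (u \<bullet> z $ a)"
      using eq conf_norm'[OF z] by (auto simp: circle_def)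
    moreover have "card {a, b, c, x} = 4" using d by auto
    ultimately show ?L by blast
  qed
  then show ?thesis unfolding no_four_cocircular_def general_position_def by blast
qed

lemma general_position_not_crit:
  assumes "z \<in> configuration_space" "general_position z"
  shows "\<not> is_critical z"
  using assms by (auto simp: is_critical_iff general_position_def otri_def)

section \<open>Edges\<close>

text \<open>Central projection of a segment with direction orthogonal to \<open>N\<close>. If two
  projections agree, the vectors differ by a factor \<open>k\<close>, and pairing with
  \<open>N\<close> gives \<open>k = 1\<close>.\<close>

lemma arc_sgn_segment:
  fixes N w :: "real^3"
  assumes "N \<noteq> 0" "w \<noteq> 0" "w \<bullet> N = 0"
  shows "arc (\<lambda>t. sgn (N + t *\<^sub>R w))"
proof -
  have nz: "N + t *\<^sub>R w \<noteq> 0" for t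
  proof
    assume "N + t *\<^sub>R w = 0"
    then have "(N + t *\<^sub>R w) \<bullet> N = 0" by simp
    then show False using assms by (simp add: inner_add_left)
  qed
  have "inj_on (\<lambda>t. sgn (N + t *\<^sub>R w)) {0..1}"
  proof (rule inj_onI)
    fix s t assume eq: "sgn (N + s *\<^sub>R w) = sgn (N + t *\<^sub>R w)"
    define k where "k = norm (N + s *\<^sub>R w) / norm (N + t *\<^sub>R w)"
    have "N + s *\<^sub>R w = norm (N + s *\<^sub>R w) *\<^sub>R sgn (N + s *\<^sub>R w)"
      using nz[of s] by (simp add: sgn_div_norm)
    then have k: "N + s *\<^sub>R w = k *\<^sub>R (N + t *\<^sub>R w)"
      unfolding eq k_def by (simp add: sgn_div_norm divide_inverse)
    then have "(N + s *\<^sub>R w) \<bullet> N = (k *\<^sub>R (N + t *\<^sub>R w)) \<bullet> N" by simp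
    then have "k = 1" using assms by (simp add: inner_add_left)
    then have "(s - t) *\<^sub>R w = 0" using k by (simp add: algebra_simps)
    then show "s = t" using assms by simp
  qed
  moreover have "path (\<lambda>t. sgn (N + t *\<^sub>R w))"
    unfolding path_def using nz by (intro continuous_on_sgn continuous_intros) auto
  ultimately show ?thesis unfolding arc_def by simp
qed

lemma dist_le_iff_inner:
  fixes x y w :: "'a::real_inner"
  assumes "norm y = norm w"
  shows "dist x y \<le> dist x w \<longleftrightarrow> x \<bullet> w \<le> x \<bullet> y"
proof -
  have "y \<bullet> y = w \<bullet> w" using assms by (metis power2_norm_eq_inner)
  then show ?thesis
    unfolding dist_norm norm_le
    by (simp add: inner_diff_left inner_diff_right inner_commute)
qed

lemma voronoi_cell_iff:
  assumes z: "z \<in> configuration_space"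
  shows "x \<in> voronoi_cell z i \<longleftrightarrow> norm x = 1 \<and> (\<forall>j. x \<bullet> z $ j \<le> x \<bullet> z $ i)"
proof -
  have "dist x (z $ i) \<le> dist x (z $ j) \<longleftrightarrow> x \<bullet> z $ j \<le> x \<bullet> z $ i" for j
    by (rule dist_le_iff_inner) (simp add: conf_norm'[OF z])
  then show ?thesis unfolding voronoi_cell_def by (auto, metis order_refl)
qed

text \<open>The direction of \<open>N\<close> is the Voronoi vertex dual to the triangle. Tilting
  \<open>N\<close> about the edge \<open>ab\<close> away from \<open>c\<close> keeps the plane
  supporting for a short time, because all other points lie strictly below it; the tilted normals
  trace an arc in both cells.\<close>

lemma otri_edge:
  fixes z :: "(real^3)^'n"
  assumes z: "z \<in> configuration_space" and nc: "\<not> is_critical z" and o: "otri z a b c"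
  shows "{a, b} \<in> delaunay_edges z"
proof -
  have d: "a \<noteq> b" "b \<noteq> c" "a \<noteq> c" using o by (auto simp: otri_def)
  define N where "N = nrm z a b c"
  \<comment> \<open>Adding a positive multiple of \<open>w\<close> keeps \<open>a\<close> and
    \<open>b\<close> at equal height and lowers \<open>c\<close> relative to them.\<close>
  define w where "w = cross3 (z $ b - z $ a) N"
  have N0: "N \<noteq> 0" using nrm_nonzero[OF z d] by (simp add: N_def)
  have wN: "w \<bullet> N = 0" by (simp add: w_def dot_cross_self)
  have wb: "w \<bullet> (z $ b - z $ a) = 0" by (simp add: w_def dot_cross_self)
  have wc: "w \<bullet> (z $ c - z $ a) = - (N \<bullet> N)"
    unfolding w_def N_def nrm_def by (simp add: cross3_simps)
  then have w0: "w \<noteq> 0" using N0 by auto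
  have strict: "N \<bullet> (z $ x - z $ a) < 0" if "x \<notin> {a, b, c}" for x
    using nc o that unfolding is_critical_iff[OF z] otri_def N_def vol_def by (metis order_le_less)
  have ex: "\<exists>e>0. \<forall>t. 0 \<le> t \<and> t \<le> e \<longrightarrow> (N + t *\<^sub>R w) \<bullet> (z $ x - z $ a) \<le> 0" for x
  proof (cases "x \<in> {a, b, c}")
    case True
    have "(N + t *\<^sub>R w) \<bullet> (z $ x - z $ a) \<le> 0" if "0 \<le> t" for t
      using True wb wc that N0 unfolding N_def
      by (auto simp: inner_add_left vol_def[symmetric] )
    then show ?thesis by (intro exI[of _ 1]) auto
  next
    case False
    define A B where "A = N \<bullet> (z $ x - z $ a)" and "B = w \<bullet> (z $ x - z $ a)"
    have A: "A < 0" using strict[OF False] by (simp add: A_def)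
    have "A + t * B \<le> 0" if "0 \<le> t" "t \<le> -A / (\<bar>B\<bar> + 1)" for t
    proof -
      have "t * (\<bar>B\<bar> + 1) \<le> -A" using that(2) by (subst (asm) pos_le_divide_eq) auto
      moreover have "t * B \<le> t * (\<bar>B\<bar> + 1)" using that by (intro mult_left_mono) auto
      ultimately show ?thesis by linarith
    qed
    moreover have "-A / (\<bar>B\<bar> + 1) > 0" using A by (intro divide_pos_pos) auto
    ultimately show ?thesis
      by (intro exI[of _ "-A / (\<bar>B\<bar> + 1)"]) (auto simp: inner_add_left A_def B_def)
  qed
  then obtain e where e: "\<And>x. e x > 0"
    "\<And>x t. 0 \<le> t \<Longrightarrow> t \<le> e x \<Longrightarrow> (N + t *\<^sub>R w) \<bullet> (z $ x - z $ a) \<le> 0"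
    by metis
  define \<tau> where "\<tau> = Min (range e)"
  have \<tau>0: "\<tau> > 0" using e(1) by (auto simp: \<tau>_def)
  have \<tau>: "(N + t *\<^sub>R w) \<bullet> (z $ x - z $ a) \<le> 0" if "0 \<le> t" "t \<le> \<tau>" for t x
    using that e(2)[of t x] by (auto simp: \<tau>_def)
  define g where "g = (\<lambda>t. sgn (N + t *\<^sub>R (\<tau> *\<^sub>R w)))"
  have "arc g" unfolding g_def using N0 w0 \<tau>0 wN by (intro arc_sgn_segment) auto
  moreover have "path_image g \<subseteq> voronoi_cell z a \<inter> voronoi_cell z b"
  proof -
    have "g t \<in> voronoi_cell z a \<inter> voronoi_cell z b" if t: "0 \<le> t" "t \<le> 1" for t
    proof -
      have le: "(N + (t * \<tau>) *\<^sub>R w) \<bullet> (z $ x - z $ a) \<le> 0" for x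
        using t \<tau>0 by (intro \<tau>) (auto simp: mult_left_le_one_le)
      have nz: "N + (t * \<tau>) *\<^sub>R w \<noteq> 0"
      proof
        assume "N + (t * \<tau>) *\<^sub>R w = 0"
        then have "(N + (t * \<tau>) *\<^sub>R w) \<bullet> N = 0" by simp
        then show False using N0 wN by (simp add: inner_add_left)
      qed
      have eq: "(N + (t * \<tau>) *\<^sub>R w) \<bullet> z $ b = (N + (t * \<tau>) *\<^sub>R w) \<bullet> z $ a"
        using wb by (simp add: inner_add_left inner_diff_right N_def nrm_inner)
      have le': "(N + (t * \<tau>) *\<^sub>R w) \<bullet> z $ x \<le> (N + (t * \<tau>) *\<^sub>R w) \<bullet> z $ a" for x
        using le[of x] by (simp add: inner_diff_right)
      have "g t \<bullet> z $ x \<le> g t \<bullet> z $ a" for x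
        using le'[of x] unfolding g_def sgn_div_norm
        by (simp add: mult.commute mult_left_mono)
      moreover have "g t \<bullet> z $ b = g t \<bullet> z $ a"
        using eq unfolding g_def sgn_div_norm by simp
      moreover have "norm (g t) = 1" using nz by (simp add: g_def norm_sgn)
      ultimately show ?thesis by (simp add: voronoi_cell_iff[OF z])
    qed
    then show ?thesis unfolding path_image_def by auto
  qed
  ultimately show ?thesis unfolding delaunay_edges_def using d by blast
qed

lemma card_3_le: "card {i, j, k} \<le> 3"
  by (auto simp: card_insert_if)

text \<open>Two independent normals supporting an edge span a pencil of planes through it; rotating within
  the pencil until a further vertex is hit produces a triangle.\<close>
lemma pencil_otri:
  fixes z :: "(real^3)^'n" and q r :: "real^3"
  assumes z: "z \<in> configuration_space" and ij: "i \<noteq> j"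
    and q: "q \<bullet> z $ j = q \<bullet> z $ i" "\<And>x. q \<bullet> z $ x \<le> q \<bullet> z $ i"
    and r: "r \<bullet> z $ j = r \<bullet> z $ i" "\<And>x. r \<bullet> z $ x \<le> r \<bullet> z $ i"
    and ind: "\<And>t. (1 - t) *\<^sub>R q + t *\<^sub>R r \<noteq> 0"
    and pos: "q \<bullet> (z $ k - z $ i) < r \<bullet> (z $ k - z $ i)"
  shows "\<exists>c. otri z i j c \<or> otri z j i c"
proof -
  define P where "P = {x. q \<bullet> (z $ x - z $ i) < r \<bullet> (z $ x - z $ i)}"
  \<comment> \<open>\<open>\<rho> x\<close> is the parameter at which the rotating functional takes
    equal values at \<open>x\<close> and \<open>i\<close>. Only points of \<open>P\<close> rise, and
    the first one to be reached is the third vertex.\<close>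
  define \<rho> where "\<rho> x = - (q \<bullet> (z $ x - z $ i)) / (r \<bullet> (z $ x - z $ i) - q \<bullet> (z $ x - z $ i))" for x
  have P: "finite P" "P \<noteq> {}" using pos by (auto simp: P_def)
  define t where "t = Min (\<rho> ` P)"
  have "t \<in> \<rho> ` P" unfolding t_def using P by (intro Min_in) auto
  then obtain c where c: "c \<in> P" "t = \<rho> c" by auto
  define v where "v = (1 - t) *\<^sub>R q + t *\<^sub>R r"
  have vx: "v \<bullet> (z $ x - z $ i) = q \<bullet> (z $ x - z $ i) + t * (r \<bullet> (z $ x - z $ i) - q \<bullet> (z $ x - z $ i))" for x
    by (simp add: v_def inner_add_left algebra_simps)
  have q': "q \<bullet> (z $ x - z $ i) \<le> 0" and r': "r \<bullet> (z $ x - z $ i) \<le> 0" for x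
    using q(2)[of x] r(2)[of x] by (auto simp: inner_diff_right)
  have t0: "t \<ge> 0" using c q'[of c] by (auto simp: \<rho>_def P_def intro!: divide_nonpos_pos)
  have le: "v \<bullet> (z $ x - z $ i) \<le> 0" for x
  proof (cases "x \<in> P")
    case True
    then have "t \<le> \<rho> x" using P by (simp add: t_def)
    then have "t * (r \<bullet> (z $ x - z $ i) - q \<bullet> (z $ x - z $ i)) \<le> - (q \<bullet> (z $ x - z $ i))"
      using True unfolding \<rho>_def P_def by (subst (asm) pos_le_divide_eq) auto
    then show ?thesis unfolding vx by linarith
  next
    case False
    then have "t * (r \<bullet> (z $ x - z $ i) - q \<bullet> (z $ x - z $ i)) \<le> 0"
      using t0 by (intro mult_nonneg_nonpos) (auto simp: P_def)
    then show ?thesis using q'[of x] unfolding vx by linarith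
  qed
  have "v \<bullet> (z $ c - z $ i) = 0" using c unfolding vx by (simp add: \<rho>_def P_def)
  moreover have "c \<noteq> i" "c \<noteq> j" using c(1) q(1) r(1) by (auto simp: P_def inner_diff_right)
  moreover have "v \<bullet> z $ j = v \<bullet> z $ i" using q r by (simp add: v_def inner_add_left)
  moreover have "v \<noteq> 0" using ind by (simp add: v_def)
  moreover have "v \<bullet> z $ x \<le> v \<bullet> z $ i" for x using le[of x] by (simp add: inner_diff_right)
  ultimately show ?thesis using supporting_otri[OF z ij, of c v] by (auto simp: inner_diff_right)
qed

text \<open>Two distinct, non-antipodal normals on the arc span the pencil of planes through the
  edge, and \<open>pencil_otri\<close> finds a triangle in it.\<close>

lemma edge_otri:
  fixes z :: "(real^3)^'n"
  assumes z: "z \<in> configuration_space" and nc: "\<not> is_critical z" and n: "CARD('n) \<ge> 4"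
    and E: "{i, j} \<in> delaunay_edges z" "i \<noteq> j"
  shows "\<exists>c. otri z i j c \<or> otri z j i c"
proof -
  obtain g i' j' where g: "arc g" "path_image g \<subseteq> voronoi_cell z i' \<inter> voronoi_cell z j'" "{i, j} = {i', j'}"
    using E unfolding delaunay_edges_def by auto
  then have g': "path_image g \<subseteq> voronoi_cell z i \<inter> voronoi_cell z j" by (auto simp: doubleton_eq_iff)
  have cell: "norm (g t) = 1" "g t \<bullet> z $ j = g t \<bullet> z $ i" "\<And>x. g t \<bullet> z $ x \<le> g t \<bullet> z $ i"
    if "t \<in> {0..1}" for t
  proof -
    have "g t \<in> path_image g" using that by (auto simp: path_image_def)
    then have "g t \<in> voronoi_cell z i \<inter> voronoi_cell z j" using g' by blast
    then show "norm (g t) = 1" "g t \<bullet> z $ j = g t \<bullet> z $ i" "\<And>x. g t \<bullet> z $ x \<le> g t \<bullet> z $ i"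
      by (auto simp: voronoi_cell_iff[OF z] intro: antisym)
  qed
  have inj: "g s \<noteq> g t" if "s \<in> {0..1}" "t \<in> {0..1}" "s \<noteq> t" for s t
    using g(1) that unfolding arc_def inj_on_def by blast
  \<comment> \<open>The ends of the arc may be antipodal and then span no plane; the midpoint serves
    in that case.\<close>
  obtain s where s: "s \<in> {0..1}" "g s \<noteq> g 0" "g s \<noteq> - g 0"
  proof (cases "g 1 = - g 0")
    case True
    then show ?thesis using inj[of "1/2" 1] inj[of "1/2" 0] by (intro that[of "1/2"]) auto
  next
    case False
    then show ?thesis using inj[of 1 0] by (intro that[of 1]) auto
  qed
  define q r where "q = g 0" and "r = g s"
  have qr: "norm q = 1" "norm r = 1" "r \<noteq> q" "r \<noteq> - q" using cell s by (auto simp: q_def r_def)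
  have cq: "q \<bullet> z $ j = q \<bullet> z $ i" "\<And>x. q \<bullet> z $ x \<le> q \<bullet> z $ i"
    and cr: "r \<bullet> z $ j = r \<bullet> z $ i" "\<And>x. r \<bullet> z $ x \<le> r \<bullet> z $ i"
    using cell[of 0] cell[of s] s by (simp_all add: q_def r_def)
  have ind: "\<alpha> *\<^sub>R q + \<beta> *\<^sub>R r \<noteq> 0" if "\<alpha> + \<beta> = 1" for \<alpha> \<beta>
  proof
    assume h: "\<alpha> *\<^sub>R q + \<beta> *\<^sub>R r = 0"
    then have "\<alpha> *\<^sub>R q = - (\<beta> *\<^sub>R r)" by (simp add: add_eq_0_iff2)
    then have "norm (\<alpha> *\<^sub>R q) = norm (\<beta> *\<^sub>R r)" by simp
    then have "\<bar>\<alpha>\<bar> = \<bar>\<beta>\<bar>" using qr by simp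
    then have "\<alpha> = \<beta>" "\<alpha> \<noteq> 0" using that by auto
    then have "q + r = 0" using h by (metis scaleR_eq_0_iff scaleR_right_distrib)
    then show False using qr by (simp add: add_eq_0_iff)
  qed
  \<comment> \<open>Otherwise \<open>r - q\<close> would be constant on the whole configuration; all
    points would be coplanar, and with at least four points this is a critical circle.\<close>
  have "\<exists>k. q \<bullet> (z $ k - z $ i) \<noteq> r \<bullet> (z $ k - z $ i)"
  proof (rule ccontr)
    assume "\<not> ?thesis"
    then have "q \<bullet> (z $ k - z $ i) = r \<bullet> (z $ k - z $ i)" for k by blast
    then have eq: "(r - q) \<bullet> z $ k = (r - q) \<bullet> z $ i" for k
      by (simp add: inner_diff_left inner_diff_right algebra_simps)
    have "\<exists>l. l \<notin> {i, j, k}" for k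
    proof (rule ccontr)
      assume "\<not> ?thesis"
      then have "UNIV = {i, j, k}" by blast
      then have "CARD('n) \<le> 3" by (metis card_3_le)
      then show False using n by simp
    qed
    then obtain k l where k: "k \<notin> {i, j}" and l: "l \<notin> {i, j, k}" by (metis insert_iff)
    have rq: "r - q \<noteq> 0" using qr by auto
    have "distinct [i, j, k, l]" using k l E(2) by auto
    then have v: "vol z i j k l = 0" using rq eq by (intro coplanar_vol[OF z, of _ _ _ _ "r - q"]) auto
    have "otri z i j k \<or> otri z j i k"
      using supporting_otri[OF z E(2) _ _ rq eq eq eq_refl[OF eq], of k] k by blast
    moreover have "vol z j i k l = 0" using v vol_swap[of z j i k l] by simp
    moreover have "l \<notin> {j, i, k}" using l by auto
    ultimately show False using v nc l unfolding is_critical_iff[OF z] by blast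
  qed
  then obtain k where "q \<bullet> (z $ k - z $ i) < r \<bullet> (z $ k - z $ i) \<or> r \<bullet> (z $ k - z $ i) < q \<bullet> (z $ k - z $ i)"
    by (meson linorder_neqE)
  then show ?thesis
  proof
    assume "q \<bullet> (z $ k - z $ i) < r \<bullet> (z $ k - z $ i)"
    moreover have "(1 - t) *\<^sub>R q + t *\<^sub>R r \<noteq> 0" for t by (rule ind) simp
    ultimately show ?thesis by (rule pencil_otri[OF z E(2) cq cr, rotated])
  next
    assume "r \<bullet> (z $ k - z $ i) < q \<bullet> (z $ k - z $ i)"
    moreover have "(1 - t) *\<^sub>R r + t *\<^sub>R q \<noteq> 0" for t using ind[of t "1 - t"] by (simp add: add.commute)
    ultimately show ?thesis by (rule pencil_otri[OF z E(2) cr cq, rotated])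
  qed
qed

lemma delaunay_edges_eq:
  fixes z :: "(real^3)^'n"
  assumes z: "z \<in> configuration_space" and nc: "\<not> is_critical z" and n: "CARD('n) \<ge> 4"
  shows "delaunay_edges z = {{a, b} |a b. \<exists>c. otri z a b c}"
proof (intro equalityI subsetI)
  fix E assume E: "E \<in> delaunay_edges z"
  then obtain i j where ij: "E = {i, j}" "i \<noteq> j" unfolding delaunay_edges_def by auto
  then obtain c where "otri z i j c \<or> otri z j i c" using edge_otri[OF z nc n] E by metis
  then show "E \<in> {{a, b} |a b. \<exists>c. otri z a b c}"
  proof
    assume "otri z i j c" then show ?thesis using ij(1) by blast
  next
    assume "otri z j i c" moreover have "E = {j, i}" using ij(1) by (simp add: insert_commute)
    ultimately show ?thesis by blast
  qed
qed (use otri_edge[OF z nc] in auto)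

text \<open>The right-hand side is a function of \<open>otri z\<close>.\<close>
lemma delaunay_eq:
  fixes z :: "(real^3)^'n"
  assumes z: "z \<in> configuration_space" and nc: "\<not> is_critical z" and n: "CARD('n) \<ge> 4"
  shows "delaunay z = ({{a, b} |a b. \<exists>c. otri z a b c}, {{a, b, c} |a b c. otri z a b c})"
  unfolding delaunay_def using delaunay_edges_eq[OF assms] delaunay_triangles_eq[OF z] by simp

section \<open>Tropical Ptolemy functions on a cyclically ordered set\<close>

text \<open>Rotation and antisymmetry hold everywhere, totality and transitivity only on
  \<open>F\<close>. In the intended instance \<open>cy a b c\<close> is positivity of
  \<open>u \<bullet> nrm z a b c\<close>, which makes sense for all indices but is a cyclic order
  only on the vertices of a face.\<close>

locale cyclic_order =
  fixes F :: "'a set" and cy :: "'a \<Rightarrow> 'a \<Rightarrow> 'a \<Rightarrow> bool"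
  assumes fin: "finite F"
    and rot: "cy a b c \<Longrightarrow> cy b c a"
    and asym: "cy a b c \<Longrightarrow> \<not> cy a c b"
    and tot: "a \<in> F \<Longrightarrow> b \<in> F \<Longrightarrow> c \<in> F \<Longrightarrow> distinct [a, b, c] \<Longrightarrow> cy a b c \<or> cy a c b"
    and tran: "a \<in> F \<Longrightarrow> b \<in> F \<Longrightarrow> c \<in> F \<Longrightarrow> e \<in> F \<Longrightarrow> cy a b c \<Longrightarrow> cy a c e \<Longrightarrow> cy a b e"
begin

lemma cy_distinct: "cy a b c \<Longrightarrow> distinct [a, b, c]"
  using rot asym by (metis distinct_length_2_or_more distinct_singleton)

text \<open>The pair \<open>cy a b c\<close>, \<open>cy a c e\<close> encodes the cyclic order
  \<open>a, b, c, e\<close>; the conclusion is the same pair for the quadruple rotated by one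
  step.\<close>

lemma quad_rot:
  assumes "a \<in> F" "b \<in> F" "c \<in> F" "e \<in> F" "cy a b c" "cy a c e"
  shows "cy b c e" "cy b e a"
proof -
  have "cy c a b" "cy c e a" using assms rot by blast+
  then have "cy c e b" using tran[of c e a b] assms by blast
  then show "cy b c e" using rot by blast
  show "cy b e a" using tran[of a b c e] assms rot by blast
qed

text \<open>The tropical analogue of lambda lengths of an ideal polygon with vertex set
  \<open>V\<close>; only values on two-element subsets of \<open>V\<close> matter.\<close>

definition ptolemy :: "'a set \<Rightarrow> ('a set \<Rightarrow> 'x::linordered_ab_group_add) \<Rightarrow> bool" where
  "ptolemy V d \<longleftrightarrow> (\<forall>a\<in>V. \<forall>b\<in>V. \<forall>c\<in>V. \<forall>e\<in>V. cy a b c \<longrightarrow> cy a c e \<longrightarrow>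
     d {a, c} + d {b, e} = max (d {a, b} + d {c, e}) (d {b, c} + d {e, a}))"

lemma ptolemy_triangle: "ptolemy {i, j, k} d"
  unfolding ptolemy_def
proof (intro ballI impI)
  fix a b c e assume m: "a \<in> {i, j, k}" "b \<in> {i, j, k}" "c \<in> {i, j, k}" "e \<in> {i, j, k}"
    and c: "cy a b c" "cy a c e"
  have "a \<noteq> b" "b \<noteq> c" "a \<noteq> c" "a \<noteq> e" "c \<noteq> e" using cy_distinct[OF c(1)] cy_distinct[OF c(2)] by auto
  moreover have "b \<noteq> e" using c asym by blast
  ultimately have False using m by auto
  then show "d {a, c} + d {b, e} = max (d {a, b} + d {c, e}) (d {b, c} + d {e, a})" ..
qed

text \<open>Tropical counterpart of lambda(x,y) / (lambda(a,x) lambda(a,y)), the length of the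
  horocyclic arc at \<open>a\<close> between the geodesics to \<open>x\<close> and \<open>y\<close>.
  Ptolemy's relation at \<open>a\<close> says that these lengths add.\<close>

definition wt :: "('a set \<Rightarrow> 'x::linordered_ab_group_add) \<Rightarrow> 'a \<Rightarrow> 'a \<Rightarrow> 'a \<Rightarrow> 'x" where
  "wt d a x y = d {x, y} - d {a, x} - d {a, y}"

lemma wt_commute: "wt d a x y = wt d a y x"
  unfolding wt_def by (simp add: insert_commute algebra_simps)

text \<open>Relative to a base point \<open>a\<close>, a Ptolemy function is the same as arbitrary values \<open>d {a, x}\<close>
  together with a weight that is max-additive for the linear order starting at \<open>a\<close>.\<close>
lemma ptolemy_imp_wt:
  assumes "ptolemy V d" "a \<in> V" "q \<in> V" "r \<in> V" "s \<in> V" "cy a q r" "cy a r s"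
  shows "wt d a q s = max (wt d a q r) (wt d a r s)"
proof -
  have "d {a, r} + d {q, s} = max (d {a, q} + d {r, s}) (d {q, r} + d {s, a})"
    using assms unfolding ptolemy_def by blast
  then have "d {q, s} = max (d {a, q} + d {r, s}) (d {q, r} + d {s, a}) - d {a, r}"
    by (metis add_diff_cancel_left')
  then show ?thesis unfolding wt_def
    by (simp add: max_diff_distrib_left max.commute insert_commute algebra_simps)
qed

text \<open>The identity \<open>(\<alpha> + \<beta>) * (\<beta> + \<gamma>) = \<alpha> * \<gamma> +
  \<beta> * (\<alpha> + \<beta> + \<gamma>)\<close> read in the max-plus semifield.\<close>

lemma max_additive_quad:
  fixes \<alpha> \<beta> \<gamma> :: "'x::linordered_ab_group_add"
  shows "max \<alpha> \<beta> + max \<beta> \<gamma> = max (\<alpha> + \<gamma>) (\<beta> + max \<alpha> (max \<beta> \<gamma>))"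
  by (simp add: max_add_distrib_left max_add_distrib_right ac_simps)

text \<open>For a quadruple containing \<open>a\<close> the relation is the hypothesis rewritten. A
  quadruple avoiding \<open>a\<close> is rotated until it is increasing in the linear order that
  starts at \<open>a\<close>; its three consecutive weights determine the others, and the relation
  becomes \<open>max_additive_quad\<close>.\<close>

lemma wt_imp_ptol:
  fixes d :: "'a set \<Rightarrow> 'x::linordered_ab_group_add"
  assumes V: "V \<subseteq> F" and a: "a \<in> V"
    and w: "\<And>q r s. q \<in> V \<Longrightarrow> r \<in> V \<Longrightarrow> s \<in> V \<Longrightarrow> cy a q r \<Longrightarrow> cy a r s \<Longrightarrow>
      wt d a q s = max (wt d a q r) (wt d a r s)"
  shows "ptolemy V d"
proof -
  define rel where "rel p q r s \<longleftrightarrow>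
     d {p, r} + d {q, s} = max (d {p, q} + d {r, s}) (d {q, r} + d {s, p})" for p q r s
  have relrot: "rel q r s p \<Longrightarrow> rel p q r s" for p q r s
    unfolding rel_def by (simp add: insert_commute add.commute max.commute)
  have dw: "d {x, y} = wt d a x y + d {a, x} + d {a, y}" for x y by (simp add: wt_def)
  have base: "rel a q r s" if "q \<in> V" "r \<in> V" "s \<in> V" "cy a q r" "cy a r s" for q r s
  proof -
    have "wt d a q s = max (wt d a q r) (wt d a r s)" using w that by blast
    then show ?thesis unfolding rel_def dw[of q s] dw[of r s] dw[of q r]
      by (simp add: insert_commute max_add_distrib_left max_add_distrib_right ac_simps)
  qed
  have lin: "rel p q r s" if m: "p \<in> V" "q \<in> V" "r \<in> V" "s \<in> V"
    and lt: "cy a p q" "cy a p r" "cy a p s" and c: "cy p q r" "cy p r s" for p q r s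
  proof -
    have *: "cy a x y" if "x \<in> V" "y \<in> V" "cy a p x" "cy a p y" "cy p x y" for x y
    proof (rule ccontr)
      assume n: "\<not> cy a x y"
      have "distinct [a, x, y]" using that cy_distinct by fastforce
      then have "cy a y x" using tot[of a x y] n that V a by blast
      then have "cy p y x" using quad_rot[of a p y x] that V a m by blast
      then show False using that asym by blast
    qed
    have qr: "cy a q r" "cy a r s" using * m lt c by blast+
    have qs: "cy a q s" using tran[of a q r s] qr m a V by blast
    have "wt d a p r = max (wt d a p q) (wt d a q r)" "wt d a q s = max (wt d a q r) (wt d a r s)"
      "wt d a p s = max (wt d a p q) (wt d a q s)"
      using w m lt qr qs by blast+
    then have "wt d a p r + wt d a q s = max (wt d a p q + wt d a r s) (wt d a q r + wt d a p s)"
      by (simp only: max_additive_quad)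
    moreover define K where "K = d {a, p} + d {a, q} + d {a, r} + d {a, s}"
    have "d {p, r} + d {q, s} = wt d a p r + wt d a q s + K"
      "d {p, q} + d {r, s} = wt d a p q + wt d a r s + K"
      "d {q, r} + d {s, p} = wt d a q r + wt d a p s + K"
      unfolding dw[of p r] dw[of q s] dw[of p q] dw[of r s] dw[of q r] dw[of s p] K_def
      by (simp_all only: wt_commute[of d a s p] ac_simps)
    ultimately show ?thesis unfolding rel_def by (simp only: max_add_distrib_left)
  qed
  \<comment> \<open>The smallest vertex in the linear order from \<open>a\<close> selects the
    rotation to which \<open>lin\<close> applies.\<close>
  have min_ex: "\<exists>m\<in>S. \<forall>x\<in>S. x \<noteq> m \<longrightarrow> cy a m x" if "finite S" "S \<noteq> {}" "S \<subseteq> V - {a}" for S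
    using that
  proof (induction S rule: finite_ne_induct)
    case (insert x S)
    then obtain m where m: "m \<in> S" "\<forall>y\<in>S. y \<noteq> m \<longrightarrow> cy a m y" by blast
    have "distinct [a, m, x]" using m insert by auto
    then consider "cy a m x" | "cy a x m" using tot[of a m x] m insert V a by blast
    then show ?case
    proof cases
      case 1 then show ?thesis using m by blast
    next
      case 2
      have "cy a x y" if "y \<in> S" for y
      proof (cases "y = m")
        case False
        then have "cy a m y" using m(2) that by simp
        moreover have "a \<in> F" "x \<in> F" "m \<in> F" "y \<in> F" using a V m(1) that insert.prems by auto
        ultimately show ?thesis using tran[of a x m y] 2 by simp
      qed (use 2 in simp)
      then show ?thesis by blast
    qed
  qed auto
  have "rel p q r s" if m: "p \<in> V" "q \<in> V" "r \<in> V" "s \<in> V" and c: "cy p q r" "cy p r s" for p q r s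
  proof -
    have mF: "p \<in> F" "q \<in> F" "r \<in> F" "s \<in> F" using m V by auto
    have 1: "cy q r s" "cy q s p" using quad_rot[OF mF c] .
    have 2: "cy r s p" "cy r p q" using quad_rot[of q r s p] mF 1 by blast+
    have 3: "cy s p q" "cy s q r" using quad_rot[of r s p q] mF 2 by blast+
    consider "a = p" | "a = q" | "a = r" | "a = s" | "{p, q, r, s} \<subseteq> V - {a}" using m by blast
    then show ?thesis
    proof cases
      case 1 then show ?thesis using base m c by blast
    next
      case 2 then show ?thesis using base[of r s p] m 1 relrot by blast
    next
      case 3 then show ?thesis using base[of s p q] m 2 relrot by blast
    next
      case 4 then show ?thesis using base[of p q r] m 3 relrot by blast
    next
      case 5
      then obtain l where l: "l \<in> {p, q, r, s}" "\<forall>x\<in>{p, q, r, s}. x \<noteq> l \<longrightarrow> cy a l x"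
        using min_ex[of "{p, q, r, s}"] by blast
      have dist: "distinct [p, q, r, s]" using cy_distinct c 1 2 by (metis distinct_length_2_or_more distinct_singleton)
      consider "l = p" | "l = q" | "l = r" | "l = s" using l by blast
      then show ?thesis
      proof cases
        case 1 then show ?thesis using l dist lin[of p q r s] m c by auto
      next
        case 2
        then have "rel q r s p" using l dist lin[of q r s p] m 1 by auto
        then show ?thesis using relrot by blast
      next
        case 3
        then have "rel r s p q" using l dist lin[of r s p q] m 2 by auto
        then show ?thesis using relrot by blast
      next
        case 4
        then have "rel s p q r" using l dist lin[of s p q r] m 3 by auto
        then show ?thesis using relrot by blast
      qed
    qed
  qed
  then show ?thesis unfolding ptolemy_def rel_def by blast
qed

text \<open>The two vertex sets lie on opposite sides of the chord \<open>ab\<close>. Seen from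
  \<open>a\<close>, the rest of \<open>V1\<close> precedes \<open>b\<close> and the rest of
  \<open>V2\<close> follows it, so max-additivity of the weights forces the value on every pair
  separated by the chord, and the forced values do satisfy all relations.\<close>

lemma ptolemy_glue:
  fixes d1 d2 :: "'a set \<Rightarrow> 'x::linordered_ab_group_add"
  assumes V: "V1 \<subseteq> F" "V2 \<subseteq> F" and ab: "a \<noteq> b" "V1 \<inter> V2 = {a, b}"
    and c1: "\<And>x. x \<in> V1 \<Longrightarrow> x \<noteq> a \<Longrightarrow> x \<noteq> b \<Longrightarrow> cy a x b"
    and c2: "\<And>y. y \<in> V2 \<Longrightarrow> y \<noteq> a \<Longrightarrow> y \<noteq> b \<Longrightarrow> cy a b y"
    and p1: "ptolemy V1 d1" and p2: "ptolemy V2 d2" and eq: "d1 {a, b} = d2 {a, b}"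
  obtains d where "ptolemy (V1 \<union> V2) d" "\<And>E. E \<subseteq> V1 \<Longrightarrow> d E = d1 E"
    "\<And>x y. x \<in> V2 \<Longrightarrow> y \<in> V2 \<Longrightarrow> x \<noteq> y \<Longrightarrow> d {x, y} = d2 {x, y}"
proof -
  have abV: "a \<in> V1" "a \<in> V2" "b \<in> V1" "b \<in> V2" using ab by auto
  \<comment> \<open>The last branch is max-additivity through \<open>b\<close>, solved for the value
    on a pair with one point \<open>x\<close> in \<open>V1\<close> and one point \<open>y\<close> in
    \<open>V2\<close>; \<open>the_elem\<close> reads off these points.\<close>
  define d where "d E = (if E \<subseteq> V1 then d1 E else if E \<subseteq> V2 then d2 E else
     d1 {a, the_elem (E \<inter> V1)} + d2 {a, the_elem (E \<inter> V2)}
       + max (wt d1 a (the_elem (E \<inter> V1)) b) (wt d2 a b (the_elem (E \<inter> V2))))" for E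
  have d1: "d E = d1 E" if "E \<subseteq> V1" for E using that by (simp add: d_def)
  have both: "x = a \<or> x = b" if "x \<in> V1" "x \<in> V2" for x using that ab by auto
  have d2: "d {x, y} = d2 {x, y}" if "x \<in> V2" "y \<in> V2" "x \<noteq> y" for x y
  proof (cases "{x, y} \<subseteq> V1")
    case True
    then have "{x, y} = {a, b}" using both[of x] both[of y] that by auto
    then show ?thesis using eq abV by (simp add: d_def)
  qed (use that in \<open>auto simp: d_def\<close>)
  have da2: "d {a, y} = d2 {a, y}" if "y \<in> V2" "y \<noteq> a" for y using d2 abV that by metis
  have w1: "wt d a x y = wt d1 a x y" if "x \<in> V1" "y \<in> V1" for x y
    using that abV by (simp add: wt_def d1)
  have w2: "wt d a x y = wt d2 a x y" if "x \<in> V2" "y \<in> V2" "x \<noteq> y" "x \<noteq> a" "y \<noteq> a" for x y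
    using that by (simp add: wt_def d2 da2)
  have w12: "wt d a x y = max (wt d a x b) (wt d a b y)"
    if "x \<in> V1" "x \<notin> V2" "y \<in> V2" "y \<notin> V1" for x y
  proof -
    have i: "{x, y} \<inter> V1 = {x}" "{x, y} \<inter> V2 = {y}" using that by auto
    have ne: "y \<noteq> b" "y \<noteq> a" using that abV by auto
    have "d {x, y} = d1 {a, x} + d2 {a, y} + max (wt d1 a x b) (wt d2 a b y)"
      using that unfolding d_def i by simp
    also have "\<dots> = d {a, x} + d {a, y} + max (wt d a x b) (wt d a b y)"
      using that abV ab ne by (simp add: d1 da2 w1 w2)
    finally show ?thesis by (simp add: wt_def[of d a x y])
  qed
  have lt: "\<not> (cy a x y \<and> cy a y x)" for x y using asym by blast
  have trn: "cy a x y \<Longrightarrow> cy a y w \<Longrightarrow> x \<in> F \<Longrightarrow> y \<in> F \<Longrightarrow> w \<in> F \<Longrightarrow> cy a x w" for x y w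
    using tran[of a x y w] abV V by blast
  have "ptolemy (V1 \<union> V2) d"
  proof (rule wt_imp_ptol)
    show "V1 \<union> V2 \<subseteq> F" "a \<in> V1 \<union> V2" using V abV by auto
    fix q r s assume m: "q \<in> V1 \<union> V2" "r \<in> V1 \<union> V2" "s \<in> V1 \<union> V2" and qrs: "cy a q r" "cy a r s"
    have mF: "q \<in> F" "r \<in> F" "s \<in> F" "b \<in> F" using m V abV by auto
    have qs: "cy a q s" using trn qrs mF by blast
    have ne: "q \<noteq> a" "r \<noteq> a" "s \<noteq> a" "q \<noteq> r" "r \<noteq> s" "q \<noteq> s"
      using cy_distinct[OF qrs(1)] cy_distinct[OF qrs(2)] cy_distinct[OF qs] by auto
    \<comment> \<open>\<open>V1\<close> is an initial segment of the linear order from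
      \<open>a\<close>, so only the positions of \<open>q\<close>, \<open>r\<close>,
      \<open>s\<close> relative to \<open>b\<close> have to be distinguished.\<close>
    have down: "x \<in> V1" if "y \<in> V1" "cy a x y" "x \<in> V1 \<union> V2" for x y
    proof (rule ccontr)
      assume "x \<notin> V1"
      then have x: "x \<in> V2" "x \<noteq> a" "x \<noteq> b" using that abV by auto
      then have bx: "cy a b x" using c2 by blast
      have "cy a b y" using trn[OF bx that(2)] x V that abV by blast
      then show False using c1[of y] that lt cy_distinct[OF \<open>cy a x y\<close>] cy_distinct[OF \<open>cy a b y\<close>] by auto
    qed
    show "wt d a q s = max (wt d a q r) (wt d a r s)"
    proof (cases "s \<in> V1")
      case True
      then have "r \<in> V1" "q \<in> V1" using down qrs m qs by blast+
      then show ?thesis using True ptolemy_imp_wt[OF p1 abV(1), of q r s] qrs by (simp add: w1)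
    next
      case s: False
      then have sV: "s \<in> V2" using m by blast
      have bs: "cy a b s" using c2 sV s abV ne by metis
      show ?thesis
      proof (cases "q \<in> V2")
        case q: True
        have "r \<in> V2"
        proof (rule ccontr)
          assume "r \<notin> V2"
          then have r: "r \<in> V1" "r \<noteq> b" using m abV by auto
          then have "q \<in> V1" using down qrs m by blast
          then have "q = b" using q both ne by blast
          then show False using r c1[of r] qrs lt ne by blast
        qed
        then show ?thesis using q sV ptolemy_imp_wt[OF p2 abV(2), of q r s] qrs ne by (simp add: w2)
      next
        case q: False
        then have qV: "q \<in> V1" using m by blast
        have qb: "cy a q b" using c1 qV q abV ne by metis
        have wqs: "wt d a q s = max (wt d a q b) (wt d a b s)" using w12 qV q sV s by blast
        consider "r = b" | "r \<in> V1" "r \<notin> V2" | "r \<in> V2" "r \<notin> V1" using m both ne by blast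
        then show ?thesis
        proof cases
          case 1 then show ?thesis using wqs by simp
        next
          case 2
          then have rb: "cy a r b" using c1 abV ne by metis
          have "wt d a r s = max (wt d a r b) (wt d a b s)" using w12 2 sV s by blast
          moreover have "wt d a q b = max (wt d a q r) (wt d a r b)"
            using ptolemy_imp_wt[OF p1 abV(1) qV 2(1) abV(3) qrs(1) rb] qV 2 abV by (simp add: w1)
          ultimately show ?thesis using wqs by (simp add: max.assoc)
        next
          case 3
          then have br: "cy a b r" using c2 abV ne by metis
          have nb: "b \<noteq> r" "b \<noteq> s" "b \<noteq> a" using 3 s abV ab by auto
          have "wt d a q r = max (wt d a q b) (wt d a b r)" using w12 3 qV q by blast
          moreover have "wt d a b s = max (wt d a b r) (wt d a r s)"
            using ptolemy_imp_wt[OF p2 abV(2) abV(4) 3(1) sV br qrs(2)] sV 3 abV nb ne by (simp add: w2)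
          ultimately show ?thesis using wqs by (simp add: max.assoc)
        qed
      qed
    qed
  qed
  then show ?thesis using that d1 d2 by blast
qed

end

text \<open>\<open>t\<close> lists oriented triangles and may be empty, as happens when a face is a
  vertex or an edge. \<open>t_noncrossing\<close> forbids the edges \<open>ab\<close> and
  \<open>ce\<close> to cross, and \<open>t_opposite\<close> leaves no gap behind an edge that has
  vertices on its far side.\<close>

locale polygon_triangulation = cyclic_order F cy for F :: "'a set" and cy +
  fixes t :: "'a \<Rightarrow> 'a \<Rightarrow> 'a \<Rightarrow> bool" and A :: "'a set \<Rightarrow> 'x::linordered_ab_group_add"
  assumes t_rot: "t a b c \<Longrightarrow> t b c a"
    and t_cy: "t a b c \<Longrightarrow> cy a b c"
    and t_F: "t a b c \<Longrightarrow> a \<in> F"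
    and t_noncrossing: "t a b p \<Longrightarrow> t c e q \<Longrightarrow> cy a c b \<Longrightarrow> cy a b e \<Longrightarrow> False"
    and t_opposite: "t a b c \<Longrightarrow> x \<in> F \<Longrightarrow> cy b a x \<Longrightarrow> \<exists>m. t b a m"
begin

definition beyond :: "'a \<Rightarrow> 'a \<Rightarrow> 'a set" where
  "beyond i j = {x \<in> F. cy i j x}"

lemma t_in_F: "t a b c \<Longrightarrow> a \<in> F" "t a b c \<Longrightarrow> b \<in> F" "t a b c \<Longrightarrow> c \<in> F"
  using t_rot t_F by blast+

text \<open>Induction on the number of vertices cut off by the chord \<open>ij\<close>: the triangle
  \<open>ijm\<close> on the chord leaves two smaller regions behind \<open>im\<close> and
  \<open>mj\<close>, and \<open>ptolemy_glue\<close> joins the three pieces along these two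
  sides.\<close>

lemma ptolemy_beyond:
  assumes "i \<in> F" "j \<in> F" "i \<noteq> j" "beyond i j = {} \<or> (\<exists>m. t i j m)"
  shows "\<exists>d :: 'a set \<Rightarrow> 'x. ptolemy (beyond i j \<union> {i, j}) d \<and>
    (\<forall>p q r. t p q r \<longrightarrow> {p, q} \<subseteq> beyond i j \<union> {i, j} \<longrightarrow> d {p, q} = A {p, q})"
  using assms
proof (induction "card (beyond i j)" arbitrary: i j rule: less_induct)
  case less
  show ?case
  proof (cases "\<exists>m. t i j m")
    case False
    then have "beyond i j = {}" using less by blast
    then have "ptolemy (beyond i j \<union> {i, j}) A"
      unfolding ptolemy_def using cy_distinct by fastforce
    then show ?thesis by blast
  next
    case True
    then obtain m where t: "t i j m" by blast
    have F: "i \<in> F" "j \<in> F" "m \<in> F" using t t_in_F by blast+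
    have c: "cy i j m" "cy j m i" "cy m i j" using t t_cy rot by blast+
    have ne: "i \<noteq> j" "j \<noteq> m" "i \<noteq> m" using cy_distinct[OF c(1)] by auto
    have fin: "finite (beyond i j)" using fin by (simp add: beyond_def)
    have im: "cy i j x" "cy j m x" "cy m x j" if "x \<in> beyond i m" for x
    proof -
      have x: "x \<in> F" "cy i m x" using that by (auto simp: beyond_def)
      show "cy i j x" using tran[of i j m x] F x c by blast
      show "cy j m x" using quad_rot[of i j m x] F x c by blast
      then show "cy m x j" using rot by blast
    qed
    have mj: "cy i j x" "cy i x m" if "x \<in> beyond m j" for x
    proof -
      have x: "x \<in> F" "cy m j x" using that by (auto simp: beyond_def)
      show "cy i j x" using quad_rot[of m i j x] F x c by blast
      show "cy i x m" using quad_rot[of m i j x] F x c by blast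
    qed
    have split: "beyond i j = beyond i m \<union> {m} \<union> beyond m j"
    proof (intro equalityI subsetI)
      fix x assume "x \<in> beyond i j"
      then have x: "x \<in> F" "cy i j x" by (auto simp: beyond_def)
      show "x \<in> beyond i m \<union> {m} \<union> beyond m j"
      proof (cases "x = m")
        case False
        have "distinct [i, m, x]" using False cy_distinct[OF x(2)] ne by auto
        then consider "cy i m x" | "cy i x m" using tot[of i m x] F x by blast
        then show ?thesis
        proof cases
          case 2
          then have "cy j x m" using quad_rot[of i j x m] F x by blast
          then have "cy m j x" using rot by blast
          then show ?thesis using x by (simp add: beyond_def)
        qed (use x in \<open>simp add: beyond_def\<close>)
      qed simp
    next
      fix x assume "x \<in> beyond i m \<union> {m} \<union> beyond m j"
      then show "x \<in> beyond i j" using im(1) mj(1) c F by (auto simp: beyond_def)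
    qed
    have nm: "m \<notin> beyond i m" "m \<notin> beyond m j" "j \<notin> beyond m j" "i \<notin> beyond i m"
      "i \<notin> beyond m j" "j \<notin> beyond i m"
      using cy_distinct c asym by (fastforce simp: beyond_def)+
    have disj: "beyond i m \<inter> beyond m j = {}"
      using im(3) asym by (fastforce simp: beyond_def)
    have card: "card (beyond i m) < card (beyond i j)" "card (beyond m j) < card (beyond i j)"
      using fin nm(1,2) by (intro psubset_card_mono; auto simp: split)+
    have opp: "beyond i m = {} \<or> (\<exists>k. t i m k)" "beyond m j = {} \<or> (\<exists>k. t m j k)"
      using t_opposite[of m i j] t_opposite[of j m i] t t_rot by (auto simp: beyond_def)
    obtain d1 where d1: "ptolemy (beyond i m \<union> {i, m}) d1"
      "\<And>p q r. t p q r \<Longrightarrow> {p, q} \<subseteq> beyond i m \<union> {i, m} \<Longrightarrow> d1 {p, q} = A {p, q}"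
      using less(1)[OF card(1) F(1,3) ne(3) opp(1)] by blast
    obtain d2 where d2: "ptolemy (beyond m j \<union> {m, j}) d2"
      "\<And>p q r. t p q r \<Longrightarrow> {p, q} \<subseteq> beyond m j \<union> {m, j} \<Longrightarrow> d2 {p, q} = A {p, q}"
      using less(1)[OF card(2) F(3,2) _ opp(2)] ne by blast
    have tr: "ptolemy {i, j, m} A" by (rule ptolemy_triangle)
    have tt: "t i j m" "t j m i" "t m i j" using t t_rot by blast+
    obtain d3 where d3: "ptolemy ({i, j, m} \<union> (beyond i m \<union> {i, m})) d3"
      "\<And>E. E \<subseteq> {i, j, m} \<Longrightarrow> d3 E = A E"
      "\<And>x y. x \<in> beyond i m \<union> {i, m} \<Longrightarrow> y \<in> beyond i m \<union> {i, m} \<Longrightarrow> x \<noteq> y \<Longrightarrow> d3 {x, y} = d1 {x, y}"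
    proof (rule ptolemy_glue[of "{i, j, m}" "beyond i m \<union> {i, m}" i m A d1])
      show "{i, j, m} \<inter> (beyond i m \<union> {i, m}) = {i, m}" using nm ne by auto
      show "A {i, m} = d1 {i, m}" using d1(2)[OF tt(3)] by (simp add: insert_commute)
    qed (use F ne c d1 tr in \<open>auto simp: beyond_def\<close>)
    have all: "{i, j, m} \<union> (beyond i m \<union> {i, m}) \<union> (beyond m j \<union> {m, j}) = beyond i j \<union> {i, j}"
      unfolding split by auto
    obtain d where d: "ptolemy (beyond i j \<union> {i, j}) d"
      "\<And>E. E \<subseteq> {i, j, m} \<union> (beyond i m \<union> {i, m}) \<Longrightarrow> d E = d3 E"
      "\<And>x y. x \<in> beyond m j \<union> {m, j} \<Longrightarrow> y \<in> beyond m j \<union> {m, j} \<Longrightarrow> x \<noteq> y \<Longrightarrow> d {x, y} = d2 {x, y}"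
    proof (rule ptolemy_glue[of "{i, j, m} \<union> (beyond i m \<union> {i, m})" "beyond m j \<union> {m, j}" m j d3 d2, unfolded all])
      show "({i, j, m} \<union> (beyond i m \<union> {i, m})) \<inter> (beyond m j \<union> {m, j}) = {m, j}"
        using nm ne disj by auto
      show "d3 {m, j} = d2 {m, j}" using d2(2)[OF tt(2)] d3(2)[of "{m, j}"] by (simp add: insert_commute)
      show "cy m x j" if "x \<in> {i, j, m} \<union> (beyond i m \<union> {i, m})" "x \<noteq> m" "x \<noteq> j" for x
        using that c im by auto
    qed (use F ne c d3 d2 in \<open>auto simp: beyond_def\<close>)
    \<comment> \<open>An edge of the triangulation stays within one of the three pieces; otherwise
      it would cross the side \<open>mi\<close> or \<open>jm\<close> of the triangle
      \<open>ijm\<close>.\<close>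
    have "d {p, q} = A {p, q}" if tp: "t p q r" and pq: "{p, q} \<subseteq> beyond i j \<union> {i, j}" for p q r
    proof -
      have pqF: "p \<in> F" "q \<in> F" "p \<noteq> q" using t_in_F[OF tp] cy_distinct[OF t_cy[OF tp]] by auto
      have cross1: False if "x \<in> beyond i m" "y \<in> beyond m j \<union> {j}" "t x y s \<or> t y x s" for x y s
      proof -
        have xy: "cy i m x" "cy i y m" "x \<in> F" "y \<in> F"
          using that(1,2) mj c rot F by (auto simp: beyond_def)
        have "cy m x i" "cy m i y" using xy rot by blast+
        moreover have "cy y m x" "cy y x i" using quad_rot[of i y m x] xy F by blast+
        ultimately show False using that(3) t_noncrossing[OF tt(3)] t_noncrossing[OF _ tt(3)] by blast
      qed
      have cross2: False if "y \<in> beyond m j" "t i y s \<or> t y i s" for y s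
      proof -
        have "cy j y m" using that(1) rot by (auto simp: beyond_def)
        then show False using c that(2) mj[OF that(1)] t_noncrossing[OF tt(2)] t_noncrossing[OF _ tt(2)] by blast
      qed
      consider "{p, q} \<subseteq> beyond i m \<union> {i, m}" | "{p, q} \<subseteq> beyond m j \<union> {m, j}" | "{p, q} \<subseteq> {i, j, m}"
        | "p \<in> beyond i m" "q \<in> beyond m j \<union> {j}" | "q \<in> beyond i m" "p \<in> beyond m j \<union> {j}"
        | "p = i" "q \<in> beyond m j" | "q = i" "p \<in> beyond m j"
        using pq unfolding split by blast
      then show ?thesis
      proof cases
        case 1 then show ?thesis using d(2)[of "{p, q}"] d3(3)[of p q] d1(2)[OF tp] pqF by auto
      next
        case 2 then show ?thesis using d(3)[of p q] d2(2)[OF tp] pqF by auto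
      next
        case 3 then show ?thesis using d(2)[of "{p, q}"] d3(2)[of "{p, q}"] by auto
      next
        case 4 then show ?thesis using cross1 tp by blast
      next
        case 5 then show ?thesis using cross1 tp by blast
      next
        case 6 then show ?thesis using cross2 tp by blast
      next
        case 7 then show ?thesis using cross2 tp by blast
      qed
    qed
    then show ?thesis using d(1) by blast
  qed
qed

text \<open>An edge of any triangle divides the polygon; \<open>ptolemy_beyond\<close> handles both
  sides and the results are glued along that edge.\<close>

lemma ptolemy_extension:
  "\<exists>d :: 'a set \<Rightarrow> 'x. ptolemy F d \<and> (\<forall>p q r. t p q r \<longrightarrow> d {p, q} = A {p, q})"
proof (cases "\<exists>a b c. t a b c")
  case False
  have "ptolemy F (\<lambda>_. 0 :: 'x)" by (simp add: ptolemy_def)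
  then show ?thesis using False by blast
next
  case True
  then obtain a b c where t: "t a b c" by blast
  have F: "a \<in> F" "b \<in> F" "c \<in> F" using t t_in_F by blast+
  have ne: "a \<noteq> b" using cy_distinct[OF t_cy[OF t]] by auto
  obtain d1 where d1: "ptolemy (beyond a b \<union> {a, b}) d1"
      "\<And>p q r. t p q r \<Longrightarrow> {p, q} \<subseteq> beyond a b \<union> {a, b} \<Longrightarrow> d1 {p, q} = A {p, q}"
    using ptolemy_beyond[OF F(1,2) ne] t by blast
  have "beyond b a = {} \<or> (\<exists>m. t b a m)" using t_opposite[OF t] by (auto simp: beyond_def)
  then obtain d2 where d2: "ptolemy (beyond b a \<union> {a, b}) d2"
      "\<And>p q r. t p q r \<Longrightarrow> {p, q} \<subseteq> beyond b a \<union> {a, b} \<Longrightarrow> d2 {p, q} = A {p, q}"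
    using ptolemy_beyond[OF F(2,1)] ne by (auto simp: insert_commute)
  have "beyond a b \<inter> beyond b a = {}" using rot asym unfolding beyond_def by blast
  moreover have "x \<noteq> a \<and> x \<noteq> b" if "cy a b x \<or> cy b a x" for x
    using that cy_distinct[of a b x] cy_distinct[of b a x] by auto
  ultimately have dis: "beyond a b \<inter> beyond b a = {}" "a \<notin> beyond a b" "b \<notin> beyond a b"
    "a \<notin> beyond b a" "b \<notin> beyond b a"
    unfolding beyond_def by blast+
  have all: "(beyond b a \<union> {a, b}) \<union> (beyond a b \<union> {a, b}) = F"
  proof -
    have "x \<in> beyond a b \<or> x \<in> beyond b a" if "x \<in> F" "x \<noteq> a" "x \<noteq> b" for x
      using tot[of a b x] that F ne rot by (auto simp: beyond_def)
    then show ?thesis using F by (auto simp: beyond_def)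
  qed
  obtain d where d: "ptolemy F d"
    "\<And>E. E \<subseteq> beyond b a \<union> {a, b} \<Longrightarrow> d E = d2 E"
    "\<And>x y. x \<in> beyond a b \<union> {a, b} \<Longrightarrow> y \<in> beyond a b \<union> {a, b} \<Longrightarrow> x \<noteq> y \<Longrightarrow> d {x, y} = d1 {x, y}"
  proof (rule ptolemy_glue[of "beyond b a \<union> {a, b}" "beyond a b \<union> {a, b}" a b d2 d1, unfolded all])
    show "d2 {a, b} = d1 {a, b}" using d2(2)[OF t] d1(2)[OF t] by simp
    show "(beyond b a \<union> {a, b}) \<inter> (beyond a b \<union> {a, b}) = {a, b}" using dis by auto
    show "cy a x b" if "x \<in> beyond b a \<union> {a, b}" "x \<noteq> a" "x \<noteq> b" for x
      using that rot by (auto simp: beyond_def)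
  qed (use F ne d1 d2 in \<open>auto simp: beyond_def\<close>)
  have "d {p, q} = A {p, q}" if tp: "t p q r" for p q r
  proof -
    have pqF: "p \<in> F" "q \<in> F" "p \<noteq> q" using t_in_F[OF tp] cy_distinct[OF t_cy[OF tp]] by auto
    have cross: False if "x \<in> beyond b a" "y \<in> beyond a b" "t x y s \<or> t y x s" for x y s
    proof -
      have xy: "cy a x b" "cy a b y" "x \<in> F" "y \<in> F"
        using that(1,2) rot by (auto simp: beyond_def)
      have "cy y a x" "cy y x b" using quad_rot[of a x b y] xy F rot by blast+
      then show False using xy that(3) t_noncrossing[OF t] t_noncrossing[OF _ t] by blast
    qed
    consider "{p, q} \<subseteq> beyond b a \<union> {a, b}" | "{p, q} \<subseteq> beyond a b \<union> {a, b}"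
      | "p \<in> beyond b a" "q \<in> beyond a b" | "q \<in> beyond b a" "p \<in> beyond a b"
      using pqF all by blast
    then show ?thesis
    proof cases
      case 1 then show ?thesis using d(2)[of "{p, q}"] d2(2)[OF tp] by auto
    next
      case 2 then show ?thesis using d(3)[of p q] d1(2)[OF tp] pqF by auto
    qed (use cross tp in blast)+
  qed
  then show ?thesis using d(1) by blast
qed

end

section \<open>Labelings near an arbitrary configuration\<close>

text \<open>\<open>near z z'\<close> collects finitely many open conditions on \<open>z'\<close> that make the hull of \<open>z'\<close> a
  subdivision of the hull of \<open>z\<close>.\<close>
definition near :: "(real^3)^'n \<Rightarrow> (real^3)^'n \<Rightarrow> bool" where
  "near z z' \<longleftrightarrow> (\<forall>a b c x. vol z a b c x > 0 \<longrightarrow> vol z' a b c x > 0) \<and>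
     (\<forall>a b c i j k. nrm z a b c \<bullet> nrm z i j k > 0 \<longrightarrow> nrm z a b c \<bullet> nrm z' i j k > 0)"

lemma continuous_nrm [continuous_intros]:
  "continuous F f \<Longrightarrow> continuous F (\<lambda>x. nrm (f x) a b c)"
  unfolding nrm_def by (intro continuous_intros continuous_cross)

lemma continuous_vol [continuous_intros]:
  "continuous F f \<Longrightarrow> continuous F (\<lambda>x. vol (f x) a b c y)"
  unfolding vol_def by (intro continuous_intros)

lemma eventually_pos:
  fixes f :: "'a::t2_space \<Rightarrow> real"
  assumes "isCont f z" "f z > 0"
  shows "\<forall>\<^sub>F z' in nhds z. f z' > 0"
proof -
  have "(f \<longlongrightarrow> f z) (nhds z)" using assms(1) by (simp add: continuous_at tendsto_nhds_iff)
  then show ?thesis using assms(2) by (rule order_tendstoD)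
qed

lemma eventually_near: "\<forall>\<^sub>F z' in nhds z. near z (z' :: (real^3)^'n)"
proof -
  have "\<forall>\<^sub>F z' in nhds z. vol z a b c x > 0 \<longrightarrow> vol z' a b c x > 0" for a b c x
    by (cases "vol z a b c x > 0") (auto intro!: eventually_pos continuous_intros)
  moreover have "\<forall>\<^sub>F z' in nhds z. nrm z a b c \<bullet> nrm z i j k > 0 \<longrightarrow> nrm z a b c \<bullet> nrm z' i j k > 0" for a b c i j k
    by (cases "nrm z a b c \<bullet> nrm z i j k > 0") (auto intro!: eventually_pos continuous_intros)
  ultimately show ?thesis
    unfolding near_def by (intro eventually_conj eventually_all_finite)
qed

lemma near_ball: "\<exists>e>0. \<forall>z'. dist z' z < e \<longrightarrow> near z (z' :: (real^3)^'n)"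
  using eventually_near[of z] by (simp add: eventually_nhds_metric)

text \<open>Only strict inequalities survive a perturbation, which explains the direction:
  supporting triples of \<open>z'\<close> support \<open>z\<close>, whereas a degenerate one of
  \<open>z\<close> may be lost.\<close>

lemma near_otri: "near z z' \<Longrightarrow> otri z' a b c \<Longrightarrow> otri z a b c"
  unfolding near_def otri_def by (meson not_le)

text \<open>Let \<open>v = z $ b - z $ a\<close>, let the other points be taken relative to
  \<open>a\<close>, and let [p q] be the determinant of \<open>v\<close>, p, q. This is the
  three-term Pluecker relation [c x][m u] - [c m][x u] + [c u][x m] = 0 modulo \<open>v\<close>. It
  compares planes of the pencil through the edge \<open>ab\<close>.\<close>

lemma plucker:
  "vol z a b c x * (u \<bullet> nrm z a b m) - vol z a b c m * (u \<bullet> nrm z a b x)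
     + (u \<bullet> nrm z a b c) * vol z a b x m = 0"
proof -
  have *: "(cross3 v c \<bullet> x) * (u \<bullet> cross3 v m) - (cross3 v c \<bullet> m) * (u \<bullet> cross3 v x)
     + (u \<bullet> cross3 v c) * (cross3 v x \<bullet> m) = 0" for v c x m u :: "real^3"
    by (simp add: cross3_simps)
  show ?thesis unfolding vol_def nrm_def by (rule *)
qed

text \<open>Cramer's rule for \<open>u\<close> in terms of the three edge vectors at
  \<open>a\<close>, paired with \<open>w\<close>. When \<open>w\<close> is a supporting normal at
  \<open>a\<close>, its pairings with the edge vectors are nonpositive.\<close>

lemma cramer:
  "vol z a c b e * (w \<bullet> u) = (u \<bullet> nrm z a b e) * (w \<bullet> (z $ c - z $ a))
     + (u \<bullet> nrm z a e c) * (w \<bullet> (z $ b - z $ a)) + (u \<bullet> nrm z a c b) * (w \<bullet> (z $ e - z $ a))"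
proof -
  have *: "(cross3 c b \<bullet> e) * (w \<bullet> u) = (u \<bullet> cross3 b e) * (w \<bullet> c)
     + (u \<bullet> cross3 e c) * (w \<bullet> b) + (u \<bullet> cross3 c b) * (w \<bullet> e)" for c b e w u :: "real^3"
    by (simp add: cross3_simps)
  show ?thesis unfolding vol_def nrm_def by (rule *)
qed

lemma otri_nrm: "z \<in> configuration_space \<Longrightarrow> otri z a b c \<Longrightarrow> nrm z a b c \<noteq> 0"
  by (intro nrm_nonzero) (auto simp: otri_def)

section \<open>Faces and their cyclic order\<close>

definition face :: "(real^3)^'n \<Rightarrow> real^3 \<Rightarrow> 'n set" where
  "face z u = {i. \<forall>j. u \<bullet> z $ j \<le> u \<bullet> z $ i}"

lemma face_eq: "i \<in> face z u \<Longrightarrow> j \<in> face z u \<Longrightarrow> u \<bullet> z $ i = u \<bullet> z $ j"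
  unfolding face_def by (auto intro: antisym)

lemma otri_face:
  assumes z: "z \<in> configuration_space" and o: "otri z a b c"
  shows "x \<in> face z (sgn (nrm z a b c)) \<longleftrightarrow> vol z a b c x = 0"
proof -
  note oc = otri_circle[OF assms]
  have "a \<in> face z (sgn (nrm z a b c))" using oc(3) by (simp add: face_def)
  moreover have "x \<in> face z (sgn (nrm z a b c))" if "vol z a b c x = 0"

  proof -
    have "sgn (nrm z a b c) \<bullet> z $ x = sgn (nrm z a b c) \<bullet> z $ a" using oc(4) that by blast
    then show ?thesis using oc(3) by (simp add: face_def)
  qed
  ultimately show ?thesis using oc(4) face_eq by blast
qed

text \<open>Inversion in a vertex \<open>r\<close> of the face maps its circle to a line; the cyclic order of the
  circle becomes the order of that line.\<close>
lemma face_inversion: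
  fixes u :: "real^3"
  assumes z: "z \<in> configuration_space" and u: "norm u = 1"
    and f: "r \<in> face z u" "a \<in> face z u" "b \<in> face z u" "a \<noteq> r" "b \<noteq> r"
  defines "pos \<equiv> \<lambda>x. (cross3 u (z $ r) \<bullet> (z $ x - z $ r)) / ((z $ x - z $ r) \<bullet> (z $ x - z $ r))"
  shows "u \<bullet> nrm z r a b > 0 \<longleftrightarrow> pos b < pos a"
proof -
  define h where "h = u \<bullet> z $ r"
  define a' b' where "a' = z $ a - z $ r" and "b' = z $ b - z $ r"
  define k where "k = u \<bullet> cross3 a' b'"
  define La Lb where "La = a' \<bullet> a'" and "Lb = b' \<bullet> b'"
  define p where "p = cross3 u (z $ r)"
  have uu: "u \<bullet> u = 1" using u by (simp add: dot_square_norm)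
  have ab0: "u \<bullet> a' = 0" "u \<bullet> b' = 0" using face_eq[OF f(2,1)] face_eq[OF f(3,1)]
    by (simp_all add: a'_def b'_def inner_diff_right)
  have L: "La > 0" "Lb > 0" using f conf_inj[OF z] by (auto simp: La_def Lb_def a'_def b'_def)
  \<comment> \<open>Hence the inverted points, such as \<open>a'\<close> divided by
    \<open>La\<close>, all lie on one line, and \<open>p\<close> is its direction.\<close>
  have q: "z $ r \<bullet> a' = - La / 2" "z $ r \<bullet> b' = - Lb / 2"
    using conf_norm[OF z] by (simp_all add: La_def Lb_def a'_def b'_def inner_diff_left inner_diff_right inner_commute)
  have "cross3 u (cross3 (cross3 a' b') u) = (u \<bullet> u) *\<^sub>R cross3 a' b' - k *\<^sub>R u"
    unfolding k_def by (simp add: cross3_simps forall_3)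
  moreover have "cross3 (cross3 a' b') u = (u \<bullet> a') *\<^sub>R b' - (u \<bullet> b') *\<^sub>R a'"
    by (simp add: cross3_simps forall_3)
  ultimately have cr: "cross3 a' b' = k *\<^sub>R u" using ab0 uu by simp
  have "(p \<bullet> a') * (z $ r \<bullet> b') - (p \<bullet> b') * (z $ r \<bullet> a') = cross3 p (z $ r) \<bullet> cross3 a' b'"
    by (simp add: cross3_simps)
  also have "cross3 p (z $ r) = h *\<^sub>R z $ r - (z $ r \<bullet> z $ r) *\<^sub>R u"
    unfolding p_def h_def by (simp add: cross3_simps forall_3)
  also have "\<dots> \<bullet> cross3 a' b' = k * (h\<^sup>2 - 1)"
    unfolding cr using conf_norm[OF z] uu
    by (simp add: inner_diff_left h_def power2_eq_square inner_commute algebra_simps)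
  \<comment> \<open>The factor \<open>1 - h^2\<close> is the squared length of \<open>p\<close>; it
    is positive because the plane is not tangent.\<close>
  finally have key: "k * (1 - h\<^sup>2) = ((p \<bullet> a') * Lb - (p \<bullet> b') * La) / 2"
    unfolding q by (simp add: algebra_simps)
  have "\<bar>h\<bar> < 1" using circle_height_less_one[OF z f(4) u] face_eq f unfolding h_def by metis
  then have h1: "1 - h\<^sup>2 > 0" by (simp add: abs_square_less_1)
  have "pos b < pos a \<longleftrightarrow> (p \<bullet> b') / Lb < (p \<bullet> a') / La"
    by (simp add: pos_def p_def a'_def b'_def La_def Lb_def)
  also have "\<dots> \<longleftrightarrow> (p \<bullet> b') * La < (p \<bullet> a') * Lb" using L by (simp add: field_simps)
  also have "\<dots> \<longleftrightarrow> k * (1 - h\<^sup>2) > 0" unfolding key by auto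
  also have "\<dots> \<longleftrightarrow> k > 0" using h1 by (simp add: zero_less_mult_iff)
  finally show ?thesis by (simp add: k_def nrm_def a'_def b'_def)
qed

text \<open>Transitivity is reduced to the order of the reals: \<open>face_inversion\<close> at the
  common first vertex turns cyclic triples into comparisons of positions on a line.\<close>

lemma face_cyclic_order:
  assumes z: "z \<in> configuration_space" and u: "norm u = 1"
  shows "cyclic_order (face z u) (\<lambda>i j k. u \<bullet> nrm z i j k > 0)"
proof
  show "finite (face z u)" by simp
  show "u \<bullet> nrm z b c a > 0" if "u \<bullet> nrm z a b c > 0" for a b c using that by (simp only: nrm_rot[of z b c a])
  show "\<not> u \<bullet> nrm z a c b > 0" if "u \<bullet> nrm z a b c > 0" for a b c using that by (simp add: nrm_swap'[of z a b c])
  show "u \<bullet> nrm z a b c > 0 \<or> u \<bullet> nrm z a c b > 0"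
    if f: "a \<in> face z u" "b \<in> face z u" "c \<in> face z u" and d: "distinct [a, b, c]" for a b c
  proof -
    have ne: "a \<noteq> b" "b \<noteq> c" "a \<noteq> c" using d by auto
    obtain k where k: "u = k *\<^sub>R nrm z a b c"
      using parallel_nrm[OF z ne, of u] face_eq f by metis
    then have "u \<bullet> nrm z a b c = k * (nrm z a b c \<bullet> nrm z a b c)" by simp
    moreover have "k \<noteq> 0" using k u by auto
    ultimately have "u \<bullet> nrm z a b c \<noteq> 0" using nrm_nonzero[OF z ne] by simp
    then show ?thesis by (auto simp: nrm_swap'[of z a b c] less_le)
  qed
  show "u \<bullet> nrm z a b e > 0"
    if f: "a \<in> face z u" "b \<in> face z u" "c \<in> face z u" "e \<in> face z u"
      and c: "u \<bullet> nrm z a b c > 0" "u \<bullet> nrm z a c e > 0" for a b c e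
  proof -
    have "b \<noteq> a" "c \<noteq> a" "e \<noteq> a" using c by (auto simp: nrm_def)
    then show ?thesis using c face_inversion[OF z u f(1)] f by (meson order_less_trans)
  qed
qed

text \<open>Faces are indexed by their unit outer normals and not by their vertex sets, since the two faces
  of a planar configuration have the same vertices but carry independent labels on their diagonals.
  The hypotheses on \<open>a, b, c, e\<close> say that these are four vertices of one face in cyclic order.\<close>
definition ptolemy_section :: "(real^3)^'n \<Rightarrow> (real^3 \<Rightarrow> 'n set \<Rightarrow> 'x::linordered_ab_group_add) \<Rightarrow> bool" where
  "ptolemy_section z d \<longleftrightarrow> (\<forall>a b c e. otri z a b c \<longrightarrow> otri z a c e \<longrightarrow> sgn (nrm z a b c) = sgn (nrm z a c e) \<longrightarrow>
     (let f = d (sgn (nrm z a b c)) in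
      f {a, c} + f {b, e} = max (f {a, b} + f {c, e}) (f {b, c} + f {e, a})))"

text \<open>The normal is taken at \<open>z\<close> but the triangle at \<open>z'\<close>: it names
  the face of \<open>z\<close> in which the triangle lies. An edge of \<open>z'\<close> between two
  faces of \<open>z\<close> is constrained by both of its triangles, so the two components of
  \<open>d\<close> must agree on it.\<close>

definition restricts :: "(real^3)^'n \<Rightarrow> (real^3 \<Rightarrow> 'n set \<Rightarrow> 'x) \<Rightarrow> (real^3)^'n \<Rightarrow> ('n set \<Rightarrow> 'x) \<Rightarrow> bool" where
  "restricts z d z' A \<longleftrightarrow> (\<forall>a b c. otri z' a b c \<longrightarrow> A {a, b} = d (sgn (nrm z a b c)) {a, b})"

lemma sgn_dot_pos_iff:
  fixes N w :: "'a::real_inner" shows "N \<noteq> 0 \<Longrightarrow> sgn N \<bullet> w > 0 \<longleftrightarrow> N \<bullet> w > 0"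
  by (simp add: sgn_div_norm divide_inverse zero_less_mult_iff)

text \<open>Rotate the plane of \<open>abc\<close> about \<open>ab\<close> until it supports from
  the other side. \<open>key y\<close> is minus the length of \<open>ab\<close> times the cotangent
  of the dihedral angle at \<open>ab\<close> from \<open>c\<close> to \<open>y\<close>, so the
  maximal key is the widest angle. \<open>plucker\<close> with \<open>u = N\<close> turns the
  comparison of keys into the sign of \<open>vol z a b m y\<close>.\<close>

lemma opposite_otri:
  fixes z :: "(real^3)^'n"
  assumes n: "CARD('n) \<ge> 4" and g: "general_position z" and o: "otri z a b c"
    and z: "z \<in> configuration_space"
  shows "\<exists>m. otri z b a m"
proof -
  have d: "a \<noteq> b" "b \<noteq> c" "a \<noteq> c" using o by (auto simp: otri_def)
  define N where "N = nrm z a b c"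
  define S where "S = UNIV - {a, b, c}"
  define key where "key y = (N \<bullet> nrm z a b y) / vol z a b c y" for y
  have S: "S \<noteq> {}"
  proof
    assume "S = {}"
    then have "UNIV = {a, b, c}" by (auto simp: S_def)
    then have "CARD('n) \<le> 3" by (metis card_3_le)
    then show False using n by simp
  qed
  have neg: "vol z a b c y < 0" if "y \<in> S" for y
  proof -
    have "distinct [a, b, c, y]" using that d by (auto simp: S_def)
    then have "vol z a b c y \<noteq> 0" using g by (auto simp: general_position_def)
    then show ?thesis using o by (auto simp: otri_def order_less_le)
  qed
  have NN: "N \<bullet> N > 0" using nrm_nonzero[OF z d] by (simp add: N_def)
  have "Max (key ` S) \<in> key ` S" using S by (intro Max_in) auto
  then obtain m where m: "m \<in> S" "Max (key ` S) = key m" by auto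
  have max: "key y \<le> key m" if "y \<in> S" for y using that by (simp flip: m(2))
  have "vol z b a m y \<le> 0" for y
  proof (cases "y \<in> S")
    case True
    have "vol z a b c m * (N \<bullet> nrm z a b y) - vol z a b c y * (N \<bullet> nrm z a b m)
     + (N \<bullet> nrm z a b c) * vol z a b m y = 0" by (rule plucker)
    moreover have "N \<bullet> nrm z a b y = key y * vol z a b c y" "N \<bullet> nrm z a b m = key m * vol z a b c m"
      using neg[OF True] neg[OF m(1)] by (simp_all add: key_def)
    ultimately have "(N \<bullet> N) * vol z a b m y = (vol z a b c m * vol z a b c y) * (key m - key y)"
      by (simp add: N_def algebra_simps)
    also have "\<dots> \<ge> 0" using max[OF True] neg[OF True] neg[OF m(1)]
      by (intro mult_nonneg_nonneg mult_nonpos_nonpos) auto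
    finally have "vol z a b m y \<ge> 0" using NN by (simp add: zero_le_mult_iff)
    then show ?thesis using vol_swap[of z b a m y] by simp
  next
    case False
    then consider "y = a" | "y = b" | "y = c" by (auto simp: S_def)
    then show ?thesis
    proof cases
      case 3
      have "vol z b a m c = vol z a b c m" using vol_swap[of z b a m c] vol_swap_last[of z a b m c] by simp
      then show ?thesis using 3 o by (simp add: otri_def)
    qed auto
  qed
  moreover have "m \<noteq> a" "m \<noteq> b" using m by (auto simp: S_def)
  ultimately show ?thesis using d unfolding otri_def by (metis (no_types))
qed

context
  fixes z z' :: "(real^3)^'n"
  assumes z: "z \<in> configuration_space" and z': "z' \<in> configuration_space"
    and nr: "near z z'" and g: "general_position z'" and n: "CARD('n) \<ge> 4"
begin

lemma near_dot:
  assumes "otri z a b c" "u = sgn (nrm z a b c)"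
  shows "u \<bullet> nrm z i j k > 0 \<Longrightarrow> u \<bullet> nrm z' i j k > 0"
    "u \<bullet> nrm z i j k < 0 \<Longrightarrow> u \<bullet> nrm z' i j k < 0"
proof -
  have N: "nrm z a b c \<noteq> 0" using assms by (intro nrm_nonzero[OF z]) (auto simp: otri_def)
  show *: "u \<bullet> nrm z i j k > 0 \<Longrightarrow> u \<bullet> nrm z' i j k > 0" for i j k
    using nr unfolding near_def assms(2) sgn_dot_pos_iff[OF N] by blast
  show "u \<bullet> nrm z i j k < 0 \<Longrightarrow> u \<bullet> nrm z' i j k < 0"
    using *[of j i k] by (simp add: nrm_swap[of z i j k] nrm_swap[of z' i j k])
qed

text \<open>If the diagonal \<open>ab\<close> of the quadruple \<open>a, c, b, e\<close> is an edge
  of \<open>z'\<close>, it passes above \<open>ce\<close>: \<open>cramer\<close> with the supporting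
  normal of \<open>abp\<close> expresses the volume through nonpositive heights. The other diagonal
  yields the opposite sign, so in general position both cannot occur.\<close>

lemma crossing_vol:
  assumes t: "otri z' a b p" "sgn (nrm z a b p) = u"
    and cy: "u \<bullet> nrm z a c b > 0" "u \<bullet> nrm z a b e > 0"
  shows "vol z' a c b e \<le> 0"
proof -
  have oz: "otri z a b p" using near_otri[OF nr t(1)] .
  note nd = near_dot[OF oz t(2)[symmetric]]
  have N: "nrm z a b p \<noteq> 0" using t by (intro nrm_nonzero[OF z]) (auto simp: otri_def)
  have "u \<bullet> nrm z a b p > 0" using sgn_dot_pos_iff[OF N] N t(2) by auto
  then have un: "nrm z' a b p \<bullet> u > 0" using nd(1) by (simp add: inner_commute)
  have "vol z' a c b e * (nrm z' a b p \<bullet> u) = (u \<bullet> nrm z' a b e) * vol z' a b p c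
     + (u \<bullet> nrm z' a e c) * vol z' a b p b + (u \<bullet> nrm z' a c b) * vol z' a b p e"
    unfolding vol_def[of z' a b p] by (rule cramer)
  also have "\<dots> \<le> 0"
    using nd(1)[OF cy(1)] nd(1)[OF cy(2)] t(1)
    by (simp add: otri_def) (intro add_nonpos_nonpos mult_nonneg_nonpos; simp)
  finally show ?thesis using un by (simp add: mult_le_0_iff)
qed

text \<open>The triangle of \<open>z'\<close> behind \<open>ab\<close> could leave the face with
  normal \<open>u\<close> only if \<open>ab\<close> were on its boundary; the face vertex
  \<open>x\<close> beyond \<open>ab\<close> excludes this.\<close>

lemma opposite_otri_same_face:
  assumes t: "otri z' a b c" "sgn (nrm z a b c) = u"
    and x: "x \<in> face z u" "u \<bullet> nrm z b a x > 0" and m: "otri z' b a m"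
  shows "sgn (nrm z b a m) = u"
proof -
  have oz: "otri z a b c" "otri z b a m" using near_otri[OF nr] t(1) m by auto
  note nd = near_dot[OF oz(1) t(2)[symmetric]]
  have N: "nrm z a b c \<noteq> 0" using t by (intro nrm_nonzero[OF z]) (auto simp: otri_def)
  have u1: "norm u = 1" using t(2) N by (auto simp: norm_sgn)
  have ec: "u \<bullet> nrm z a b c > 0" using sgn_dot_pos_iff[OF N] N t(2) by auto
  have ex: "u \<bullet> nrm z a b x < 0" using x(2) by (simp add: nrm_swap[of z b a x])
  have cx: "vol z a b c x = 0" using otri_face[OF z oz(1)] x(1) t(2) by blast
  have cm: "vol z a b c m \<le> 0" using oz(1) by (auto simp: otri_def)
  have "vol z b a m x \<le> 0" using oz(2) by (simp add: otri_def)
  then have xm: "vol z a b x m \<le> 0" using vol_swap[of z b a m x] vol_swap_last[of z a b m x] by simp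
  \<comment> \<open>At \<open>z\<close> the relation equates a nonnegative with a nonpositive
    product, so both vanish and \<open>m\<close> lies in the plane of the face.\<close>
  have "vol z a b c x * (u \<bullet> nrm z a b m) - vol z a b c m * (u \<bullet> nrm z a b x)
     + (u \<bullet> nrm z a b c) * vol z a b x m = 0" by (rule plucker)
  then have "vol z a b c m * (u \<bullet> nrm z a b x) = (u \<bullet> nrm z a b c) * vol z a b x m" using cx by simp
  moreover have "vol z a b c m * (u \<bullet> nrm z a b x) \<ge> 0" using cm ex by (simp add: mult_nonpos_nonpos)
  moreover have "(u \<bullet> nrm z a b c) * vol z a b x m \<le> 0" using ec xm by (simp add: mult_nonneg_nonpos)
  ultimately have "vol z a b c m * (u \<bullet> nrm z a b x) = 0" by linarith
  then have cm0: "vol z a b c m = 0" using ex by simp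
  have fs: "a \<in> face z u" "b \<in> face z u" "m \<in> face z u"
    using otri_face[OF z oz(1)] cm0 unfolding t(2) by simp_all
  have ne: "b \<noteq> a" "a \<noteq> m" "b \<noteq> m" using m by (auto simp: otri_def)
  obtain k where k: "u = k *\<^sub>R nrm z b a m"
    using parallel_nrm[OF z ne, of u] face_eq fs by metis
  have k0: "k \<noteq> 0" using k u1 by auto
  show ?thesis
  proof (cases "k > 0")
    case True
    have "sgn u = sgn (nrm z b a m)" using True unfolding k by (simp add: sgn_scaleR)
    then show ?thesis using u1 by (simp add: sgn_div_norm)
  next
    \<comment> \<open>Opposite normals would make all points of \<open>z\<close> coplanar, with
      \<open>m\<close> on the same side of \<open>ab\<close> as \<open>c\<close>. The Pluecker
      relation at \<open>z'\<close>, where the volume of \<open>a, b, c, x\<close> does not vanish,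
      refutes this.\<close>
    case False
    then have "k < 0" using k0 by auto
    have Nm: "nrm z b a m \<bullet> nrm z b a m > 0" using nrm_nonzero[OF z ne] by simp
    have "u \<bullet> nrm z a b m = - k * (nrm z b a m \<bullet> nrm z b a m)"
      by (subst k) (simp add: nrm_swap[of z a b m])
    then have em: "u \<bullet> nrm z a b m > 0" using \<open>k < 0\<close> Nm by (simp add: mult_neg_pos)
    have x3: "x \<noteq> a" "x \<noteq> b" "x \<noteq> c" using ex ec by (auto simp: nrm_def)
    have "distinct [a, b, c, x]" using x3 t(1) by (auto simp: otri_def)
    then have "vol z' a b c x \<noteq> 0" using g by (auto simp: general_position_def)
    then have cx': "vol z' a b c x < 0" using t(1) by (auto simp: otri_def order_less_le)
    have cm': "vol z' a b c m \<le> 0" using t(1) by (auto simp: otri_def)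
    have "vol z' b a m x \<le> 0" using m by (simp add: otri_def)
    then have mx': "vol z' a b m x \<ge> 0" using vol_swap[of z' b a m x] by simp
    have "vol z' a b c m * (u \<bullet> nrm z' a b x) - vol z' a b c x * (u \<bullet> nrm z' a b m)
     + (u \<bullet> nrm z' a b c) * vol z' a b m x = 0" by (rule plucker)
    moreover have "vol z' a b c m * (u \<bullet> nrm z' a b x) \<ge> 0"
      using cm' nd(2)[OF ex] by (simp add: mult_nonpos_nonpos)
    moreover have "vol z' a b c x * (u \<bullet> nrm z' a b m) < 0"
      using cx' nd(1)[OF em] by (simp add: mult_neg_pos)
    moreover have "(u \<bullet> nrm z' a b c) * vol z' a b m x \<ge> 0" using nd(1)[OF ec] mx' by simp
    ultimately show ?thesis by linarith
  qed
qed

text \<open>One unit normal at a time: the triangles of \<open>z'\<close> that lie on the face of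
  \<open>z\<close> with normal \<open>u\<close> satisfy the axioms of
  \<open>polygon_triangulation\<close>, and \<open>ptolemy_extension\<close> extends their labels.
  Components for different normals are chosen independently.\<close>

lemma section_exists:
  fixes A :: "'n set \<Rightarrow> 'x::linordered_ab_group_add"
  shows "\<exists>d. ptolemy_section z d \<and> restricts z d z' A"
proof -
  have ex: "\<exists>f :: 'n set \<Rightarrow> 'x. cyclic_order.ptolemy (\<lambda>i j k. u \<bullet> nrm z i j k > 0) (face z u) f \<and>
     (\<forall>a b c. otri z' a b c \<and> sgn (nrm z a b c) = u \<longrightarrow> f {a, b} = A {a, b})" if u: "norm u = 1" for u
  proof -
    let ?cy = "\<lambda>i j k. u \<bullet> nrm z i j k > 0"
    let ?t = "\<lambda>a b c. otri z' a b c \<and> sgn (nrm z a b c) = u"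
    interpret C: cyclic_order "face z u" ?cy using face_cyclic_order[OF z u] .
    have tf: "a \<in> face z u" "b \<in> face z u" if "?t a b c" for a b c
    proof -
      have o: "otri z a b c" using near_otri[OF nr] that by blast
      show "a \<in> face z u" "b \<in> face z u" using otri_face[OF z o, of a] otri_face[OF z o, of b] that by simp_all
    qed
    interpret P: polygon_triangulation "face z u" ?cy ?t A
    proof
      show "?t a b c \<Longrightarrow> ?t b c a" for a b c using otri_rot[of z' a b c] by (simp only: nrm_rot[of z b c a])
      show "?cy a b c" if "?t a b c" for a b c
      proof -
        have "nrm z a b c \<noteq> 0" using that by (intro nrm_nonzero[OF z]) (auto simp: otri_def)
        then show ?thesis using sgn_dot_pos_iff[of "nrm z a b c" "nrm z a b c"] that by auto
      qed
      show "a \<in> face z u" if "?t a b c" for a b c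
        using tf that by blast
      show False if t: "?t a b p" "?t c e q" and cy: "?cy a c b" "?cy a b e" for a b p c e q
      proof -
        have f: "a \<in> face z u" "b \<in> face z u" "c \<in> face z u" "e \<in> face z u"
          using tf t by blast+
        have cy2: "?cy c b e" "?cy c e a" using C.quad_rot[of a c b e] f cy by auto
        have "vol z' a c b e \<le> 0" using crossing_vol[of a b p u c e] t cy by blast
        moreover have "vol z' c b e a \<le> 0" using crossing_vol[of c e q u b a] t cy2 by blast
        moreover have "vol z' c b e a = - vol z' a c b e"
          unfolding vol_def nrm_def by (simp add: cross3_simps)
        ultimately have "vol z' a c b e = 0" by linarith
        moreover have "distinct [a, c, b, e]"
          using C.cy_distinct[OF cy(1)] C.cy_distinct[OF cy(2)] C.cy_distinct[OF cy2(1)] by auto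
        ultimately show False using g by (auto simp: general_position_def)
      qed
      show "\<exists>m. ?t b a m" if t: "?t a b c" and x: "x \<in> face z u" "?cy b a x" for a b c x
        using opposite_otri[OF n g _ z'] opposite_otri_same_face t x by blast
    qed
    show ?thesis using P.ptolemy_extension by blast
  qed
  then obtain d where d: "\<And>u. norm u = 1 \<Longrightarrow> cyclic_order.ptolemy (\<lambda>i j k. u \<bullet> nrm z i j k > 0) (face z u) (d u)"
     "\<And>u a b c. norm u = 1 \<Longrightarrow> otri z' a b c \<Longrightarrow> sgn (nrm z a b c) = u \<Longrightarrow> d u {a, b} = A {a, b}"
    by metis
  have "ptolemy_section z d" unfolding ptolemy_section_def Let_def
  proof (intro allI impI)
    fix a b c e assume o: "otri z a b c" "otri z a c e" and s: "sgn (nrm z a b c) = sgn (nrm z a c e)"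
    define u where "u = sgn (nrm z a b c)"
    have N: "nrm z a b c \<noteq> 0" "nrm z a c e \<noteq> 0" using o by (auto dest: otri_nrm[OF z])
    have u1: "norm u = 1" using N by (simp add: u_def norm_sgn)
    have cy: "u \<bullet> nrm z a b c > 0" "u \<bullet> nrm z a c e > 0"
      using sgn_dot_pos_iff[OF N(1), of "nrm z a b c"] sgn_dot_pos_iff[OF N(2), of "nrm z a c e"] N s
      unfolding u_def by (simp_all only: inner_gt_zero_iff simp_thms)
    have f: "a \<in> face z u" "b \<in> face z u" "c \<in> face z u" "e \<in> face z u"
      using otri_face[OF z o(1), of a] otri_face[OF z o(1), of b] otri_face[OF z o(1), of c]
        otri_face[OF z o(2), of e] unfolding s u_def by simp_all
    interpret C: cyclic_order "face z u" "\<lambda>i j k. u \<bullet> nrm z i j k > 0" using face_cyclic_order[OF z u1] .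
    show "d (sgn (nrm z a b c)) {a, c} + d (sgn (nrm z a b c)) {b, e} =
       max (d (sgn (nrm z a b c)) {a, b} + d (sgn (nrm z a b c)) {c, e})
        (d (sgn (nrm z a b c)) {b, c} + d (sgn (nrm z a b c)) {e, a})"
      using d(1)[OF u1] f cy unfolding C.ptolemy_def u_def[symmetric] by blast
  qed
  moreover have "restricts z d z' A" unfolding restricts_def
  proof (intro allI impI)
    fix a b c assume o: "otri z' a b c"
    then have N: "nrm z a b c \<noteq> 0" using otri_nrm[OF z near_otri[OF nr]] by blast
    show "A {a, b} = d (sgn (nrm z a b c)) {a, b}" using d(2)[OF _ o refl] N by (simp add: norm_sgn)
  qed
  ultimately show ?thesis by blast
qed

end

section \<open>Crossing a cocircular quadrilateral\<close>

lemma near_neg: "near z z' \<Longrightarrow> vol z a b c x < 0 \<Longrightarrow> vol z' a b c x < 0"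
  unfolding near_def using vol_swap[of z b a c x] vol_swap[of z' b a c x]
  by (metis neg_0_less_iff_less)

lemma near_zero: "near z z' \<Longrightarrow> vol z' a b c x = 0 \<Longrightarrow> vol z a b c x = 0"
  using near_neg[of z z' a b c x] unfolding near_def by (metis less_irrefl linorder_neqE)

lemma near_noncrit_otri:
  assumes z: "z \<in> configuration_space" and nc: "\<not> is_critical z" and nr: "near z z'"
  shows "otri z' = otri z"
proof (intro ext iffI)
  fix a b c assume o: "otri z a b c"
  have "vol z' a b c x \<le> 0" for x
  proof (cases "x \<in> {a, b, c}")
    case False
    then have "vol z a b c x \<noteq> 0" using nc o unfolding is_critical_iff[OF z] by blast
    then have "vol z a b c x < 0" using o by (auto simp: otri_def less_le)
    then show ?thesis using near_neg[OF nr] by force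
  qed auto
  then show "otri z' a b c" using o by (simp add: otri_def)
qed (use near_otri[OF nr] in auto)

lemma near_noncrit:
  assumes "z \<in> configuration_space" "z' \<in> configuration_space" "\<not> is_critical z" "near z z'"
  shows "\<not> is_critical z'"
  using assms near_zero[OF assms(4)] near_noncrit_otri[OF assms(1,3,4)] unfolding is_critical_iff[OF assms(1)] is_critical_iff[OF assms(2)]
  by metis

lemma near_noncrit_delaunay:
  fixes z :: "(real^3)^'n"
  assumes "z \<in> configuration_space" "z' \<in> configuration_space" "\<not> is_critical z" "near z z'" "CARD('n) \<ge> 4"
  shows "delaunay z' = delaunay z"
  using delaunay_eq[OF assms(1,3,5)] delaunay_eq[OF assms(2) near_noncrit[OF assms(1-4)] assms(5)]
    near_noncrit_otri[OF assms(1,3,4)] by simp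

text \<open>The degeneracy of a generic critical time: \<open>a, b, c, e\<close> are in
  counterclockwise order on one face, and no other quadruple lies on a supporting plane. Cocircular
  quadruples whose plane does not support the hull remain allowed.\<close>

definition quad :: "(real^3)^'n \<Rightarrow> 'n \<Rightarrow> 'n \<Rightarrow> 'n \<Rightarrow> 'n \<Rightarrow> bool" where
  "quad y a b c e \<longleftrightarrow> otri y a b c \<and> otri y a c e \<and> sgn (nrm y a b c) = sgn (nrm y a c e) \<and>
     (\<forall>i j k x. otri y i j k \<longrightarrow> x \<notin> {i, j, k} \<longrightarrow> vol y i j k x = 0 \<longrightarrow> {i, j, k, x} = {a, b, c, e})"

lemma sgn_nrm_coplanar:
  assumes y: "y \<in> configuration_space" and o: "otri y i j k" "otri y l m o'"
    and s: "sgn (nrm y i j k) = sgn (nrm y l m o')" and x: "x \<in> {l, m, o'}"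
  shows "vol y i j k x = 0"
proof -
  have "vol y l m o' x = 0" using x by auto
  then show ?thesis using otri_face[OF y o(1), of x] otri_face[OF y o(2), of x] s by simp
qed

lemma otri_of_sgn:
  assumes y: "y \<in> configuration_space" and o: "otri y i j k"
    and v: "\<And>x. x \<in> {l, m, q} \<Longrightarrow> vol y i j k x = 0"
    and p: "sgn (nrm y i j k) \<bullet> nrm y l m q > 0"
  shows "otri y l m q" "sgn (nrm y l m q) = sgn (nrm y i j k)"
proof -
  define u where "u = sgn (nrm y i j k)"
  have N0: "nrm y i j k \<noteq> 0" using otri_nrm[OF y o] .
  then have u1: "norm u = 1" by (simp add: u_def norm_sgn)
  have d: "l \<noteq> m" "m \<noteq> q" "l \<noteq> q" using p by (auto simp: nrm_def)
  note oc = otri_circle[OF y o, folded u_def]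
  have eq: "u \<bullet> y $ l = u \<bullet> y $ i" "u \<bullet> y $ m = u \<bullet> y $ i" "u \<bullet> y $ q = u \<bullet> y $ i"
    using oc(4) v by blast+
  obtain k' where k': "u = k' *\<^sub>R nrm y l m q" using parallel_nrm[OF y d, of u] eq by metis
  have "u \<bullet> nrm y l m q = k' * (nrm y l m q \<bullet> nrm y l m q)" by (subst k') simp
  then have kp: "k' > 0" using p inner_ge_zero[of "nrm y l m q"] unfolding u_def[symmetric] by (auto simp: zero_less_mult_iff)
  have "sgn u = sgn (nrm y l m q)" using kp unfolding k' by (simp add: sgn_scaleR)
  moreover have "sgn u = u" using u1 by (simp add: sgn_div_norm)
  ultimately show "sgn (nrm y l m q) = sgn (nrm y i j k)" unfolding u_def[symmetric] by simp
  have "vol y l m q x \<le> 0" for x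
  proof -
    have "k' * vol y l m q x = u \<bullet> (y $ x - y $ l)" unfolding vol_def by (subst k') simp
    also have "\<dots> \<le> 0" using oc(3)[of x] eq by (simp add: inner_diff_right)
    finally show ?thesis using kp by (simp add: mult_le_0_iff)
  qed
  then show "otri y l m q" using d by (simp add: otri_def)
qed

text \<open>Coplanarity passes from \<open>y\<close> to \<open>z\<close> by
  \<open>near_zero\<close>, but the normals could a priori be opposite at \<open>z\<close>; the
  second condition of \<open>near\<close> excludes that. Thus a flip at \<open>y\<close> is a
  Ptolemy relation in a single component of a section at \<open>z\<close>.\<close>

lemma near_sgn_nrm:
  assumes z: "z \<in> configuration_space" and y: "y \<in> configuration_space" and nr: "near z y"
    and o: "otri y i j k" "otri y l m q" and s: "sgn (nrm y i j k) = sgn (nrm y l m q)"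
  shows "sgn (nrm z i j k) = sgn (nrm z l m q)"
proof -
  have oz: "otri z i j k" "otri z l m q" using near_otri[OF nr] o by auto
  have N: "nrm z i j k \<noteq> 0" "nrm z l m q \<noteq> 0" "nrm y i j k \<noteq> 0" "nrm y l m q \<noteq> 0"
    using otri_nrm z y oz o by blast+
  have v: "vol z i j k x = 0" if "x \<in> {l, m, q}" for x
    using near_zero[OF nr] sgn_nrm_coplanar[OF y o s that] by blast
  have d: "l \<noteq> m" "m \<noteq> q" "l \<noteq> q" using o by (auto simp: otri_def)
  define u where "u = sgn (nrm z i j k)"
  have u1: "norm u = 1" using N by (simp add: u_def norm_sgn)
  note oc = otri_circle[OF z oz(1), folded u_def]
  have eq: "u \<bullet> z $ l = u \<bullet> z $ i" "u \<bullet> z $ m = u \<bullet> z $ i" "u \<bullet> z $ q = u \<bullet> z $ i"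
    using oc(4) v by blast+
  obtain k' where k': "u = k' *\<^sub>R nrm z l m q" using parallel_nrm[OF z d, of u] eq by metis
  have "nrm z i j k \<bullet> nrm z i j k > 0" using N by simp
  then have 1: "nrm z i j k \<bullet> nrm y i j k > 0" using nr unfolding near_def by blast
  have "u \<bullet> nrm y i j k > 0" unfolding u_def sgn_dot_pos_iff[OF N(1)] using 1 .
  moreover have "nrm y i j k = norm (nrm y i j k) *\<^sub>R sgn (nrm y i j k)" using N by (simp add: sgn_div_norm)
  ultimately have us: "u \<bullet> sgn (nrm y l m q) > 0" using N s by (metis inner_scaleR_right zero_less_mult_iff zero_less_norm_iff not_less_iff_gr_or_eq)
  have kp: "k' > 0"
  proof (rule ccontr)
    assume "\<not> k' > 0"
    moreover have "k' \<noteq> 0" using k' u1 by auto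
    ultimately have "k' < 0" by simp
    have Nm: "nrm z l m q \<bullet> nrm z l m q > 0" using N by simp
    have "u \<bullet> nrm z m l q = - (k' * (nrm z l m q \<bullet> nrm z l m q))"
      by (subst k') (simp add: nrm_swap[of z m l q])
    then have "u \<bullet> nrm z m l q > 0" using \<open>k' < 0\<close> Nm by (simp add: mult_neg_pos)
    then have "nrm z i j k \<bullet> nrm z m l q > 0" unfolding u_def sgn_dot_pos_iff[OF N(1)] .
    then have "nrm z i j k \<bullet> nrm y m l q > 0" using nr unfolding near_def by blast
    then have "u \<bullet> nrm y m l q > 0" unfolding u_def sgn_dot_pos_iff[OF N(1)] .
    then have "u \<bullet> nrm y l m q < 0" by (simp add: nrm_swap[of y m l q])
    moreover have "sgn (nrm y l m q) \<bullet> u > 0" using us by (simp add: inner_commute)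
    ultimately show False unfolding sgn_dot_pos_iff[OF N(4)] by (simp add: inner_commute)
  qed
  have "sgn u = sgn (nrm z l m q)" using kp unfolding k' by (simp add: sgn_scaleR)
  moreover have "sgn u = u" using u1 by (simp add: sgn_div_norm)
  ultimately show ?thesis unfolding u_def[symmetric] by simp
qed

context
  fixes y :: "(real^3)^'n" and a b c e :: 'n
  assumes y: "y \<in> configuration_space" and q: "quad y a b c e" and n5: "CARD('n) \<ge> 5"
begin

lemma quad_vol: "x \<in> {a, b, c, e} \<Longrightarrow> vol y a b c x = 0"
  using q sgn_nrm_coplanar[OF y, of a b c a c e x] by (auto simp: quad_def)

lemma quad_other: "\<exists>x. x \<notin> {a, b, c, e}"
proof (rule ccontr)
  assume "\<not> ?thesis"
  then have "UNIV = {a, b, c, e}" by blast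
  moreover have "card {a, b, c, e} \<le> 4" by (auto simp: card_insert_if)
  ultimately show False using n5 by simp
qed

text \<open>If both orientations are supporting, all points are coplanar, and with at least five
  points a second quadruple would be degenerate.\<close>

lemma quad_no_both:
  assumes o: "otri y i j k" "otri y j i k" shows False
proof -
  have v: "vol y i j k x = 0" for x
  proof -
    have "vol y i j k x \<le> 0" "vol y j i k x \<le> 0" using o by (simp_all add: otri_def)
    then show ?thesis using vol_swap[of y j i k x] by linarith
  qed
  have d: "i \<noteq> j" "j \<noteq> k" "i \<noteq> k" using o by (auto simp: otri_def)
  have "UNIV \<noteq> {i, j, k}"
  proof
    assume "UNIV = {i, j, k}"
    then have "CARD('n) \<le> 3" by (metis card_3_le)
    then show False using n5 by simp
  qed
  then obtain x where x: "x \<notin> {i, j, k}" by blast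
  have Q: "{i, j, k, x} = {a, b, c, e}" if "x \<notin> {i, j, k}" for x using q o v that unfolding quad_def by blast
  obtain x' where x': "x' \<notin> {a, b, c, e}" using quad_other by blast
  then have "x' \<notin> {i, j, k}" using Q[OF x] by blast
  then show False using Q[of x'] x' by blast
qed

lemma quad_distinct: "distinct [a, b, c, e]"
proof -
  have "b \<noteq> e"
  proof
    assume "b = e"
    then have "otri y a b c" "otri y a c b" using q by (auto simp: quad_def)
    then show False using quad_no_both[of b c a] otri_rot by metis
  qed
  then show ?thesis using q by (auto simp: quad_def otri_def)
qed

lemma quad_cyclic:
  "sgn (nrm y a b c) \<bullet> nrm y a b c > 0" "sgn (nrm y a b c) \<bullet> nrm y a c e > 0"
  "sgn (nrm y a b c) \<bullet> nrm y b c e > 0" "sgn (nrm y a b c) \<bullet> nrm y b e a > 0"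
proof -
  define u where "u = sgn (nrm y a b c)"
  have o: "otri y a b c" "otri y a c e" "sgn (nrm y a c e) = u" using q by (auto simp: quad_def u_def)
  have N: "nrm y a b c \<noteq> 0" "nrm y a c e \<noteq> 0" using otri_nrm y o by blast+
  have u1: "norm u = 1" using N by (simp add: u_def norm_sgn)
  have f: "a \<in> face y u" "b \<in> face y u" "c \<in> face y u" "e \<in> face y u"
    using otri_face[OF y o(1)] quad_vol unfolding u_def by auto
  have cy: "u \<bullet> nrm y a b c > 0" "u \<bullet> nrm y a c e > 0"
    using sgn_dot_pos_iff[OF N(1), of "nrm y a b c"] sgn_dot_pos_iff[OF N(2), of "nrm y a c e"] N
    unfolding o(3) u_def[symmetric] by simp_all
  interpret C: cyclic_order "face y u" "\<lambda>i j k. u \<bullet> nrm y i j k > 0" using face_cyclic_order[OF y u1] .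
  have "u \<bullet> nrm y b c e > 0" "u \<bullet> nrm y b e a > 0" using C.quad_rot[OF f cy] by auto
  then show "sgn (nrm y a b c) \<bullet> nrm y a b c > 0" "sgn (nrm y a b c) \<bullet> nrm y a c e > 0"
    "sgn (nrm y a b c) \<bullet> nrm y b c e > 0" "sgn (nrm y a b c) \<bullet> nrm y b e a > 0"
    using cy unfolding u_def by auto
qed

text \<open>Makes the two diagonals \<open>ac\<close> and \<open>be\<close> interchangeable.\<close>

lemma quad_rotate: "quad y b c e a"
proof -
  have o: "otri y a b c" using q by (simp add: quad_def)
  have 1: "otri y b c e" "sgn (nrm y b c e) = sgn (nrm y a b c)"
    using otri_of_sgn[OF y o _ quad_cyclic(3)] quad_vol by auto
  have 2: "otri y b e a" "sgn (nrm y b e a) = sgn (nrm y a b c)"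
    using otri_of_sgn[OF y o _ quad_cyclic(4)] quad_vol by auto
  have "{b, c, e, a} = {a, b, c, e}" by auto
  then show ?thesis using 1 2 q unfolding quad_def by simp
qed

text \<open>A diagonal of the degenerate face is an edge of no other face. For a normal
  \<open>w\<close> supporting at \<open>a\<close> and \<open>c\<close>, \<open>cramer\<close> gives
  a vanishing sum of two nonnegative terms, so \<open>w\<close> also vanishes on
  \<open>y $ b - y $ a\<close> and the plane is that of the quadrilateral.\<close>

lemma quad_no_diagonal:
  assumes o: "otri y a c k \<or> otri y c a k" shows "k \<in> {a, b, c, e}"
proof (rule ccontr)
  assume k: "k \<notin> {a, b, c, e}"
  define u where "u = sgn (nrm y a b c)"
  define w where "w = (if otri y a c k then nrm y a c k else nrm y c a k)"
  have w: "w \<bullet> (y $ c - y $ a) = 0" "\<And>x. w \<bullet> (y $ x - y $ a) \<le> 0"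
    using o unfolding w_def by (auto simp: vol_def[symmetric] vol_base otri_def)
  have v0: "vol y a c b e = 0" using quad_vol[of e] vol_swap_mid[of y a c b e] by simp
  have cy: "u \<bullet> nrm y a e c < 0" "u \<bullet> nrm y a c b < 0"
    using quad_cyclic(1,2) by (simp_all add: u_def nrm_swap'[of y a e c] nrm_swap'[of y a c b])
  have "0 = (u \<bullet> nrm y a e c) * (w \<bullet> (y $ b - y $ a)) + (u \<bullet> nrm y a c b) * (w \<bullet> (y $ e - y $ a))"
    using cramer[of y a c b e w u] v0 w(1) by simp
  moreover have "(u \<bullet> nrm y a e c) * (w \<bullet> (y $ b - y $ a)) \<ge> 0" "(u \<bullet> nrm y a c b) * (w \<bullet> (y $ e - y $ a)) \<ge> 0"
    using cy w(2) by (auto intro!: mult_nonpos_nonpos simp: less_imp_le)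
  ultimately have "(u \<bullet> nrm y a e c) * (w \<bullet> (y $ b - y $ a)) = 0" by linarith
  then have wb: "w \<bullet> (y $ b - y $ a) = 0" using cy by simp
  have bk: "b \<notin> {a, c, k}" using quad_distinct k by auto
  have "{a, c, k, b} = {a, b, c, e}"
  proof (cases "otri y a c k")
    case True
    then have "vol y a c k b = 0" using wb by (simp add: w_def vol_def)
    then show ?thesis using True q bk unfolding quad_def by blast
  next
    case False
    then have o': "otri y c a k" using o by blast
    have "vol y c a k b = 0" using wb False by (simp add: w_def vol_base)
    then have "{c, a, k, b} = {a, b, c, e}" using o' q bk unfolding quad_def by blast
    then show ?thesis by auto
  qed
  then show False using k by auto
qed

text \<open>Near \<open>y\<close> nothing changes outside the degenerate face, and inside it the
  sign of the volume selects the diagonal: a negative \<open>vol z a b c e\<close> puts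
  \<open>e\<close> below the plane of \<open>abc\<close>, which gives \<open>ac\<close>.\<close>

lemma quad_near_otri:
  assumes nr: "near y z" and neg: "vol z a b c e < 0"
  shows "otri z i j k \<longleftrightarrow> otri y i j k \<and> \<not> {i, j, k} \<subseteq> {a, b, c, e} \<or>
    (i, j, k) \<in> {(a, b, c), (b, c, a), (c, a, b), (a, c, e), (c, e, a), (e, a, c)}" (is "_ \<longleftrightarrow> ?S \<or> ?R")
proof
  have oy: "otri y a b c" "otri y a c e" "otri y b c e" "otri y b e a"
    using q quad_rotate by (auto simp: quad_def)
  have big: "otri y i j k" if "otri z i j k" for i j k using near_otri[OF nr that] .
  assume o: "otri z i j k"
  show "?S \<or> ?R"
  proof (cases "{i, j, k} \<subseteq> {a, b, c, e}")
    case True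
    \<comment> \<open>Reversed triples are excluded by \<open>quad_no_both\<close>, triangles on the
      diagonal \<open>be\<close> by the sign of the volume; rotation settles the remaining oriented
      triples.\<close>
    have no: "\<not> otri z c b a" "\<not> otri z e c a" "\<not> otri z e c b" "\<not> otri z a e b"
      using big quad_no_both oy otri_rot by blast+
    have no2: "\<not> otri z b c e" "\<not> otri z b e a"
    proof -
      have "vol z b c e a = - vol z a b c e" unfolding vol_def nrm_def by (simp add: cross3_simps)
      then show "\<not> otri z b c e" using neg unfolding otri_def by (metis neg_0_less_iff_less not_le)
      have "vol z b e a c = - vol z a b c e" unfolding vol_def nrm_def by (simp add: cross3_simps)
      then show "\<not> otri z b e a" using neg unfolding otri_def by (metis neg_0_less_iff_less not_le)
    qed
    have no3: "\<not> otri z i i k" "\<not> otri z i k i" "\<not> otri z k i i" for i k by (auto simp: otri_def)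
    have no4: "\<not> otri z b a c" "\<not> otri z a c b" "\<not> otri z c a e" "\<not> otri z a e c" "\<not> otri z c b e" "\<not> otri z b e c"
       "\<not> otri z e b a" "\<not> otri z b a e" "\<not> otri z c e b" "\<not> otri z e b c" "\<not> otri z e a b" "\<not> otri z a b e"
      using no no2 otri_rot by blast+
    have "i \<in> {a, b, c, e}" "j \<in> {a, b, c, e}" "k \<in> {a, b, c, e}" using True by auto
    then show ?thesis using o
      by (elim insertE emptyE) (simp_all only: no no2 no3 no4 insert_iff simp_thms)
  qed (use big[OF o] in blast)
next
  assume sr: "?S \<or> ?R"
  have unq: "\<And>i j k x. otri y i j k \<Longrightarrow> x \<notin> {i, j, k} \<Longrightarrow> vol y i j k x = 0 \<Longrightarrow> {i, j, k, x} = {a, b, c, e}"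
    using q unfolding quad_def by blast
  have *: "otri z i j k" if o: "otri y i j k"
    and x: "\<And>x. x \<notin> {i, j, k} \<Longrightarrow> {i, j, k, x} = {a, b, c, e} \<Longrightarrow> vol z i j k x \<le> 0" for i j k
  proof -
    have "vol z i j k x \<le> 0" for x
    proof (cases "x \<in> {i, j, k}")
      case False
      show ?thesis
      proof (cases "vol y i j k x = 0")
        case True then show ?thesis using x False unq[OF o False True] by blast
      next
        case nz: False
        then have "vol y i j k x < 0" using o by (auto simp: otri_def less_le)
        then show ?thesis using near_neg[OF nr] by force
      qed
    qed auto
    then show ?thesis using o by (simp add: otri_def)
  qed
  have d: "distinct [a, b, c, e]" by (rule quad_distinct)
  have abc: "otri z a b c"
  proof (rule *)
    show "otri y a b c" using q by (simp add: quad_def)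
    show "vol z a b c x \<le> 0" if "x \<notin> {a, b, c}" "{a, b, c, x} = {a, b, c, e}" for x
    proof -
      have "x = e" using that d by auto
      then show ?thesis using neg by simp
    qed
  qed
  have ace: "otri z a c e"
  proof (rule *)
    show "otri y a c e" using q by (simp add: quad_def)
    show "vol z a c e x \<le> 0" if "x \<notin> {a, c, e}" "{a, c, e, x} = {a, b, c, e}" for x
    proof -
      have "x = b" using that d by auto
      moreover have "vol z a c e b = vol z a b c e" unfolding vol_def nrm_def by (simp add: cross3_simps)
      ultimately show ?thesis using neg by simp
    qed
  qed
  show "otri z i j k"
  proof (cases ?R)
    case True then show ?thesis using abc ace otri_rot by blast
  next
    case False
    then have ?S using sr by blast
    then show ?thesis by (intro *) auto
  qed
qed

lemma quad_near_noncrit: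
  assumes nr: "near y z" and neg: "vol z a b c e < 0" and z: "z \<in> configuration_space"
  shows "\<not> is_critical z"
proof
  assume "is_critical z"
  then obtain i j k x where o: "otri z i j k" and x: "x \<notin> {i, j, k}" and v: "vol z i j k x = 0"
    unfolding is_critical_iff[OF z] by blast
  have "{i, j, k, x} = {a, b, c, e}"
    using q near_otri[OF nr o] x near_zero[OF nr v] unfolding quad_def by blast
  then have "{i, j, k} \<subseteq> {a, b, c, e}" and xQ: "x \<in> {a, b, c, e}" by auto
  then have ijk: "(i, j, k) \<in> {(a, b, c), (b, c, a), (c, a, b), (a, c, e), (c, e, a), (e, a, c)}"
    using o quad_near_otri[OF nr neg, of i j k] by fast
  have s: "vol z a c e b = vol z a b c e" unfolding vol_def nrm_def by (simp add: cross3_simps)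
  have r: "vol z b c a e = vol z a b c e" "vol z c a b e = vol z a b c e"
    "vol z c e a b = vol z a c e b" "vol z e a c b = vol z a c e b"
    unfolding vol_def nrm_def by (simp_all add: cross3_simps)
  show False using ijk x xQ v neg s r by auto
qed

end

text \<open>A positive \<open>vol z2 a b c e\<close> is a negative volume for the rotated quadruple
  \<open>b, c, e, a\<close>, so \<open>quad_near_otri\<close> describes both sides of the crossing,
  with complementary diagonals.\<close>

lemma quad_flip:
  fixes y z1 z2 :: "(real^3)^'n"
  assumes y: "y \<in> configuration_space" and q: "quad y a b c e" and n5: "CARD('n) \<ge> 5"
    and z: "z1 \<in> configuration_space" "z2 \<in> configuration_space" and nr: "near y z1" "near y z2"
    and s: "vol z1 a b c e < 0" "vol z2 a b c e > 0"
  shows "is_flip a b c e (delaunay z1) (delaunay z2)"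
    "{a, b, e} \<notin> snd (delaunay z1)" "{b, c, e} \<notin> snd (delaunay z1)"
    "{a, b, c} \<notin> snd (delaunay z2)" "{a, c, e} \<notin> snd (delaunay z2)"
proof -
  have n4: "CARD('n) \<ge> 4" using n5 by simp
  have q': "quad y b c e a" using quad_rotate[OF y q n5] .
  have s2: "vol z2 b c e a < 0"
  proof -
    have "vol z2 b c e a = - vol z2 a b c e" unfolding vol_def nrm_def by (simp add: cross3_simps)
    then show ?thesis using s by simp
  qed
  define Q where "Q = {a, b, c, e}"
  have Q': "{b, c, e, a} = Q" by (auto simp: Q_def)
  \<comment> \<open>The triangles outside the degenerate face, which both sides share.\<close>
  define st where "st i j k \<longleftrightarrow> otri y i j k \<and> \<not> {i, j, k} \<subseteq> Q" for i j k
  have o1: "otri z1 i j k \<longleftrightarrow> st i j k \<or> (i, j, k) \<in> {(a, b, c), (b, c, a), (c, a, b), (a, c, e), (c, e, a), (e, a, c)}" for i j k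
    using quad_near_otri[OF y q n5 nr(1) s(1), of i j k] unfolding st_def Q_def .
  have o2: "otri z2 i j k \<longleftrightarrow> st i j k \<or> (i, j, k) \<in> {(b, c, e), (c, e, b), (e, b, c), (b, e, a), (e, a, b), (a, b, e)}" for i j k
    using quad_near_otri[OF y q' n5 nr(2) s2, of i j k] unfolding st_def Q' .
  note D1 = delaunay_eq[OF z(1) quad_near_noncrit[OF y q n5 nr(1) s(1) z(1)] n4]
  note D2 = delaunay_eq[OF z(2) quad_near_noncrit[OF y q' n5 nr(2) s2 z(2)] n4]
  have d: "distinct [a, b, c, e]" by (rule quad_distinct[OF y q n5])
  define ST where "ST = {{i, j, k} |i j k. st i j k}"
  define SE where "SE = {{i, j} |i j. \<exists>k. st i j k}"
  have T1: "snd (delaunay z1) = ST \<union> {{a, b, c}, {a, c, e}}"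
    unfolding D1 snd_conv o1 ST_def by (auto simp: insert_commute)
  have T2: "snd (delaunay z2) = ST \<union> {{a, b, e}, {b, c, e}}"
    unfolding D2 snd_conv o2 ST_def by (auto simp: insert_commute)
  have E1: "fst (delaunay z1) = SE \<union> {{a, b}, {b, c}, {c, e}, {e, a}, {a, c}}"
  proof (intro equalityI subsetI)
    fix E assume "E \<in> fst (delaunay z1)"
    then obtain i j k where ij: "E = {i, j}" "otri z1 i j k" unfolding D1 fst_conv by blast
    show "E \<in> SE \<union> {{a, b}, {b, c}, {c, e}, {e, a}, {a, c}}"
    proof (cases "st i j k")
      case True then show ?thesis using ij(1) unfolding SE_def by blast
    next
      case False
      then show ?thesis using ij(2) unfolding o1 ij(1) by (auto simp: insert_commute)
    qed
  next
    fix E assume E: "E \<in> SE \<union> {{a, b}, {b, c}, {c, e}, {e, a}, {a, c}}"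
    have "otri z1 a b c" "otri z1 b c a" "otri z1 c e a" "otri z1 e a c" "otri z1 a c e" by (simp_all add: o1)
    moreover have "E \<in> SE \<Longrightarrow> \<exists>i j k. E = {i, j} \<and> otri z1 i j k" unfolding SE_def o1 by blast
    ultimately show "E \<in> fst (delaunay z1)" using E unfolding D1 fst_conv by blast
  qed
  have E2: "fst (delaunay z2) = SE \<union> {{a, b}, {b, c}, {c, e}, {e, a}, {b, e}}"
  proof (intro equalityI subsetI)
    fix E assume "E \<in> fst (delaunay z2)"
    then obtain i j k where ij: "E = {i, j}" "otri z2 i j k" unfolding D2 fst_conv by blast
    show "E \<in> SE \<union> {{a, b}, {b, c}, {c, e}, {e, a}, {b, e}}"
    proof (cases "st i j k")
      case True then show ?thesis using ij(1) unfolding SE_def by blast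
    next
      case False
      then show ?thesis using ij(2) unfolding o2 ij(1) by (auto simp: insert_commute)
    qed
  next
    fix E assume E: "E \<in> SE \<union> {{a, b}, {b, c}, {c, e}, {e, a}, {b, e}}"
    have "otri z2 a b e" "otri z2 b c e" "otri z2 c e b" "otri z2 e a b" "otri z2 b e a" by (simp_all add: o2)
    moreover have "E \<in> SE \<Longrightarrow> \<exists>i j k. E = {i, j} \<and> otri z2 i j k" unfolding SE_def o2 by blast
    ultimately show "E \<in> fst (delaunay z2)" using E unfolding D2 fst_conv by blast
  qed
  have ST: "D \<notin> ST" if "D \<subseteq> Q" for D using that unfolding ST_def st_def by blast
  \<comment> \<open>The old diagonal really disappears: no shared triangle has it as an
    edge.\<close>
  have SE: "{a, c} \<notin> SE"
  proof
    assume "{a, c} \<in> SE"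
    then obtain i j k where ij: "{a, c} = {i, j}" "st i j k" unfolding SE_def by blast
    then have "otri y a c k \<or> otri y c a k" unfolding st_def by (auto simp: doubleton_eq_iff)
    then have "k \<in> Q" using quad_no_diagonal[OF y q n5] unfolding Q_def by blast
    then show False using ij unfolding st_def Q_def by auto
  qed
  show "is_flip a b c e (delaunay z1) (delaunay z2)"
    unfolding is_flip_def T1 T2 E1 E2
  proof (intro conjI)
    show "ST \<union> {{a, b, e}, {b, c, e}} = ST \<union> {{a, b, c}, {a, c, e}} - {{a, b, c}, {a, c, e}} \<union> {{a, b, e}, {b, c, e}}"
      using ST[of "{a, b, c}"] ST[of "{a, c, e}"] by (auto simp: Q_def)
    have "{a, c} \<noteq> {a, b}" "{a, c} \<noteq> {b, c}" "{a, c} \<noteq> {c, e}" "{a, c} \<noteq> {e, a}"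
      using d by (auto simp: doubleton_eq_iff)
    then show "SE \<union> {{a, b}, {b, c}, {c, e}, {e, a}, {b, e}}
      = SE \<union> {{a, b}, {b, c}, {c, e}, {e, a}, {a, c}} - {{a, c}} \<union> {{b, e}}"
      using SE by auto
  qed (use d in auto)
  have x: "c \<notin> {a, b, e}" "a \<notin> {b, c, e}" "b \<notin> {a, c, e}" "e \<notin> {a, b, c}" using d by auto
  show "{a, b, e} \<notin> snd (delaunay z1)" "{b, c, e} \<notin> snd (delaunay z1)"
    "{a, b, c} \<notin> snd (delaunay z2)" "{a, c, e} \<notin> snd (delaunay z2)"
    unfolding T1 T2 using ST[of "{a, b, e}"] ST[of "{b, c, e}"] ST[of "{a, b, c}"] ST[of "{a, c, e}"] x
    unfolding Q_def by blast+
qed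

text \<open>The definite description is unambiguous: the two removed triangles are determined by
  \<open>T\<close> and \<open>T'\<close>, their intersection is the old diagonal, the rest of their
  union the new one, and the Ptolemy expression is invariant under the relabelings that
  remain.\<close>

lemma flip_labels_eq:
  fixes a :: 'a
  assumes f: "is_flip a b c e T T'" and n: "{a, b, e} \<notin> snd T" "{b, c, e} \<notin> snd T"
  shows "flip_labels T T' A = A({b, e} := max (A {a, b} + A {c, e}) (A {b, c} + A {e, a}) - A {a, c})"
  unfolding flip_labels_def
proof (rule the_equality)
  show "\<exists>a' b' c' d'. is_flip a' b' c' d' T T' \<and>
     A({b, e} := max (A {a, b} + A {c, e}) (A {b, c} + A {e, a}) - A {a, c}) =
     A({b', d'} := max (A {a', b'} + A {c', d'}) (A {b', c'} + A {d', a'}) - A {a', c'})"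
    using f by blast
  fix A' assume "\<exists>a b c d. is_flip a b c d T T' \<and>
         A' = A({b, d} := max (A {a, b} + A {c, d}) (A {b, c} + A {d, a}) - A {a, c})"
  then obtain a' b' c' e' where f': "is_flip a' b' c' e' T T'"
    and A': "A' = A({b', e'} := max (A {a', b'} + A {c', e'}) (A {b', c'} + A {e', a'}) - A {a', c'})" by blast
  have d: "distinct [a, b, c, e]" "distinct [a', b', c', e']" using f f' by (auto simp: is_flip_def)
  have ne: "{a, b, c} \<noteq> {a, b, e}" "{a, b, c} \<noteq> {b, c, e}" "{a, c, e} \<noteq> {a, b, e}" "{a, c, e} \<noteq> {b, c, e}"
    using d by auto
  have "{{a, b, c}, {a, c, e}} \<subseteq> snd T - snd T'"
    using f ne unfolding is_flip_def by auto
  moreover have "snd T - snd T' \<subseteq> {{a', b', c'}, {a', c', e'}}"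
    using f' unfolding is_flip_def by auto
  ultimately have sub: "{{a, b, c}, {a, c, e}} \<subseteq> {{a', b', c'}, {a', c', e'}}" by blast
  have tri: "{a, b, c} \<noteq> {a, c, e}" using d by auto
  have "\<And>X Y P Q :: 'a set. {X, Y} \<subseteq> {P, Q} \<Longrightarrow> X \<noteq> Y \<Longrightarrow> X = P \<and> Y = Q \<or> X = Q \<and> Y = P" by blast
  from this[OF sub tri]
  have cs: "{a, b, c} \<inter> {a, c, e} = {a', b', c'} \<inter> {a', c', e'} \<and> {a, b, c} \<union> {a, c, e} = {a', b', c'} \<union> {a', c', e'}"
    by (elim disjE conjE) (simp_all only: Int_commute Un_commute simp_thms)
  have i: "{a, b, c} \<inter> {a, c, e} = {a, c}" "{a', b', c'} \<inter> {a', c', e'} = {a', c'}"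
     "({a, b, c} \<union> {a, c, e}) - {a, c} = {b, e}" "({a', b', c'} \<union> {a', c', e'}) - {a', c'} = {b', e'}"
    using d by auto
  have "{a, c} = {a', c'}" using cs i(1,2) by simp
  moreover have "{b, e} = {b', e'}" using cs i(3,4) calculation by metis
  ultimately have "a = a' \<and> c = c' \<or> a = c' \<and> c = a'" "b = b' \<and> e = e' \<or> b = e' \<and> e = b'"
    by (auto simp: doubleton_eq_iff)
  then show "A' = A({b, e} := max (A {a, b} + A {c, e}) (A {b, c} + A {e, a}) - A {a, c})"
    unfolding A' by (auto simp: insert_commute max.commute add.commute)
qed

text \<open>The four sides and the old diagonal carry values of one component of \<open>d\<close>,
  whose Ptolemy relation is exactly the rule for the new label. Three scales are nested here:
  \<open>z1\<close> and \<open>z2\<close> are near \<open>y\<close>, which is near the possibly more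
  degenerate \<open>z\<close>.\<close>

lemma restricts_flip:
  fixes y z z1 z2 :: "(real^3)^'n" and A :: "'n set \<Rightarrow> 'x::linordered_ab_group_add"
  assumes y: "y \<in> configuration_space" and q: "quad y a b c e" and n5: "CARD('n) \<ge> 5"
    and zc: "z \<in> configuration_space" "z1 \<in> configuration_space" "z2 \<in> configuration_space"
    and nr: "near y z1" "near y z2" "near z y" and nc: "\<not> is_critical z1" "\<not> is_critical z2"
    and fl: "is_flip a b c e (delaunay z1) (delaunay z2)"
    and d: "ptolemy_section z d" and r: "restricts z d z1 A"
  shows "restricts z d z2 (flip_labels (delaunay z1) (delaunay z2) A)"
proof -
  have n4: "CARD('n) \<ge> 4" using n5 by simp
  have q': "quad y b c e a" using quad_rotate[OF y q n5] .
  have dist: "distinct [a, b, c, e]" by (rule quad_distinct[OF y q n5])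
  have vrot: "vol w b c e a = - vol w a b c e" for w :: "(real^3)^'n"
    unfolding vol_def nrm_def by (simp add: cross3_simps)
  have trn: "\<And>w :: (real^3)^'n. w \<in> configuration_space \<Longrightarrow> snd (delaunay w) = {{i, j, k} |i j k. otri w i j k}"
    unfolding delaunay_def using delaunay_triangles_eq by simp
  have tr0: "\<exists>i j k. D = {i, j, k} \<and> otri w i j k" if "D \<in> snd (delaunay w)" "w \<in> configuration_space" for D and w :: "(real^3)^'n"
    using trn[OF that(2)] that(1) by blast
  \<comment> \<open>A vanishing volume would place the fourth vertex on the supporting plane of the
    triangle \<open>D\<close>.\<close>
  have nz: "vol w a b c e \<noteq> 0" if w: "w \<in> configuration_space" "\<not> is_critical w" "D \<in> snd (delaunay w)"
    "D \<subset> {a, b, c, e}" for w D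
  proof
    assume v: "vol w a b c e = 0"
    obtain i j k where ijk: "D = {i, j, k}" "otri w i j k" using tr0[OF w(3,1)] by blast
    obtain x where x: "x \<in> {a, b, c, e}" "x \<notin> {i, j, k}" using w(4) ijk by blast
    have dd: "distinct [i, j, k, x]" using ijk(2) x by (auto simp: otri_def)
    have Nw: "nrm w a b c \<noteq> 0" using dist by (intro nrm_nonzero[OF w(1)]) auto
    have eq: "nrm w a b c \<bullet> w $ s = nrm w a b c \<bullet> w $ t" if "s \<in> {a, b, c, e}" "t \<in> {a, b, c, e}" for s t
    proof -
      have "vol w a b c s = 0" "vol w a b c t = 0" using that v by auto
      then show ?thesis by (simp add: vol_def inner_diff_right)
    qed
    have sub: "{i, j, k} \<subseteq> {a, b, c, e}" using w(4) ijk by blast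
    have "vol w i j k x = 0"
      using coplanar_vol[OF w(1) dd Nw eq eq eq] sub x by blast
    then show False using w(2) ijk(2) x(2) unfolding is_critical_iff[OF w(1)] by blast
  qed
  have prp: "{a, b, c} \<subset> {a, b, c, e}" "{a, b, e} \<subset> {a, b, c, e}" using dist by auto
  have t1: "{a, b, c} \<in> snd (delaunay z1)" and t2: "{a, b, e} \<in> snd (delaunay z2)"
    using fl unfolding is_flip_def by auto
  \<comment> \<open>The flip fixes the signs: with the other sign the triangulation would use the
    diagonal \<open>be\<close> and could not contain \<open>abc\<close>.\<close>
  have s1: "vol z1 a b c e < 0"
  proof (rule ccontr)
    assume "\<not> ?thesis"
    then have p1: "vol z1 a b c e > 0" using nz[OF zc(2) nc(1) t1 prp(1)] by simp
    then have p: "vol z1 b c e a < 0" using vrot[of z1] by simp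
    obtain i j k where ijk: "{a, b, c} = {i, j, k}" "otri z1 i j k" using tr0[OF t1 zc(2)] by blast
    have "{i, j, k} \<subseteq> {b, c, e, a}" using ijk by blast
    then have "(i, j, k) \<in> {(b, c, e), (c, e, b), (e, b, c), (b, e, a), (e, a, b), (a, b, e)}"
      using ijk(2) quad_near_otri[OF y q' n5 nr(1) p, of i j k] by fast
    then have "e \<in> {i, j, k}" by auto
    then have "e \<in> {a, b, c}" using ijk(1) by blast
    then show False using dist by auto
  qed
  have s2: "vol z2 a b c e > 0"
  proof (rule ccontr)
    assume "\<not> ?thesis"
    then have p: "vol z2 a b c e < 0" using nz[OF zc(3) nc(2) t2 prp(2)] by simp
    obtain i j k where ijk: "{a, b, e} = {i, j, k}" "otri z2 i j k" using tr0[OF t2 zc(3)] by blast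
    have "{i, j, k} \<subseteq> {a, b, c, e}" using ijk by blast
    then have "(i, j, k) \<in> {(a, b, c), (b, c, a), (c, a, b), (a, c, e), (c, e, a), (e, a, c)}"
      using ijk(2) quad_near_otri[OF y q n5 nr(2) p, of i j k] by fast
    then have "c \<in> {i, j, k}" by auto
    then have "c \<in> {a, b, e}" using ijk(1) by blast
    then show False using dist by auto
  qed
  define A' where "A' = flip_labels (delaunay z1) (delaunay z2) A"
  have A': "A' = A({b, e} := max (A {a, b} + A {c, e}) (A {b, c} + A {e, a}) - A {a, c})"
    unfolding A'_def using quad_flip[OF y q n5 zc(2,3) nr(1,2) s1 s2] fl by (intro flip_labels_eq) auto
  have p2: "vol z2 b c e a < 0" using s2 vrot[of z2] by simp
  have o1: "otri z1 a b c" "otri z1 b c a" "otri z1 c e a" "otri z1 e a c" "otri z1 a c e"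
    using quad_near_otri[OF y q n5 nr(1) s1] by auto
  have oy: "otri y a b c" "otri y a c e" "otri y b c e" "otri y b e a" "sgn (nrm y a b c) = sgn (nrm y a c e)"
    "sgn (nrm y b c e) = sgn (nrm y b e a)"
    using q q' by (auto simp: quad_def)
  define u where "u = sgn (nrm z a b c)"
  have sy: "sgn (nrm y b c e) = sgn (nrm y a b c)"
    by (rule otri_of_sgn(2)[OF y oy(1) _ quad_cyclic(3)[OF y q n5]]) (rule quad_vol[OF y q n5], blast)
  have u: "sgn (nrm z a c e) = u" "sgn (nrm z b c e) = u" "sgn (nrm z b e a) = u"
    using near_sgn_nrm[OF zc(1) y nr(3)] oy sy unfolding u_def by metis+
  have rr: "A {i, j} = d (sgn (nrm z i j k)) {i, j}" if "otri z1 i j k" for i j k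
    using r that unfolding restricts_def by blast
  have ru: "A {a, b} = d u {a, b}" "A {b, c} = d u {b, c}" "A {c, e} = d u {c, e}" "A {e, a} = d u {e, a}" "A {a, c} = d u {a, c}"
    using rr[OF o1(1)] rr[OF o1(2)] rr[OF o1(3)] rr[OF o1(4)] rr[OF o1(5)] u(1)
      nrm_rot[of z b c a] nrm_rot[of z c e a] nrm_rot[of z e a c] unfolding u_def by simp_all
  have oz: "otri z a b c" "otri z a c e" using near_otri[OF nr(3)] oy by auto
  have "d u {a, c} + d u {b, e} = max (d u {a, b} + d u {c, e}) (d u {b, c} + d u {e, a})"
    using d oz u(1) unfolding ptolemy_section_def Let_def u_def by metis
  then have "A' {b, e} = d u {b, e}" unfolding A' ru by (simp add: algebra_simps)
  moreover have Ao: "A' E = A E" if "E \<noteq> {b, e}" for E using that by (simp add: A')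
  moreover have dne: "{a, b} \<noteq> {b, e}" "{b, c} \<noteq> {b, e}" "{c, e} \<noteq> {b, e}" "{e, a} \<noteq> {b, e}"
    using dist by (auto simp: doubleton_eq_iff)
  ultimately have Au: "A' {a, b} = d u {a, b}" "A' {b, c} = d u {b, c}" "A' {c, e} = d u {c, e}" "A' {e, a} = d u {e, a}"
    "A' {b, e} = d u {b, e}" using ru by auto
  have "A' {i, j} = d (sgn (nrm z i j k)) {i, j}" if o: "otri z2 i j k" for i j k
  proof (cases "(i, j, k) \<in> {(b, c, e), (c, e, b), (e, b, c), (b, e, a), (e, a, b), (a, b, e)}")
    case True
    have "sgn (nrm z c e b) = u" "sgn (nrm z e b c) = u" "sgn (nrm z e a b) = u" "sgn (nrm z a b e) = u"
      using u nrm_rot[of z c e b] nrm_rot[of z e b c] nrm_rot[of z e a b] nrm_rot[of z a b e] by simp_all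
    moreover have "{e, b} = {b, e}" by auto
    ultimately show ?thesis using True u Au by auto
  next
    case False
    then have st: "otri y i j k" "\<not> {i, j, k} \<subseteq> {b, c, e, a}"
      using o quad_near_otri[OF y q' n5 nr(2) p2, of i j k] by fast+
    moreover have "{b, c, e, a} = {a, b, c, e}" by auto
    ultimately have "otri z1 i j k" using quad_near_otri[OF y q n5 nr(1) s1, of i j k] by simp
    then have "A {i, j} = d (sgn (nrm z i j k)) {i, j}" by (rule rr)
    \<comment> \<open>The overwritten value at \<open>be\<close> is read only by the two new
      triangles, by \<open>quad_no_diagonal\<close> for the rotated quadruple.\<close>
    moreover have "{i, j} \<noteq> {b, e}"
    proof
      assume "{i, j} = {b, e}"
      then have "otri y b e k \<or> otri y e b k" "{i, j, k} = {b, e, k}" using st(1) by (auto simp: doubleton_eq_iff)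
      then have "k \<in> {b, c, e, a}" using quad_no_diagonal[OF y q' n5] by blast
      then show False using st(2) \<open>{i, j, k} = {b, e, k}\<close> by auto
    qed
    ultimately show ?thesis using Ao by simp
  qed
  then show ?thesis unfolding restricts_def A'_def by blast
qed

section \<open>Labels along generic paths\<close>

text \<open>What transport of labels requires; it covers generic braids as well as transversal
  paths, whose endpoints need not coincide.\<close>

definition generic_path :: "(real \<Rightarrow> (real^3)^'n) \<Rightarrow> bool" where
  "generic_path \<gamma> \<longleftrightarrow> path \<gamma> \<and> path_image \<gamma> \<subseteq> configuration_space \<and>
     finite (critical_times \<gamma>) \<and> critical_times \<gamma> \<subseteq> {0<..<1} \<and>
     (\<forall>t\<in>critical_times \<gamma>. \<exists>a b c e. quad (\<gamma> t) a b c e \<and>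
        (\<forall>\<^sub>F s in at_left t. \<forall>\<^sub>F s' in at_right t. is_flip a b c e (delaunay (\<gamma> s)) (delaunay (\<gamma> s'))))"

lemma critical_times_iff: "t \<in> critical_times \<gamma> \<longleftrightarrow> t \<in> {0..1} \<and> is_critical (\<gamma> t)"
  by (auto simp: critical_times_def is_critical_def)

lemma path_conf: "path_image \<gamma> \<subseteq> configuration_space \<Longrightarrow> t \<in> {0..1} \<Longrightarrow> \<gamma> t \<in> configuration_space"
  unfolding path_image_def by blast

lemma path_near:
  assumes "path \<gamma>" "t \<in> {0..1}"
  shows "\<exists>\<delta>>0. \<forall>s\<in>{0..1}. \<bar>s - t\<bar> < \<delta> \<longrightarrow> near (\<gamma> t) (\<gamma> s)"
proof -
  obtain e where e: "e > 0" "\<And>w. dist w (\<gamma> t) < e \<Longrightarrow> near (\<gamma> t) w" using near_ball by blast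
  obtain \<delta> where "\<delta> > 0" "\<forall>s\<in>{0..1}. dist s t < \<delta> \<longrightarrow> dist (\<gamma> s) (\<gamma> t) < e"
    using assms e(1) unfolding path_def continuous_on_iff by blast
  then show ?thesis using e(2) unfolding dist_real_def by blast
qed

lemma delaunay_constant:
  fixes \<gamma> :: "real \<Rightarrow> (real^3)^'n"
  assumes g: "path \<gamma>" "path_image \<gamma> \<subseteq> configuration_space" and n: "CARD('n) \<ge> 5"
    and st: "0 \<le> s" "s \<le> t" "t \<le> 1" and nc: "{s..t} \<inter> critical_times \<gamma> = {}"
  shows "otri (\<gamma> s) = otri (\<gamma> t)" "delaunay (\<gamma> s) = delaunay (\<gamma> t)"
proof -
  have n4: "CARD('n) \<ge> 4" using n by simp
  define f where "f r = (otri (\<gamma> r), delaunay (\<gamma> r))" for r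
  have "f s = f t"
  proof (rule connected_local_const)
    show "connected {s..t}" "s \<in> {s..t}" "t \<in> {s..t}" using st by auto
    show "\<forall>a\<in>{s..t}. \<forall>\<^sub>F b in at a within {s..t}. f a = f b"
    proof
      fix a assume a: "a \<in> {s..t}"
      then have a01: "a \<in> {0..1}" using st by auto
      obtain \<delta> where d: "\<delta> > 0" "\<forall>s\<in>{0..1}. \<bar>s - a\<bar> < \<delta> \<longrightarrow> near (\<gamma> a) (\<gamma> s)" using path_near[OF g(1) a01] by blast
      have nca: "\<not> is_critical (\<gamma> a)" using nc a a01 critical_times_iff by blast
      have "f a = f b" if b: "b \<in> {s..t}" "dist b a < \<delta>" for b
      proof -
        have b01: "b \<in> {0..1}" using b st by auto
        have "near (\<gamma> a) (\<gamma> b)" using d b b01 by (simp add: dist_real_def)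
        then show ?thesis unfolding f_def
          using near_noncrit_otri[OF path_conf[OF g(2) a01] nca]
            near_noncrit_delaunay[OF path_conf[OF g(2) a01] path_conf[OF g(2) b01] nca _ n4] by metis
      qed
      then show "\<forall>\<^sub>F b in at a within {s..t}. f a = f b" unfolding eventually_at using d(1) by blast
    qed
  qed
  then show "otri (\<gamma> s) = otri (\<gamma> t)" "delaunay (\<gamma> s) = delaunay (\<gamma> t)" by (auto simp: f_def)
qed

text \<open>For a noncritical \<open>t\<close> this is the index in the flip sequence of the
  triangulation at time \<open>t\<close>.\<close>

definition crit_count :: "(real \<Rightarrow> (real^3)^'n) \<Rightarrow> real \<Rightarrow> nat" where
  "crit_count \<gamma> t = card {s \<in> critical_times \<gamma>. s < t}"

definition label_at :: "(real \<Rightarrow> (real^3)^'n) \<Rightarrow> ('n set \<Rightarrow> 'x::linordered_ab_group_add) \<Rightarrow> real \<Rightarrow> 'n set \<Rightarrow> 'x" where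
  "label_at \<gamma> A t = label_sequence \<gamma> A (crit_count \<gamma> t)"

context
  fixes \<gamma> :: "real \<Rightarrow> (real^3)^'n"
  assumes g: "generic_path \<gamma>" and n5: "CARD('n) \<ge> 5"
begin

lemma generic_path_facts: "path \<gamma>" "path_image \<gamma> \<subseteq> configuration_space" "finite (critical_times \<gamma>)"
  "critical_times \<gamma> \<subseteq> {0<..<1}" "t \<in> {0..1} \<Longrightarrow> \<gamma> t \<in> configuration_space"
  using g path_conf by (auto simp: generic_path_def)

lemma same_crit_count:
  assumes "s < t" "s \<notin> critical_times \<gamma>" "t \<notin> critical_times \<gamma>" "crit_count \<gamma> s = crit_count \<gamma> t"
  shows "{s..t} \<inter> critical_times \<gamma> = {}"
proof (rule ccontr)
  assume "\<not> ?thesis"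
  then obtain k where k: "k \<in> critical_times \<gamma>" "s \<le> k" "k \<le> t" by auto
  then have k': "s < k" "k < t" using assms by (auto simp: less_le)
  have "{r \<in> critical_times \<gamma>. r < s} \<subseteq> {r \<in> critical_times \<gamma>. r < t}" using assms(1) by fastforce
  moreover have "k \<in> {r \<in> critical_times \<gamma>. r < t}" "k \<notin> {r \<in> critical_times \<gamma>. r < s}" using k(1) k' by auto
  ultimately have "{r \<in> critical_times \<gamma>. r < s} \<subset> {r \<in> critical_times \<gamma>. r < t}" by blast
  then have "crit_count \<gamma> s < crit_count \<gamma> t"
    unfolding crit_count_def using generic_path_facts(3) by (intro psubset_card_mono) auto
  then show False using assms by simp
qed

lemma flip_sequence_eq:
  assumes t: "t \<in> {0..1}" "t \<notin> critical_times \<gamma>"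
  shows "flip_sequence \<gamma> (crit_count \<gamma> t) = delaunay (\<gamma> t)"
proof -
  define K where "K = critical_times \<gamma>"
  have K: "finite K" "K \<subseteq> {0<..<1}" using generic_path_facts by (auto simp: K_def)
  define xs where "xs = sorted_list_of_set K"
  have xs: "set xs = K" "sorted_wrt (<) xs" using K by (auto simp: xs_def)
  define ys where "ys = [0] @ xs @ [1 :: real]"
  have mark: "time_mark \<gamma> j = ys ! j" for j by (simp add: time_mark_def ys_def xs_def K_def)
  have ys: "sorted_wrt (<) ys" using xs K by (auto simp: ys_def sorted_wrt_append)
  have len: "length ys = length xs + 2" by (simp add: ys_def)
  have ym: "ys ! j < ys ! k" if "j < k" "k < length ys" for j k
    using sorted_wrt_nth_less[OF ys that] .
  have ym': "ys ! j \<le> ys ! k" if "j \<le> k" "k < length ys" for j k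
    using ym[of j k] that by (cases "j = k") auto
  have y0: "ys ! 0 = 0" by (simp add: ys_def)
  have y1: "ys ! (Suc (length xs)) = 1" by (simp add: ys_def nth_append)
  \<comment> \<open>The initial mark 0 shifts the indices by one.\<close>
  have yx: "ys ! Suc j = xs ! j" if "j < length xs" for j using that by (simp add: ys_def nth_append)
  define i where "i = crit_count \<gamma> t"
  have dxs: "distinct xs" by (simp add: xs_def)
  have il: "i \<le> length xs"
    unfolding i_def crit_count_def K_def[symmetric] using K xs dxs
    by (metis (no_types, lifting) card_mono distinct_card mem_Collect_eq subsetI)
  \<comment> \<open>Times strictly between consecutive marks are noncritical and have the same count
    as \<open>t\<close>, so \<open>delaunay_constant\<close> compares them with
    \<open>t\<close>.\<close>
  have inJ: "s \<in> {0..1}" "s \<notin> K" "crit_count \<gamma> s = i" if s: "s \<in> {ys ! i <..< ys ! Suc i}" for s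
  proof -
    have s': "ys ! i < s" "s < ys ! Suc i" using s by auto
    show "s \<in> {0..1}" using s' ym'[of 0 i] ym'[of "Suc i" "Suc (length xs)"] il y0 y1 len by auto
    have lt: "xs ! j < s \<longleftrightarrow> j < i" if "j < length xs" for j
    proof
      assume "j < i"
      then have "ys ! Suc j \<le> ys ! i" using il len by (intro ym') auto
      then show "xs ! j < s" using s' yx[OF that] by simp
    next
      assume h: "xs ! j < s"
      show "j < i"
      proof (rule ccontr)
        assume "\<not> j < i"
        then have "ys ! Suc i \<le> ys ! Suc j" using that len by (intro ym') auto
        then show False using h s' yx[OF that] by simp
      qed
    qed
    have ne: "xs ! j \<noteq> s" if "j < length xs" for j
    proof
      assume h: "xs ! j = s"
      show False
      proof (cases "j < i")
        case True then show ?thesis using lt[OF that] h by simp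
      next
        case False
        then have "ys ! Suc i \<le> ys ! Suc j" using that len by (intro ym') auto
        then show False using h s' yx[OF that] by simp
      qed
    qed
    show "s \<notin> K" using ne xs(1) by (metis in_set_conv_nth)
    have "{r \<in> K. r < s} = (\<lambda>j. xs ! j) ` {..<i}"
    proof (intro equalityI subsetI)
      fix r assume "r \<in> {r \<in> K. r < s}"
      then obtain j where "j < length xs" "r = xs ! j" "r < s" using xs(1) by (auto simp: in_set_conv_nth)
      then show "r \<in> (\<lambda>j. xs ! j) ` {..<i}" using lt by auto
    next
      fix r assume "r \<in> (\<lambda>j. xs ! j) ` {..<i}"
      then obtain j where "j < i" "r = xs ! j" by auto
      then show "r \<in> {r \<in> K. r < s}" using lt[of j] il xs(1) nth_mem[of j xs] by auto
    qed
    moreover have "inj_on (\<lambda>j. xs ! j) {..<i}" using dxs il by (auto simp: inj_on_def nth_eq_iff_index_eq)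
    ultimately show "crit_count \<gamma> s = i" unfolding crit_count_def K_def[symmetric] by (simp add: card_image)
  qed
  have eq: "delaunay (\<gamma> s) = delaunay (\<gamma> t)" if s: "s \<in> {ys ! i <..< ys ! Suc i}" for s
  proof -
    note J = inJ[OF s]
    consider "s = t" | "s < t" | "t < s" by linarith
    then show ?thesis
    proof cases
      case 2
      have "{s..t} \<inter> critical_times \<gamma> = {}" using J t 2 by (intro same_crit_count) (auto simp: K_def i_def)
      then show ?thesis using delaunay_constant(2)[OF generic_path_facts(1,2) n5, of s t] J t 2 by simp
    next
      case 3
      have "{t..s} \<inter> critical_times \<gamma> = {}" using J t 3 by (intro same_crit_count) (auto simp: K_def i_def)
      then show ?thesis using delaunay_constant(2)[OF generic_path_facts(1,2) n5, of t s] J t 3 by simp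
    qed simp
  qed
  have "ys ! i < ys ! Suc i" using il len by (intro ym) auto
  then obtain s where s: "s \<in> {ys ! i <..< ys ! Suc i}" using dense by auto
  show ?thesis unfolding flip_sequence_def mark i_def[symmetric]
    using eq s by (intro the_equality) metis+
qed

lemma label_at_constant:
  assumes "s \<le> t" "{s..t} \<inter> critical_times \<gamma> = {}"
  shows "label_at \<gamma> A s = label_at \<gamma> A t"
proof -
  have "{r \<in> critical_times \<gamma>. r < s} = {r \<in> critical_times \<gamma>. r < t}"
  proof (intro Collect_cong conj_cong refl iffI)
    fix r assume r: "r \<in> critical_times \<gamma>" "r < t"
    then have "r \<notin> {s..t}" using assms by blast
    then show "r < s" using r by auto
  qed (use assms in auto)
  then show ?thesis by (simp add: label_at_def crit_count_def)
qed

lemma label_at_flip: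
  assumes rr: "r \<in> {0..1}" "r' \<in> {0..1}" and k: "r < k" "k < r'" and K: "{r..r'} \<inter> critical_times \<gamma> = {k}"
  shows "label_at \<gamma> A r' = flip_labels (delaunay (\<gamma> r)) (delaunay (\<gamma> r')) (label_at \<gamma> A r)"
proof -
  have kK: "k \<in> critical_times \<gamma>" "r \<notin> critical_times \<gamma>" "r' \<notin> critical_times \<gamma>" using K k by auto
  have "{s \<in> critical_times \<gamma>. s < r'} = insert k {s \<in> critical_times \<gamma>. s < r}"
  proof (intro equalityI subsetI)
    fix x assume x: "x \<in> {s \<in> critical_times \<gamma>. s < r'}"
    show "x \<in> insert k {s \<in> critical_times \<gamma>. s < r}"
    proof (cases "x < r")
      case False
      then have "x \<in> {r..r'} \<inter> critical_times \<gamma>" using x by auto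
      then show ?thesis using K by auto
    qed (use x in auto)
  qed (use kK k in auto)
  then have c: "crit_count \<gamma> r' = Suc (crit_count \<gamma> r)"
    unfolding crit_count_def using generic_path_facts(3) k by simp
  show ?thesis unfolding label_at_def c label_sequence.simps
    using flip_sequence_eq[OF rr(1) kK(2)] flip_sequence_eq[OF rr(2) kK(3)] by (simp add: c)
qed

lemma label_at_0: "label_at \<gamma> A 0 = A"
proof -
  have "{s \<in> critical_times \<gamma>. s < 0} = {}" using generic_path_facts(4) by auto
  then show ?thesis by (simp only: label_at_def crit_count_def card.empty label_sequence.simps)
qed

lemma label_at_1: "label_at \<gamma> A 1 = label_sequence \<gamma> A (card (critical_times \<gamma>))"
proof -
  have "{s \<in> critical_times \<gamma>. s < 1} = critical_times \<gamma>" using generic_path_facts(4) by auto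
  then show ?thesis by (simp only: label_at_def crit_count_def)
qed

text \<open>Induction on the number of critical times in between. The first one, \<open>k\<close>,
  is crossed between two sample times \<open>r < k < r'\<close> at which the flip condition holds
  and the configurations are near that at \<open>k\<close>; \<open>restricts_flip\<close> performs
  the crossing.\<close>

lemma restricts_flat:
  fixes A :: "'n set \<Rightarrow> 'x::linordered_ab_group_add"
  assumes z: "z \<in> configuration_space" and d: "ptolemy_section z d"
    and st: "0 \<le> s" "s \<le> t" "t \<le> 1" "s \<notin> critical_times \<gamma>" "t \<notin> critical_times \<gamma>"
    and nr: "\<And>r. r \<in> {s..t} \<Longrightarrow> near z (\<gamma> r)"
    and r: "restricts z d (\<gamma> s) (label_at \<gamma> A s)"
  shows "restricts z d (\<gamma> t) (label_at \<gamma> A t)"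
  using st nr r
proof (induction "card ({s..t} \<inter> critical_times \<gamma>)" arbitrary: s rule: less_induct)
  case less
  note fin = generic_path_facts(3)
  have step: "restricts z d (\<gamma> r) (label_at \<gamma> A r)"
    if "s \<le> r" "r \<le> t" "{s..r} \<inter> critical_times \<gamma> = {}" for r
  proof -
    have "otri (\<gamma> s) = otri (\<gamma> r)" using delaunay_constant(1)[OF generic_path_facts(1,2) n5] that less by simp
    moreover have "label_at \<gamma> A s = label_at \<gamma> A r" using label_at_constant that by blast
    ultimately show ?thesis using less(8) unfolding restricts_def by simp
  qed
  show ?case
  proof (cases "{s..t} \<inter> critical_times \<gamma> = {}")
    case True then show ?thesis using step less by blast
  next
    case False
    define k where "k = Min ({s..t} \<inter> critical_times \<gamma>)"
    have "k \<in> {s..t} \<inter> critical_times \<gamma>" unfolding k_def using fin False by (intro Min_in) auto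
    then have k: "k \<in> critical_times \<gamma>" "s < k" "k < t" using less by (auto simp: less_le)
    have kmin: "k \<le> x" if "x \<in> critical_times \<gamma>" "s \<le> x" "x \<le> t" for x
      unfolding k_def using fin that by (intro Min_le) auto
    have k01: "k \<in> {0..1}" using k less by auto
    obtain a b c e where q: "quad (\<gamma> k) a b c e" and
      fl: "\<forall>\<^sub>F s in at_left k. \<forall>\<^sub>F s' in at_right k. is_flip a b c e (delaunay (\<gamma> s)) (delaunay (\<gamma> s'))"
      using g k unfolding generic_path_def by blast
    obtain \<delta> where \<delta>: "\<delta> > 0" "\<forall>s\<in>{0..1}. \<bar>s - k\<bar> < \<delta> \<longrightarrow> near (\<gamma> k) (\<gamma> s)"
      using path_near[OF generic_path_facts(1) k01] by blast
    \<comment> \<open>The next critical time after \<open>k\<close>, or \<open>t\<close>, so that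
      \<open>k\<close> is the only critical time between \<open>r\<close> and
      \<open>r'\<close>.\<close>
    define m where "m = Min (insert t {x \<in> critical_times \<gamma>. k < x})"
    have mk: "k < m" unfolding m_def using fin k by auto
    have mle: "m \<le> t" "\<And>x. x \<in> critical_times \<gamma> \<Longrightarrow> k < x \<Longrightarrow> m \<le> x" unfolding m_def using fin by auto
    have "\<forall>\<^sub>F r in at_left k. r \<in> {max s (k - \<delta>)<..<k}"
      using k \<delta> by (intro eventually_at_left_real) auto
    with fl have "\<forall>\<^sub>F r in at_left k. r \<in> {max s (k - \<delta>)<..<k} \<and>
       (\<forall>\<^sub>F s' in at_right k. is_flip a b c e (delaunay (\<gamma> r)) (delaunay (\<gamma> s')))"
      by (intro eventually_conj)
    then obtain r where r: "r \<in> {max s (k - \<delta>)<..<k}"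
       "\<forall>\<^sub>F s' in at_right k. is_flip a b c e (delaunay (\<gamma> r)) (delaunay (\<gamma> s'))"
      using eventually_happens'[OF trivial_limit_at_left_real] by blast
    have "\<forall>\<^sub>F s' in at_right k. s' \<in> {k<..<min m (k + \<delta>)}"
      using mk \<delta> by (intro eventually_at_right_real) auto
    with r(2) have "\<forall>\<^sub>F s' in at_right k. s' \<in> {k<..<min m (k + \<delta>)} \<and> is_flip a b c e (delaunay (\<gamma> r)) (delaunay (\<gamma> s'))"
      by (intro eventually_conj)
    then obtain r' where r': "r' \<in> {k<..<min m (k + \<delta>)}" "is_flip a b c e (delaunay (\<gamma> r)) (delaunay (\<gamma> r'))"
      using eventually_happens'[OF trivial_limit_at_right_real] by blast
    have r01: "r \<in> {0..1}" "r' \<in> {0..1}" "s < r" "r < k" "k < r'" "r' < t" using r(1) r'(1) less k mle by auto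
    have K1: "{s..r} \<inter> critical_times \<gamma> = {}"
    proof (rule ccontr)
      assume "\<not> ?thesis"
      then obtain x where "x \<in> critical_times \<gamma>" "s \<le> x" "x \<le> r" by auto
      then show False using kmin[of x] r01 by auto
    qed
    have K2: "{r..r'} \<inter> critical_times \<gamma> = {k}"
    proof -
      have "x = k" if "x \<in> critical_times \<gamma>" "r \<le> x" "x \<le> r'" for x
      proof (rule ccontr)
        assume "x \<noteq> k"
        then have "k < x" using kmin[of x] that r01 by auto
        then show False using mle(2)[of x] that r'(1) by auto
      qed
      then have "x \<in> {k}" if "x \<in> {r..r'} \<inter> critical_times \<gamma>" for x using that by simp
      moreover have "k \<in> {r..r'} \<inter> critical_times \<gamma>" using k(1) r01(4,5) by simp
      ultimately show ?thesis by blast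
    qed
    have nK: "r \<notin> critical_times \<gamma>" "r' \<notin> critical_times \<gamma>" using K2 r01 by auto
    have 1: "restricts z d (\<gamma> r) (label_at \<gamma> A r)" using step[of r] K1 r01 by auto
    have "restricts z d (\<gamma> r') (flip_labels (delaunay (\<gamma> r)) (delaunay (\<gamma> r')) (label_at \<gamma> A r))"
    proof (rule restricts_flip[OF _ q n5 z _ _ _ _ _ _ _ r'(2) d 1])
      show "\<gamma> k \<in> configuration_space" "\<gamma> r \<in> configuration_space" "\<gamma> r' \<in> configuration_space"
        using generic_path_facts(5) k01 r01 by auto
      show "near (\<gamma> k) (\<gamma> r)" using \<delta>(2) r(1) r01(1) by auto
      show "near (\<gamma> k) (\<gamma> r')" using \<delta>(2) r'(1) r01(2) by auto
      show "near z (\<gamma> k)" using less(7) k by auto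
      show "\<not> is_critical (\<gamma> r)" "\<not> is_critical (\<gamma> r')" using nK r01 critical_times_iff by blast+
    qed
    then have 2: "restricts z d (\<gamma> r') (label_at \<gamma> A r')" unfolding label_at_flip[OF r01(1,2,4,5) K2] .
    have "{r'..t} \<inter> critical_times \<gamma> \<subseteq> {s..t} \<inter> critical_times \<gamma>" using r01(3-5) by auto
    moreover have "k \<in> {s..t} \<inter> critical_times \<gamma>" "k \<notin> {r'..t} \<inter> critical_times \<gamma>" using k r01(5) by auto
    ultimately have "{r'..t} \<inter> critical_times \<gamma> \<subset> {s..t} \<inter> critical_times \<gamma>" by blast
    then have "card ({r'..t} \<inter> critical_times \<gamma>) < card ({s..t} \<inter> critical_times \<gamma>)"
      using fin by (intro psubset_card_mono) auto
    then show ?thesis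
      by (rule less(1)) (use r01 nK less 2 in auto)
  qed
qed

end

section \<open>Generic braids\<close>

lemma tri_orient:
  assumes z: "z \<in> configuration_space" and t: "{a, b, c} \<in> snd (delaunay z)"
  shows "otri z a b c \<or> otri z a c b"
proof -
  obtain i j k where ijk: "{a, b, c} = {i, j, k}" "otri z i j k"
    using t delaunay_triangles_eq[OF z] unfolding delaunay_def by auto
  have d: "i \<noteq> j" "j \<noteq> k" "i \<noteq> k" using ijk by (auto simp: otri_def)
  have r: "otri z j k i" "otri z k i j" using ijk otri_rot by blast+
  have m: "i \<in> {a, b, c}" "j \<in> {a, b, c}" "k \<in> {a, b, c}" using ijk by auto
  have "otri z a b c \<or> otri z a c b" if "otri z i j k" "otri z j k i" "otri z k i j"
    using m d that by (elim insertE emptyE) simp_all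
  then show ?thesis using ijk r by blast
qed

lemma crit_circle:
  assumes z: "z \<in> configuration_space" and o: "otri z i j k" and x: "x \<notin> {i, j, k}" "vol z i j k x = 0"
  shows "\<exists>C. critical_circle z C \<and> {i, j, k, x} \<subseteq> {i. z $ i \<in> C}"
proof -
  define u where "u = sgn (nrm z i j k)"
  note oc = otri_circle[OF z o, folded u_def]
  define C where "C = circle u (u \<bullet> z $ i)"
  have sub: "{i, j, k, x} \<subseteq> {i. z $ i \<in> C}"
    using oc(4) x conf_norm'[OF z] by (auto simp: C_def circle_def)
  moreover have "card {i, j, k, x} = 4" using o x by (auto simp: otri_def)
  ultimately have "card {i. z $ i \<in> C} \<ge> 4" by (metis card_mono finite)
  moreover have "\<forall>i'. z $ i' \<notin> disc u (u \<bullet> z $ i)"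
    using oc(3) by (auto simp: disc_def not_less)
  ultimately show ?thesis unfolding critical_circle_def using oc(1,2) C_def sub by blast
qed

text \<open>\<open>generic_braid\<close> records a flip through unordered vertex sets, which leaves
  the orientation of \<open>a, b, c, e\<close> open; hence the two alternatives. The oriented
  triangles at the nearby noncritical configuration \<open>z\<close> remain supporting at
  \<open>y\<close>.\<close>

lemma quad_of_flip:
  fixes y z :: "(real^3)^'n"
  assumes y: "y \<in> configuration_space" and z: "z \<in> configuration_space" and n5: "CARD('n) \<ge> 5"
    and nr: "near y z" and nc: "\<not> is_critical z" and d: "distinct [a, b, c, e]"
    and t: "{a, b, c} \<in> snd (delaunay z)" "{a, c, e} \<in> snd (delaunay z)"
    and cc: "critical_circle y C" "\<And>C'. critical_circle y C' \<Longrightarrow> {i. y $ i \<in> C'} = {a, b, c, e}"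
  shows "quad y a b c e \<or> quad y a e c b"
proof -
  have unq: "{i, j, k, x} = {a, b, c, e}" if ijk: "otri y i j k" "x \<notin> {i, j, k}" "vol y i j k x = 0" for i j k x
  proof -
    obtain C' where "critical_circle y C'" "{i, j, k, x} \<subseteq> {i. y $ i \<in> C'}" using crit_circle[OF y ijk] by blast
    then have "{i, j, k, x} \<subseteq> {a, b, c, e}" using cc(2) by blast
    moreover have "card {i, j, k, x} = 4" "card {a, b, c, e} = 4" using ijk d by (auto simp: otri_def)
    ultimately show ?thesis by (intro card_subset_eq) auto
  qed
  obtain u0 h where C: "norm u0 = 1" "C = circle u0 h" using cc(1) unfolding critical_circle_def by blast
  have Q: "{i. y $ i \<in> C} = {a, b, c, e}" using cc by blast
  have on: "u0 \<bullet> y $ i = h" if "i \<in> {a, b, c, e}" for i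
    using that unfolding Q[symmetric] C(2) circle_def by simp
  have u0: "u0 \<noteq> 0" using C by auto
  have main: "quad y a b c e" if d: "distinct [a, b, c, e]" and o: "otri y a b c" "otri y a c e"
     and on: "\<And>i. i \<in> {a, b, c, e} \<Longrightarrow> u0 \<bullet> y $ i = h"
     and unq: "\<And>i j k x. otri y i j k \<Longrightarrow> x \<notin> {i, j, k} \<Longrightarrow> vol y i j k x = 0 \<Longrightarrow> {i, j, k, x} = {a, b, c, e}" for a b c e
  proof -
    have v: "vol y a b c e = 0" using on by (intro coplanar_vol[OF y d u0]) simp_all
    define u where "u = sgn (nrm y a b c)"
    have u1: "norm u = 1" using otri_nrm[OF y o(1)] by (simp add: u_def norm_sgn)
    have vx: "vol y a b c x = 0" if "x \<in> {a, b, c, e}" for x using that v by auto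
    interpret F: cyclic_order "face y u" "\<lambda>i j k. u \<bullet> nrm y i j k > 0" using face_cyclic_order[OF y u1] .
    have f: "x \<in> face y u" if "x \<in> {a, b, c, e}" for x
      using otri_face[OF y o(1), of x] vx[OF that] unfolding u_def by simp
    have dd: "distinct [a, c, e]" using d by auto
    have "u \<bullet> nrm y a c e > 0 \<or> u \<bullet> nrm y a e c > 0"
      using F.tot[OF f f f dd] by simp
    moreover have False if "u \<bullet> nrm y a e c > 0"
    proof -
      have oo: "otri y a e c" using otri_of_sgn(1)[OF y o(1) _ that[unfolded u_def]] vx by blast
      have "vol y a c e x = 0" for x
      proof -
        have "vol y a c e x \<le> 0" "vol y a e c x \<le> 0" using oo o(2) by (simp_all add: otri_def)
        then show ?thesis using vol_swap_mid[of y a e c x] by linarith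
      qed
      moreover have "\<exists>x. x \<notin> {a, b, c, e}"
      proof (rule ccontr)
        assume "\<not> ?thesis"
        then have "UNIV = {a, b, c, e}" by blast
        moreover have "card {a, b, c, e} \<le> 4" by (auto simp: card_insert_if)
        ultimately show False using n5 by simp
      qed
      then obtain x where x: "x \<notin> {a, b, c, e}" by blast
      ultimately have "{a, c, e, x} = {a, b, c, e}" using unq[OF o(2), of x] by blast
      then show False using x by blast
    qed
    ultimately have "u \<bullet> nrm y a c e > 0" by blast
    then have "sgn (nrm y a c e) = sgn (nrm y a b c)"
      using otri_of_sgn(2)[OF y o(1), of a c e] vx unfolding u_def by blast
    then show ?thesis unfolding quad_def by (intro conjI allI impI o unq) simp_all
  qed
  \<comment> \<open>Two triangles do not lie on the same side of a common edge: each apex would be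
    weakly below the plane of the other triangle, hence on it.\<close>
  have ne: False if "otri z p r q" "otri z p r s" "distinct [p, q, r, s]" for p q r s
  proof -
    have "vol z p r q s \<le> 0" "vol z p r s q \<le> 0" using that by (simp_all add: otri_def)
    then have "vol z p r q s = 0" using vol_swap_last[of z p r s q] by linarith
    moreover have "s \<notin> {p, r, q}" using that by auto
    ultimately show False using nc that(1) unfolding is_critical_iff[OF z] by blast
  qed
  have "otri z a b c \<and> otri z a c e \<or> otri z a e c \<and> otri z a c b"
  proof -
    have 1: "otri z a b c \<or> otri z a c b" "otri z a c e \<or> otri z a e c" using tri_orient[OF z] t by blast+
    have False if "otri z a b c" "otri z a e c"
    proof (rule ne[of c a b e])
      show "otri z c a b" "otri z c a e" using that otri_rot by blast+
    qed (use d in auto)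
    moreover have False if "otri z a c b" "otri z a c e" using ne[of a c b e] that d by auto
    ultimately show ?thesis using 1 by blast
  qed
  then show ?thesis
  proof
    assume "otri z a b c \<and> otri z a c e"
    then have "quad y a b c e" using near_otri[OF nr] d on unq by (intro main) auto
    then show ?thesis ..
  next
    assume h: "otri z a e c \<and> otri z a c b"
    have s: "{a, e, c, b} = {a, b, c, e}" by auto
    have "quad y a e c b"
    proof (rule main)
      show "otri y a e c" "otri y a c b" using h near_otri[OF nr] by auto
    qed (use d on unq s in auto)
    then show ?thesis ..
  qed
qed

lemma is_flip_sym: "is_flip a b c e T T' \<Longrightarrow> is_flip a e c b T T'"
proof -
  assume f: "is_flip a b c e T T'"
  have s: "{a, e, c} = {a, c, e}" "{a, c, b} = {a, b, c}" "{e, b} = {b, e}" "{a, e, b} = {a, b, e}" "{e, c, b} = {b, c, e}"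
    by auto
  have s': "{{a, c, e}, {a, b, c}} = {{a, b, c}, {a, c, e}}" by auto
  show ?thesis using f unfolding is_flip_def s s' by auto
qed

lemma generic_braid_path:
  fixes \<beta> :: "real \<Rightarrow> (real^3)^'n"
  assumes g: "generic_braid p \<beta>" and n5: "CARD('n) \<ge> 5"
  shows "generic_path \<beta>"
proof -
  have p: "path \<beta>" "path_image \<beta> \<subseteq> configuration_space" and K: "finite (critical_times \<beta>)" "critical_times \<beta> \<subseteq> {0<..<1}"
    using g by (auto simp: generic_braid_def pure_braid_def)
  have "\<exists>a b c e. quad (\<beta> t) a b c e \<and>
        (\<forall>\<^sub>F s in at_left t. \<forall>\<^sub>F s' in at_right t. is_flip a b c e (delaunay (\<beta> s)) (delaunay (\<beta> s')))"
    if t: "t \<in> critical_times \<beta>" for t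
  proof -
    have t01: "t \<in> {0..1}" "0 < t" using t K by auto
    have uq: "\<exists>!C. critical_circle (\<beta> t) C"
      using g t unfolding generic_braid_def by blast
    obtain C a b c e where C: "critical_circle (\<beta> t) C" "card {i. \<beta> t $ i \<in> C} = 4"
           "{i. \<beta> t $ i \<in> C} = {a, b, c, e}" and
      fl: "\<forall>\<^sub>F s in at_left t. \<forall>\<^sub>F s' in at_right t. is_flip a b c e (delaunay (\<beta> s)) (delaunay (\<beta> s'))"
      using g t unfolding generic_braid_def by blast
    have cc: "{i. \<beta> t $ i \<in> C'} = {a, b, c, e}" if "critical_circle (\<beta> t) C'" for C'
      using uq C that by blast
    obtain \<delta> where \<delta>: "\<delta> > 0" "\<forall>s\<in>{0..1}. \<bar>s - t\<bar> < \<delta> \<longrightarrow> near (\<beta> t) (\<beta> s)"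
      using path_near[OF p(1) t01(1)] by blast
    define m where "m = Max (insert 0 {x \<in> critical_times \<beta>. x < t})"
    have m: "m < t" "0 \<le> m" "\<And>x. x \<in> critical_times \<beta> \<Longrightarrow> x < t \<Longrightarrow> x \<le> m"
      unfolding m_def using K t01 by auto
    have "\<forall>\<^sub>F r in at_left t. r \<in> {max m (t - \<delta>)<..<t}"
      using m \<delta> by (intro eventually_at_left_real) auto
    with fl have "\<forall>\<^sub>F r in at_left t. r \<in> {max m (t - \<delta>)<..<t} \<and>
       (\<forall>\<^sub>F s' in at_right t. is_flip a b c e (delaunay (\<beta> r)) (delaunay (\<beta> s')))"
      by (intro eventually_conj)
    then obtain r where r: "r \<in> {max m (t - \<delta>)<..<t}"
       "\<forall>\<^sub>F s' in at_right t. is_flip a b c e (delaunay (\<beta> r)) (delaunay (\<beta> s'))"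
      using eventually_happens'[OF trivial_limit_at_left_real] by blast
    obtain s' where s': "is_flip a b c e (delaunay (\<beta> r)) (delaunay (\<beta> s'))"
      using r(2) eventually_happens'[OF trivial_limit_at_right_real] by blast
    have r01: "r \<in> {0..1}" using r(1) m t01 by auto
    have "r \<notin> critical_times \<beta>" using r(1) m(3)[of r] by auto
    then have nc: "\<not> is_critical (\<beta> r)" using r01 critical_times_iff by blast
    have nr: "near (\<beta> t) (\<beta> r)" using \<delta>(2) r01 r(1) by auto
    have "quad (\<beta> t) a b c e \<or> quad (\<beta> t) a e c b"
      using s' unfolding is_flip_def
      by (intro quad_of_flip[OF path_conf[OF p(2) t01(1)] path_conf[OF p(2) r01] n5 nr nc _ _ _ C(1) cc]) auto
    moreover have "\<forall>\<^sub>F s in at_left t. \<forall>\<^sub>F s' in at_right t. is_flip a e c b (delaunay (\<beta> s)) (delaunay (\<beta> s'))"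
      by (rule eventually_mono[OF fl]) (erule eventually_mono, erule is_flip_sym)
    ultimately show ?thesis using fl by blast
  qed
  then show ?thesis unfolding generic_path_def using p K by blast
qed

section \<open>Paths crossing one cocircular quadruple at a time\<close>

text \<open>Topological transversality: a sign change in place of a nonzero derivative, which
  survives reparametrization. All coplanar quadruples are controlled, whether or not their plane
  supports the hull.\<close>

definition cross :: "(real \<Rightarrow> (real^3)^'n) \<Rightarrow> real \<Rightarrow> bool" where
  "cross \<gamma> t \<longleftrightarrow> (\<exists>a b c e. distinct [a, b, c, e] \<and>
     (\<forall>i j k x. distinct [i, j, k, x] \<longrightarrow> vol (\<gamma> t) i j k x = 0 \<longrightarrow> {i, j, k, x} = {a, b, c, e}) \<and>
     (\<exists>\<epsilon>>0. \<forall>s s'. t - \<epsilon> < s \<longrightarrow> s < t \<longrightarrow> t < s' \<longrightarrow> s' < t + \<epsilon> \<longrightarrow>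
        vol (\<gamma> s) a b c e * vol (\<gamma> s') a b c e < 0))"

definition transversal :: "(real \<Rightarrow> (real^3)^'n) \<Rightarrow> real \<Rightarrow> real \<Rightarrow> bool" where
  "transversal \<gamma> u v \<longleftrightarrow> continuous_on {u..v} \<gamma> \<and> \<gamma> ` {u..v} \<subseteq> configuration_space \<and>
     general_position (\<gamma> u) \<and> general_position (\<gamma> v) \<and>
     finite {t \<in> {u..v}. \<not> general_position (\<gamma> t)} \<and>
     (\<forall>t\<in>{u..v}. \<not> general_position (\<gamma> t) \<longrightarrow> cross \<gamma> t)"

text \<open>\<open>vol\<close> is alternating in its four indices, so a product of two of its values
  is symmetric; a sign change does not depend on the order of the quadruple.\<close>

lemma vol_product_perm:
  assumes "{p, q, r, s} = {a, b, c, e}" "distinct [p, q, r, s]"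
  shows "vol z p q r s * vol z' p q r s = vol z a b c e * vol z' a b c e"
proof -
  define g where "g a b c e = vol z a b c e * vol z' a b c e" for a b c e
  have g: "g q p r s = g p q r s" "g p r q s = g p q r s" "g p q s r = g p q r s" for p q r s
    unfolding g_def using vol_swap[of z q p r s] vol_swap[of z' q p r s] vol_swap_mid[of z p r q s] vol_swap_mid[of z' p r q s]
      vol_swap_last[of z p q s r] vol_swap_last[of z' p q s r] by simp_all
  have m: "p \<in> {a, b, c, e}" "q \<in> {a, b, c, e}" "r \<in> {a, b, c, e}" "s \<in> {a, b, c, e}" using assms by auto
  have d: "p \<noteq> q" "p \<noteq> r" "p \<noteq> s" "q \<noteq> r" "q \<noteq> s" "r \<noteq> s" using assms by auto
  have "g p q r s = g a b c e" using m d by (elim insertE emptyE) (simp_all add: g)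
  then show ?thesis by (simp add: g_def)
qed

text \<open>The triple \<open>i, j, k\<close> is already cyclically ordered on its face; the fourth
  point \<open>x\<close> is inserted into one of the three gaps.\<close>

lemma quad_of_crit:
  fixes y :: "(real^3)^'n"
  assumes y: "y \<in> configuration_space" and c: "is_critical y" and n5: "CARD('n) \<ge> 5"
    and unq: "\<And>i j k x. distinct [i, j, k, x] \<Longrightarrow> vol y i j k x = 0 \<Longrightarrow> {i, j, k, x} = Q"
  obtains p q r s where "quad y p q r s" "{p, q, r, s} = Q" "distinct [p, q, r, s]"
proof -
  note finish = that
  obtain i j k x where o: "otri y i j k" and x: "x \<notin> {i, j, k}" and v: "vol y i j k x = 0"
    using c unfolding is_critical_iff[OF y] by blast
  have ijk: "i \<noteq> j" "j \<noteq> k" "i \<noteq> k" using o by (auto simp: otri_def)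
  have unq': "{i', j', k', x'} = Q" if "otri y i' j' k'" "x' \<notin> {i', j', k'}" "vol y i' j' k' x' = 0" for i' j' k' x'
    using that by (intro unq) (auto simp: otri_def)
  have Q: "{i, j, k, x} = Q" using unq' o x v by blast
  define u where "u = sgn (nrm y i j k)"
  have u1: "norm u = 1" using otri_nrm[OF y o] by (simp add: u_def norm_sgn)
  have vx: "vol y i j k w = 0" if "w \<in> {i, j, k, x}" for w using that v by auto
  interpret F: cyclic_order "face y u" "\<lambda>i j k. u \<bullet> nrm y i j k > 0" using face_cyclic_order[OF y u1] .
  have f: "w \<in> face y u" if "w \<in> {i, j, k, x}" for w
    using otri_face[OF y o, of w] vx[OF that] unfolding u_def by simp
  have f4: "i \<in> face y u" "j \<in> face y u" "k \<in> face y u" "x \<in> face y u" using f by auto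
  have ot: "otri y l m q" "sgn (nrm y l m q) = u" if "u \<bullet> nrm y l m q > 0" "{l, m, q} \<subseteq> {i, j, k, x}" for l m q
    using otri_of_sgn[OF y o, of l m q] vx that unfolding u_def by blast+
  have res: ?thesis if "u \<bullet> nrm y p q r > 0" "u \<bullet> nrm y p r s > 0" "{p, q, r, s} = {i, j, k, x}" for p q r s
  proof (rule finish)
    have "{p, q, r} \<subseteq> {i, j, k, x}" "{p, r, s} \<subseteq> {i, j, k, x}" using that(3) by blast+
    then show qd: "quad y p q r s" unfolding quad_def using ot that Q unq' by metis
    show "{p, q, r, s} = Q" using that Q by simp
    show "distinct [p, q, r, s]" using quad_distinct[OF y qd n5] .
  qed
  have N: "nrm y i j k \<noteq> 0" using otri_nrm[OF y o] .
  have c0: "u \<bullet> nrm y i j k > 0" using sgn_dot_pos_iff[OF N, of "nrm y i j k"] N by (simp add: u_def)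
  have "u \<bullet> nrm y i k x > 0 \<or> u \<bullet> nrm y i x k > 0" using F.tot[of i k x] f4 ijk x by auto
  then show ?thesis
  proof
    assume "u \<bullet> nrm y i k x > 0" then show ?thesis using c0 by (intro res) auto
  next
    assume 1: "u \<bullet> nrm y i x k > 0"
    have "u \<bullet> nrm y i j x > 0 \<or> u \<bullet> nrm y i x j > 0" using F.tot[of i j x] f4 ijk x by auto
    then show ?thesis
    proof
      assume "u \<bullet> nrm y i j x > 0" then show ?thesis using 1 by (intro res[of i j x k]) auto
    next
      assume "u \<bullet> nrm y i x j > 0" then show ?thesis using c0 by (intro res[of i x j k]) auto
    qed
  qed
qed

text \<open>Four points on a critical circle span a supporting plane, which \<open>quad\<close>
  identifies; the reversed normal is impossible by \<open>quad_no_both\<close>. Uniqueness of the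
  critical circle follows.\<close>

lemma quad_critical_circle:
  fixes y :: "(real^3)^'n"
  assumes y: "y \<in> configuration_space" and q: "quad y a b c e" and n5: "CARD('n) \<ge> 5"
    and C: "critical_circle y C"
  shows "C = circle (sgn (nrm y a b c)) (sgn (nrm y a b c) \<bullet> y $ a)" "{i. y $ i \<in> C} = {a, b, c, e}"
proof -
  have o: "otri y a b c" using q by (simp add: quad_def)
  have unq: "\<And>i j k x. otri y i j k \<Longrightarrow> x \<notin> {i, j, k} \<Longrightarrow> vol y i j k x = 0 \<Longrightarrow> {i, j, k, x} = {a, b, c, e}"
    using q unfolding quad_def by blast
  obtain u h where C': "card {i. y $ i \<in> C} \<ge> 4" "norm u = 1" "C = circle u h"
    "\<forall>i. y $ i \<notin> disc u h" using C unfolding critical_circle_def by blast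
  obtain Q where Q: "Q \<subseteq> {i. y $ i \<in> C}" "card Q = 4"
    using obtain_subset_with_card_n[OF C'(1)] by blast
  then obtain i j k x where Qe: "Q = {i, j, k, x}" and d: "distinct [i, j, k, x]"
    using card_4_distinct by metis
  have mem: "u \<bullet> y $ i = h" "u \<bullet> y $ j = h" "u \<bullet> y $ k = h" "u \<bullet> y $ x = h"
    using Q Qe C' by (auto simp: circle_def)
  have le: "u \<bullet> y $ w \<le> h" for w
    using C'(4) conf_norm'[OF y] by (auto simp: disc_def not_less)
  have u0: "u \<noteq> 0" using C' by auto
  have ijk: "i \<noteq> j" "j \<noteq> k" "i \<noteq> k" using d by auto
  have v: "vol y i j k x = 0" using mem by (intro coplanar_vol[OF y d u0]) auto
  have "otri y i j k \<or> otri y j i k" using mem le by (intro supporting_otri[OF y ijk u0]) auto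
  moreover have xx: "x \<notin> {i, j, k}" "x \<notin> {j, i, k}" using d by auto
  ultimately have "{i, j, k, x} = {a, b, c, e}"
  proof (elim disjE)
    assume "otri y i j k" then show ?thesis using unq[OF _ xx(1) v] by blast
  next
    assume "otri y j i k"
    moreover have "vol y j i k x = 0" using v vol_swap[of y j i k x] by simp
    ultimately have "{j, i, k, x} = {a, b, c, e}" using unq[OF _ xx(2)] by blast
    then show ?thesis by auto
  qed
  then have "a \<in> {i, j, k, x}" "b \<in> {i, j, k, x}" "c \<in> {i, j, k, x}" by blast+
  then have abc: "u \<bullet> y $ a = h" "u \<bullet> y $ b = h" "u \<bullet> y $ c = h" using mem by auto
  have dabc: "a \<noteq> b" "b \<noteq> c" "a \<noteq> c" using o by (auto simp: otri_def)
  obtain k' where k': "u = k' *\<^sub>R nrm y a b c" using parallel_nrm[OF y dabc, of u] abc by auto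
  have kp: "k' > 0"
  proof (rule ccontr)
    assume "\<not> k' > 0"
    moreover have "k' \<noteq> 0" using k' u0 by auto
    ultimately have "k' < 0" by simp
    have "vol y b a c w \<le> 0" for w
    proof -
      have "k' * vol y a b c w = u \<bullet> (y $ w - y $ a)" unfolding vol_def by (subst k') simp
      also have "\<dots> \<le> 0" using le[of w] abc by (simp add: inner_diff_right)
      finally show ?thesis using \<open>k' < 0\<close> vol_swap[of y b a c w] by (simp add: mult_le_0_iff)
    qed
    then have "otri y b a c" using dabc by (simp add: otri_def)
    then show False using quad_no_both[OF y q n5] o by blast
  qed
  have "sgn u = sgn (nrm y a b c)" using kp unfolding k' by (simp add: sgn_scaleR)
  moreover have "sgn u = u" using C'(2) by (simp add: sgn_div_norm)
  ultimately have us: "u = sgn (nrm y a b c)" by simp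
  then show "C = circle (sgn (nrm y a b c)) (sgn (nrm y a b c) \<bullet> y $ a)" using C'(3) abc by simp
  note oc = otri_circle[OF y o]
  have "y $ i \<in> C \<longleftrightarrow> vol y a b c i = 0" for i
    using oc(4)[of i] abc conf_norm'[OF y] unfolding C'(3) circle_def us by simp
  moreover have "vol y a b c i = 0 \<longleftrightarrow> i \<in> {a, b, c, e}" for i
  proof
    assume v: "vol y a b c i = 0"
    show "i \<in> {a, b, c, e}"
    proof (cases "i \<in> {a, b, c}")
      case False
      then have "{a, b, c, i} = {a, b, c, e}" using unq[OF o False v] by simp
      then show ?thesis by blast
    qed auto
  qed (use quad_vol[OF y q n5] in blast)
  ultimately show "{i. y $ i \<in> C} = {a, b, c, e}" by blast
qed

text \<open>The direction of the sign change selects the diagonal that disappears. If the volume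
  decreases, the quadruple is rotated by one step, which reverses the sign.\<close>

lemma cross_flip:
  fixes \<gamma> :: "real \<Rightarrow> (real^3)^'n"
  assumes cont: "continuous_on {0..1} \<gamma>" and conf: "\<gamma> ` {0..1} \<subseteq> configuration_space" and n5: "CARD('n) \<ge> 5"
    and t: "t \<in> {0<..<1}" "is_critical (\<gamma> t)" "cross \<gamma> t"
  shows "\<exists>p q r s. quad (\<gamma> t) p q r s \<and>
     (\<forall>\<^sub>F s1 in at_left t. \<forall>\<^sub>F s2 in at_right t. is_flip p q r s (delaunay (\<gamma> s1)) (delaunay (\<gamma> s2)))"
proof -
  have pt: "path \<gamma>" using cont by (simp add: path_def)
  have t01: "t \<in> {0..1}" using t by auto
  have C: "\<gamma> s \<in> configuration_space" if "s \<in> {0..1}" for s using conf that by blast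
  obtain a b c e \<epsilon> where d: "distinct [a, b, c, e]"
    and unq: "\<And>i j k x. distinct [i, j, k, x] \<Longrightarrow> vol (\<gamma> t) i j k x = 0 \<Longrightarrow> {i, j, k, x} = {a, b, c, e}"
    and eps: "\<epsilon> > 0" "\<And>s s'. t - \<epsilon> < s \<Longrightarrow> s < t \<Longrightarrow> t < s' \<Longrightarrow> s' < t + \<epsilon> \<Longrightarrow>
        vol (\<gamma> s) a b c e * vol (\<gamma> s') a b c e < 0"
    using t(3) unfolding cross_def by blast
  obtain p q r s where q: "quad (\<gamma> t) p q r s" and Q: "{p, q, r, s} = {a, b, c, e}" "distinct [p, q, r, s]"
    using quad_of_crit[OF C[OF t01] t(2) n5 unq] by blast
  have sg: "vol (\<gamma> s1) p q r s * vol (\<gamma> s2) p q r s < 0"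
    if "t - \<epsilon> < s1" "s1 < t" "t < s2" "s2 < t + \<epsilon>" for s1 s2
    using eps(2)[OF that] vol_product_perm[OF Q] by simp
  obtain \<delta> where \<delta>: "\<delta> > 0" "\<forall>s\<in>{0..1}. \<bar>s - t\<bar> < \<delta> \<longrightarrow> near (\<gamma> t) (\<gamma> s)"
    using path_near[OF pt t01] by blast
  define \<eta> where "\<eta> = min (min \<epsilon> \<delta>) (min t (1 - t))"
  have \<eta>: "\<eta> > 0" "\<eta> \<le> \<epsilon>" "\<eta> \<le> \<delta>" "\<eta> \<le> t" "\<eta> \<le> 1 - t" using eps(1) \<delta>(1) t by (auto simp: \<eta>_def)
  have near: "near (\<gamma> t) (\<gamma> w)" "\<gamma> w \<in> configuration_space" if "\<bar>w - t\<bar> < \<eta>" for w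
  proof -
    have "w \<in> {0..1}" using that \<eta>(4,5) by auto
    then show "near (\<gamma> t) (\<gamma> w)" "\<gamma> w \<in> configuration_space" using \<delta>(2) that \<eta>(3) C by auto
  qed
  have ev: "\<forall>\<^sub>F s1 in at_left t. \<forall>\<^sub>F s2 in at_right t. P s1 s2"
    if "\<And>s1 s2. t - \<eta> < s1 \<Longrightarrow> s1 < t \<Longrightarrow> t < s2 \<Longrightarrow> s2 < t + \<eta> \<Longrightarrow> P s1 s2" for P
  proof -
    have 1: "\<forall>\<^sub>F s1 in at_left t. s1 \<in> {t - \<eta><..<t}" using \<eta> by (intro eventually_at_left_real) auto
    have 2: "\<forall>\<^sub>F s2 in at_right t. s2 \<in> {t<..<t + \<eta>}" using \<eta> by (intro eventually_at_right_real) auto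
    show ?thesis
      by (rule eventually_mono[OF 1], rule eventually_mono[OF 2]) (use that in auto)
  qed
  \<comment> \<open>Two fixed sample times determine the sign on each side, because every product of
    a value before and a value after is negative.\<close>
  define l0 r0 where "l0 = t - \<eta> / 2" and "r0 = t + \<eta> / 2"
  have lr: "t - \<epsilon> < l0" "l0 < t" "t < r0" "r0 < t + \<epsilon>" using \<eta> by (auto simp: l0_def r0_def)
  have s0: "vol (\<gamma> l0) p q r s * vol (\<gamma> r0) p q r s < 0" using sg lr by blast
  have inn: "t - \<epsilon> < w" if "t - \<eta> < w" for w using that \<eta>(2) by linarith
  have inn': "w < t + \<epsilon>" if "w < t + \<eta>" for w using that \<eta>(2) by linarith
  consider "vol (\<gamma> r0) p q r s > 0" "vol (\<gamma> l0) p q r s < 0" | "vol (\<gamma> r0) p q r s < 0" "vol (\<gamma> l0) p q r s > 0"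
    using s0 by (auto simp: mult_less_0_iff)
  then show ?thesis
  proof cases
    case pos: 1
    have "is_flip p q r s (delaunay (\<gamma> s1)) (delaunay (\<gamma> s2))"
      if h: "t - \<eta> < s1" "s1 < t" "t < s2" "s2 < t + \<eta>" for s1 s2
    proof -
      have b: "\<bar>s1 - t\<bar> < \<eta>" "\<bar>s2 - t\<bar> < \<eta>" using h by linarith+
      have 1: "vol (\<gamma> s1) p q r s < 0" using sg[OF inn[OF h(1)] h(2) lr(3,4)] pos(1) unfolding mult_less_0_iff by linarith
      have 2: "vol (\<gamma> s2) p q r s > 0" using sg[OF lr(1,2) h(3) inn'[OF h(4)]] pos(2) unfolding mult_less_0_iff by linarith
      show ?thesis using quad_flip(1)[OF C[OF t01] q n5 near(2)[OF b(1)] near(2)[OF b(2)] near(1)[OF b(1)] near(1)[OF b(2)] 1 2] .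
    qed
    then have "\<forall>\<^sub>F s1 in at_left t. \<forall>\<^sub>F s2 in at_right t. is_flip p q r s (delaunay (\<gamma> s1)) (delaunay (\<gamma> s2))"
      by (rule ev)
    then show ?thesis using q by blast
  next
    case pos: 2
    have v: "vol w q r s p = - vol w p q r s" for w :: "(real^3)^'n"
      unfolding vol_def nrm_def by (simp add: cross3_simps)
    have q': "quad (\<gamma> t) q r s p" using quad_rotate[OF C[OF t01] q n5] .
    have "is_flip q r s p (delaunay (\<gamma> s1)) (delaunay (\<gamma> s2))"
      if h: "t - \<eta> < s1" "s1 < t" "t < s2" "s2 < t + \<eta>" for s1 s2
    proof -
      have b: "\<bar>s1 - t\<bar> < \<eta>" "\<bar>s2 - t\<bar> < \<eta>" using h by linarith+
      have 1: "vol (\<gamma> s1) q r s p < 0" using sg[OF inn[OF h(1)] h(2) lr(3,4)] pos(1) v[of "\<gamma> s1"] unfolding mult_less_0_iff by linarith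
      have 2: "vol (\<gamma> s2) q r s p > 0" using sg[OF lr(1,2) h(3) inn'[OF h(4)]] pos(2) v[of "\<gamma> s2"] unfolding mult_less_0_iff by linarith
      show ?thesis using quad_flip(1)[OF C[OF t01] q' n5 near(2)[OF b(1)] near(2)[OF b(2)] near(1)[OF b(1)] near(1)[OF b(2)] 1 2] .
    qed
    then have "\<forall>\<^sub>F s1 in at_left t. \<forall>\<^sub>F s2 in at_right t. is_flip q r s p (delaunay (\<gamma> s1)) (delaunay (\<gamma> s2))"
      by (rule ev)
    then show ?thesis using q' by blast
  qed
qed

lemma transversal_crit:
  assumes n: "transversal \<gamma> 0 1"
  shows "finite (critical_times \<gamma>)" "critical_times \<gamma> \<subseteq> {0<..<1}"
    "t \<in> critical_times \<gamma> \<Longrightarrow> cross \<gamma> t"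
proof -
  have C: "\<gamma> s \<in> configuration_space" if "s \<in> {0..1}" for s using n that unfolding transversal_def by blast
  have *: "t \<in> {0..1} \<and> \<not> general_position (\<gamma> t)" if "t \<in> critical_times \<gamma>" for t
    using that general_position_not_crit[OF C] unfolding critical_times_iff by blast
  then show "finite (critical_times \<gamma>)"
    using n unfolding transversal_def by (metis (no_types, lifting) finite_subset mem_Collect_eq subsetI)
  show "t \<in> critical_times \<gamma> \<Longrightarrow> cross \<gamma> t" using * n unfolding transversal_def by blast
  have "t \<noteq> 0 \<and> t \<noteq> 1" if "t \<in> critical_times \<gamma>" for t using * [OF that] n unfolding transversal_def by metis
  then show "critical_times \<gamma> \<subseteq> {0<..<1}" using * by (fastforce simp: less_le)
qed

lemma transversal_generic_path:
  fixes \<gamma> :: "real \<Rightarrow> (real^3)^'n"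
  assumes n: "transversal \<gamma> 0 1" and n5: "CARD('n) \<ge> 5"
  shows "generic_path \<gamma>"
proof -
  note nc = transversal_crit[OF n]
  have "\<exists>a b c e. quad (\<gamma> t) a b c e \<and>
        (\<forall>\<^sub>F s in at_left t. \<forall>\<^sub>F s' in at_right t. is_flip a b c e (delaunay (\<gamma> s)) (delaunay (\<gamma> s')))"
    if "t \<in> critical_times \<gamma>" for t
  proof (rule cross_flip[OF _ _ n5])
    show "t \<in> {0<..<1}" "cross \<gamma> t" "is_critical (\<gamma> t)" using nc that critical_times_iff by blast+
  qed (use n in \<open>auto simp: transversal_def\<close>)
  then show ?thesis unfolding generic_path_def using nc n by (auto simp: transversal_def path_def path_image_def)
qed

lemma transversal_generic_braid:
  fixes \<gamma> :: "real \<Rightarrow> (real^3)^'n"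
  assumes n: "transversal \<gamma> 0 1" and n5: "CARD('n) \<ge> 5" and p: "\<gamma> 0 = p" "\<gamma> 1 = p"
  shows "generic_braid p \<gamma>"
  unfolding generic_braid_def
proof (intro conjI ballI)
  note nc = transversal_crit[OF n]
  have C: "\<gamma> s \<in> configuration_space" if "s \<in> {0..1}" for s using n that unfolding transversal_def by blast
  show "pure_braid p \<gamma>" using n p unfolding transversal_def pure_braid_def path_def path_image_def pathstart_def pathfinish_def by blast
  show "finite (critical_times \<gamma>)" "critical_times \<gamma> \<subseteq> {0<..<1}" using nc by auto
  have "{t \<in> {0..1}. \<not> no_four_cocircular (\<gamma> t)} = {t \<in> {0..1}. \<not> general_position (\<gamma> t)}"
    using no_four_cocircular_iff[OF C] by blast
  then show "finite {t \<in> {0..1}. \<not> no_four_cocircular (\<gamma> t)}" using n unfolding transversal_def by simp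
  fix t assume t: "t \<in> critical_times \<gamma>"
  have t01: "t \<in> {0..1}" "is_critical (\<gamma> t)" using t critical_times_iff by blast+
  obtain a b c e where q: "quad (\<gamma> t) a b c e" and
    fl: "\<forall>\<^sub>F s1 in at_left t. \<forall>\<^sub>F s2 in at_right t. is_flip a b c e (delaunay (\<gamma> s1)) (delaunay (\<gamma> s2))"
    using transversal_generic_path[OF n n5] t unfolding generic_path_def by blast
  obtain C0 where C0: "critical_circle (\<gamma> t) C0" using t01(2) by (auto simp: is_critical_def)
  note qc = quad_critical_circle[OF C[OF t01(1)] q n5]
  show "\<exists>!C. critical_circle (\<gamma> t) C" using C0 qc(1) by metis
  have "card {a, b, c, e} = 4" using quad_distinct[OF C[OF t01(1)] q n5] by auto
  then have "card {i. \<gamma> t $ i \<in> C0} = 4" using qc(2)[OF C0] by simp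
  then show "\<exists>C a b c d. critical_circle (\<gamma> t) C \<and> card {i. \<gamma> t $ i \<in> C} = 4 \<and>
           {i. \<gamma> t $ i \<in> C} = {a, b, c, d} \<and>
           (\<forall>\<^sub>F s in at_left t. \<forall>\<^sub>F s' in at_right t. is_flip a b c d (delaunay (\<gamma> s)) (delaunay (\<gamma> s')))"
    using C0 qc(2)[OF C0] fl by blast
qed

section \<open>Gluing and reparametrizing transversal paths\<close>

lemma cross_cong:
  assumes "\<delta> > 0" "\<And>s. \<bar>s - t\<bar> < \<delta> \<Longrightarrow> \<gamma> s = \<gamma>' s" "cross \<gamma> t"
  shows "cross \<gamma>' t"
proof -
  obtain a b c e \<epsilon> where d: "distinct [a, b, c, e]"
    and unq: "\<forall>i j k x. distinct [i, j, k, x] \<longrightarrow> vol (\<gamma> t) i j k x = 0 \<longrightarrow> {i, j, k, x} = {a, b, c, e}"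
    and eps: "\<epsilon> > 0" "\<And>s s'. t - \<epsilon> < s \<Longrightarrow> s < t \<Longrightarrow> t < s' \<Longrightarrow> s' < t + \<epsilon> \<Longrightarrow>
        vol (\<gamma> s) a b c e * vol (\<gamma> s') a b c e < 0"
    using assms(3) unfolding cross_def by blast
  have "vol (\<gamma>' s) a b c e * vol (\<gamma>' s') a b c e < 0"
    if "t - min \<epsilon> \<delta> < s" "s < t" "t < s'" "s' < t + min \<epsilon> \<delta>" for s s'
    using eps(2)[of s s'] assms(2)[of s] assms(2)[of s'] that by auto
  moreover have "min \<epsilon> \<delta> > 0" "\<gamma>' t = \<gamma> t" using eps(1) assms by auto
  ultimately show ?thesis unfolding cross_def using d unq by (metis (no_types, lifting))
qed

text \<open>The configuration at the seam is in general position, so every crossing belongs to the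
  interior of one of the two pieces.\<close>

lemma transversal_join:
  assumes n1: "transversal \<gamma>1 u v" and n2: "transversal \<gamma>2 v w" and uvw: "u \<le> v" "v \<le> w" and eq: "\<gamma>1 v = \<gamma>2 v"
  shows "transversal (\<lambda>t. if t \<le> v then \<gamma>1 t else \<gamma>2 t) u w"
proof -
  define \<gamma> where "\<gamma> = (\<lambda>t. if t \<le> v then \<gamma>1 t else \<gamma>2 t)"
  have un: "{u..w} = {u..v} \<union> {v..w}" using uvw by auto
  have g1: "\<gamma> t = \<gamma>1 t" if "t \<le> v" for t using that by (simp add: \<gamma>_def)
  have g2: "\<gamma> t = \<gamma>2 t" if "v \<le> t" for t using that eq by (auto simp: \<gamma>_def)
  have "continuous_on ({u..v} \<union> {v..w}) \<gamma>" unfolding \<gamma>_def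
    using n1 n2 eq by (intro continuous_on_cases) (auto simp: transversal_def)
  then have "continuous_on {u..w} \<gamma>" by (simp add: un)
  moreover have "\<gamma> ` {u..w} \<subseteq> configuration_space"
  proof (rule image_subsetI)
    fix t assume "t \<in> {u..w}"
    then show "\<gamma> t \<in> configuration_space"
      using n1 n2 unfolding transversal_def by (cases "t \<le> v") (auto simp: \<gamma>_def)
  qed
  moreover have "general_position (\<gamma> u)" "general_position (\<gamma> w)"
    using n1 n2 uvw by (auto simp: transversal_def g1 g2)
  moreover have "{t \<in> {u..w}. \<not> general_position (\<gamma> t)} \<subseteq>
     {t \<in> {u..v}. \<not> general_position (\<gamma>1 t)} \<union> {t \<in> {v..w}. \<not> general_position (\<gamma>2 t)}"
    by (auto simp: \<gamma>_def split: if_splits)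
  then have "finite {t \<in> {u..w}. \<not> general_position (\<gamma> t)}"
    using n1 n2 unfolding transversal_def by (meson finite_UnI finite_subset)
  moreover have "cross \<gamma> t" if t: "t \<in> {u..w}" "\<not> general_position (\<gamma> t)" for t
  proof -
    consider "t < v" | "t = v" | "v < t" by linarith
    then show ?thesis
    proof cases
      case 1
      then have "cross \<gamma>1 t" using n1 t g1[of t] by (auto simp: transversal_def)
      then show ?thesis using 1 g1 by (intro cross_cong[of "v - t" t \<gamma>1 \<gamma>]) auto
    next
      case 2 then show ?thesis using n1 t g1[of t] by (auto simp: transversal_def)
    next
      case 3
      then have "cross \<gamma>2 t" using n2 t g2[of t] by (auto simp: transversal_def)
      then show ?thesis using 3 g2 by (intro cross_cong[of "t - v" t \<gamma>2 \<gamma>]) auto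
    qed
  qed
  ultimately show ?thesis unfolding transversal_def \<gamma>_def[symmetric] by blast
qed

text \<open>A negative factor exchanges past and future, which does not affect the product of the
  two volumes.\<close>

lemma cross_affine:
  assumes "cross \<gamma> (\<alpha> * t + \<beta>)" "\<alpha> \<noteq> 0"
  shows "cross (\<lambda>t. \<gamma> (\<alpha> * t + \<beta>)) t"
proof -
  define T where "T = \<alpha> * t + \<beta>"
  obtain a b c e \<epsilon> where d: "distinct [a, b, c, e]"
    and unq: "\<forall>i j k x. distinct [i, j, k, x] \<longrightarrow> vol (\<gamma> T) i j k x = 0 \<longrightarrow> {i, j, k, x} = {a, b, c, e}"
    and eps: "\<epsilon> > 0" "\<And>s s'. T - \<epsilon> < s \<Longrightarrow> s < T \<Longrightarrow> T < s' \<Longrightarrow> s' < T + \<epsilon> \<Longrightarrow>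
        vol (\<gamma> s) a b c e * vol (\<gamma> s') a b c e < 0"
    using assms(1) unfolding cross_def T_def[symmetric] by blast
  define \<delta> where "\<delta> = \<epsilon> / \<bar>\<alpha>\<bar>"
  have \<delta>: "\<delta> > 0" "\<bar>\<alpha>\<bar> * \<delta> = \<epsilon>" using eps(1) assms(2) by (auto simp: \<delta>_def)
  have "vol (\<gamma> (\<alpha> * s + \<beta>)) a b c e * vol (\<gamma> (\<alpha> * s' + \<beta>)) a b c e < 0"
    if h: "t - \<delta> < s" "s < t" "t < s'" "s' < t + \<delta>" for s s'
  proof (cases "\<alpha> > 0")
    case True
    have "\<alpha> * t - \<alpha> * \<delta> < \<alpha> * s" "\<alpha> * s < \<alpha> * t" "\<alpha> * t < \<alpha> * s'" "\<alpha> * s' < \<alpha> * t + \<alpha> * \<delta>"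
      using mult_strict_left_mono[OF h(1) True] mult_strict_left_mono[OF h(2) True]
        mult_strict_left_mono[OF h(3) True] mult_strict_left_mono[OF h(4) True] by (simp_all add: algebra_simps)
    then show ?thesis using \<delta>(2) True by (intro eps(2)) (auto simp: T_def)
  next
    case False
    then have neg: "\<alpha> < 0" using assms(2) by simp
    have "\<alpha> * t - \<alpha> * \<delta> > \<alpha> * s" "\<alpha> * s > \<alpha> * t" "\<alpha> * t > \<alpha> * s'" "\<alpha> * s' > \<alpha> * t + \<alpha> * \<delta>"
      using mult_strict_left_mono_neg[OF h(1) neg] mult_strict_left_mono_neg[OF h(2) neg]
        mult_strict_left_mono_neg[OF h(3) neg] mult_strict_left_mono_neg[OF h(4) neg] by (simp_all add: algebra_simps)
    then have "vol (\<gamma> (\<alpha> * s' + \<beta>)) a b c e * vol (\<gamma> (\<alpha> * s + \<beta>)) a b c e < 0"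
      using \<delta>(2) neg by (intro eps(2)) (auto simp: T_def)
    then show ?thesis by (simp add: mult.commute)
  qed
  then show ?thesis unfolding cross_def using d unq \<delta>(1) unfolding T_def by blast
qed

lemma transversal_affine:
  assumes n: "transversal \<gamma> u v" and a: "\<alpha> \<noteq> 0" and im: "\<And>t. t \<in> {u'..v'} \<Longrightarrow> \<alpha> * t + \<beta> \<in> {u..v}"
    and e: "\<alpha> * u' + \<beta> \<in> {u, v}" "\<alpha> * v' + \<beta> \<in> {u, v}"
  shows "transversal (\<lambda>t. \<gamma> (\<alpha> * t + \<beta>)) u' v'"
proof -
  have "continuous_on {u'..v'} (\<lambda>t. \<gamma> (\<alpha> * t + \<beta>))"
  proof (rule continuous_on_compose2[of "{u..v}" \<gamma>])
    show "continuous_on {u..v} \<gamma>" using n by (simp add: transversal_def)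
    show "(\<lambda>t. \<alpha> * t + \<beta>) ` {u'..v'} \<subseteq> {u..v}" using im by blast
  qed (intro continuous_intros)
  moreover have "(\<lambda>t. \<gamma> (\<alpha> * t + \<beta>)) ` {u'..v'} \<subseteq> configuration_space" using n im unfolding transversal_def by blast
  moreover have "general_position (\<gamma> (\<alpha> * u' + \<beta>))" "general_position (\<gamma> (\<alpha> * v' + \<beta>))"
    using n e unfolding transversal_def by auto
  moreover have "finite {t \<in> {u'..v'}. \<not> general_position (\<gamma> (\<alpha> * t + \<beta>))}"
  proof (rule finite_subset)
    show "{t \<in> {u'..v'}. \<not> general_position (\<gamma> (\<alpha> * t + \<beta>))} \<subseteq>
      (\<lambda>t. \<alpha> * t + \<beta>) -` {t \<in> {u..v}. \<not> general_position (\<gamma> t)}" using im by blast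
    show "finite ((\<lambda>t. \<alpha> * t + \<beta>) -` {t \<in> {u..v}. \<not> general_position (\<gamma> t)})"
      using n a by (intro finite_vimageI) (auto simp: transversal_def inj_on_def)
  qed
  moreover have "cross (\<lambda>t. \<gamma> (\<alpha> * t + \<beta>)) t" if "t \<in> {u'..v'}" "\<not> general_position (\<gamma> (\<alpha> * t + \<beta>))" for t
  proof (rule cross_affine[OF _ a])
    show "cross \<gamma> (\<alpha> * t + \<beta>)" using n im[OF that(1)] that(2) unfolding transversal_def by blast
  qed
  ultimately show ?thesis unfolding transversal_def by blast
qed

lemma transversal_rescale:
  assumes "transversal \<gamma> 0 1" "u < v"
  shows "transversal (\<lambda>t. \<gamma> ((t - u) / (v - u))) u v"
proof -
  have "transversal (\<lambda>t. \<gamma> (1 / (v - u) * t + - u / (v - u))) u v"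
  proof (rule transversal_affine[OF assms(1)])
    show "1 / (v - u) * t + - u / (v - u) \<in> {0..1}" if "t \<in> {u..v}" for t
    proof -
      have "1 / (v - u) * t + - u / (v - u) = (t - u) / (v - u)" by (simp add: diff_divide_distrib)
      then show ?thesis using that assms(2) by (simp add: divide_le_eq)
    qed
    show "1 / (v - u) * u + - u / (v - u) \<in> {0, 1}" by simp
    have "1 / (v - u) * v + - u / (v - u) = (v - u) / (v - u)" by (simp only: diff_divide_distrib) simp
    then show "1 / (v - u) * v + - u / (v - u) \<in> {0, 1}" using assms(2) by simp
  qed (use assms in auto)
  moreover have "1 / (v - u) * t + - u / (v - u) = (t - u) / (v - u)" for t by (simp add: diff_divide_distrib)
  ultimately show ?thesis by simp
qed

lemma transversal_reverse: "transversal \<gamma> 0 1 \<Longrightarrow> transversal (\<lambda>t. \<gamma> (1 - t)) 0 1"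
  using transversal_affine[of \<gamma> 0 1 "-1" 0 1 1] by simp

section \<open>Moving a single point\<close>

text \<open>Closedness is included so that finite unions still have empty interior.\<close>

definition thin :: "'a::topological_space set \<Rightarrow> bool" where
  "thin S \<longleftrightarrow> closed S \<and> interior S = {}"

lemma thin_Un: "thin S \<Longrightarrow> thin T \<Longrightarrow> thin (S \<union> T)"
  unfolding thin_def using interior_closed_Un_empty_interior by blast

lemma thin_UN: "finite I \<Longrightarrow> (\<And>i. i \<in> I \<Longrightarrow> thin (S i)) \<Longrightarrow> thin (\<Union>i\<in>I. S i)"
  by (induction I rule: finite_induct) (auto intro: thin_Un simp: thin_def[of "{}"])

lemma quadratic_zeros_finite:
  fixes a b c :: real
  assumes "a \<noteq> 0 \<or> b \<noteq> 0 \<or> c \<noteq> 0"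
  shows "finite {t. a + b * t + c * t\<^sup>2 = 0}"
proof -
  have "finite {t. poly [:a, b, c:] t = 0}" using assms by (intro poly_roots_finite) auto
  moreover have "poly [:a, b, c:] t = a + b * t + c * t\<^sup>2" for t by (simp add: power2_eq_square algebra_simps)
  ultimately show ?thesis by (simp only:)
qed

text \<open>If \<open>f\<close> vanished on a ball, its restriction to the line towards
  \<open>w0\<close> would be a quadratic polynomial with infinitely many zeros, contradicting the
  value at \<open>w0\<close>.\<close>

lemma thin_quadratic:
  fixes f :: "'a::euclidean_space \<Rightarrow> real"
  assumes c: "continuous_on UNIV f" and q: "\<And>w v. \<exists>a b c. \<forall>t. f (w + t *\<^sub>R v) = a + b * t + c * t\<^sup>2"
    and nz: "f w0 \<noteq> 0"
  shows "thin {w. f w = 0}"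
proof -
  have "closed {w. f w = 0}"
    using continuous_closed_preimage_constant[OF c, of 0] by simp
  moreover have "interior {w. f w = 0} = {}"
  proof (rule ccontr)
    assume "\<not> ?thesis"
    then obtain w e where w: "e > 0" "ball w e \<subseteq> {w. f w = 0}" by (auto simp: mem_interior)
    define v where "v = w0 - w"
    obtain a b c where abc: "\<And>t. f (w + t *\<^sub>R v) = a + b * t + c * t\<^sup>2" using q by metis
    have "f (w + 1 *\<^sub>R v) \<noteq> 0" using nz by (simp add: v_def)
    then have "a \<noteq> 0 \<or> b \<noteq> 0 \<or> c \<noteq> 0" unfolding abc by auto
    then have fin: "finite {t. a + b * t + c * t\<^sup>2 = 0}" by (rule quadratic_zeros_finite)
    define h where "h = e / (norm v + 1)"
    have h: "h > 0" using w(1) by (auto simp: h_def intro!: divide_pos_pos add_nonneg_pos)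
    have "{0<..<h} \<subseteq> {t. a + b * t + c * t\<^sup>2 = 0}"
    proof
      fix t assume t: "t \<in> {0<..<h}"
      have n1: "norm v + 1 > 0" by (simp add: add_nonneg_pos)
      have "t * norm v \<le> t * (norm v + 1)" using t by (intro mult_left_mono) auto
      also have "\<dots> < h * (norm v + 1)" using t n1 by (intro mult_strict_right_mono) auto
      also have "\<dots> = e" using n1 by (simp add: h_def)
      finally have "t * norm v < e" .
      then have "w + t *\<^sub>R v \<in> ball w e" using t by (simp add: dist_norm)
      then show "t \<in> {t. a + b * t + c * t\<^sup>2 = 0}" using w(2) abc by auto
    qed
    then show False using fin h infinite_Ioo[of 0 h] finite_subset by blast
  qed
  ultimately show ?thesis by (simp add: thin_def)
qed

text \<open>At a root the derivative \<open>D\<close> satisfies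
  \<open>D^2 = A1^2 - 4 * A0 * A2\<close>, so a nonzero discriminant makes the zero simple, also in
  the linear case \<open>A2 = 0\<close>.\<close>

lemma quadratic_sign_change:
  fixes A0 A1 A2 t :: real
  assumes root: "A0 + A1 * t + A2 * t\<^sup>2 = 0" and disc: "A1\<^sup>2 - 4 * A0 * A2 \<noteq> 0"
  shows "\<exists>\<epsilon>>0. \<forall>s s'. t - \<epsilon> < s \<longrightarrow> s < t \<longrightarrow> t < s' \<longrightarrow> s' < t + \<epsilon> \<longrightarrow>
     (A0 + A1 * s + A2 * s\<^sup>2) * (A0 + A1 * s' + A2 * s'\<^sup>2) < 0"
proof -
  define D where "D = A1 + 2 * A2 * t"
  have "D\<^sup>2 = A1\<^sup>2 - 4 * A0 * A2 + 4 * A2 * (A0 + A1 * t + A2 * t\<^sup>2)"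
    unfolding D_def by (simp add: power2_eq_square algebra_simps)
  then have D: "D \<noteq> 0" using root disc by auto
  have fac: "A0 + A1 * s + A2 * s\<^sup>2 = (s - t) * (D + A2 * (s - t))" for s
  proof -
    have "A0 + A1 * s + A2 * s\<^sup>2 = (A0 + A1 * t + A2 * t\<^sup>2) + (s - t) * (D + A2 * (s - t))"
      unfolding D_def by (simp add: power2_eq_square algebra_simps)
    then show ?thesis using root by simp
  qed
  \<comment> \<open>Within this radius \<open>A2 * (s - t)\<close> is smaller than \<open>D\<close>
    in absolute value, so the second factor keeps the sign of \<open>D\<close>.\<close>
  define \<epsilon> where "\<epsilon> = \<bar>D\<bar> / (\<bar>A2\<bar> + 1)"
  have e: "\<epsilon> > 0" using D by (auto simp: \<epsilon>_def intro!: divide_pos_pos add_nonneg_pos)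
  have pos: "D * (D + A2 * (s - t)) > 0" if "\<bar>s - t\<bar> < \<epsilon>" for s
  proof -
    have n1: "\<bar>A2\<bar> + 1 > 0" by simp
    have "\<bar>A2 * (s - t)\<bar> \<le> (\<bar>A2\<bar> + 1) * \<bar>s - t\<bar>" by (simp add: abs_mult mult_right_mono)
    also have "\<dots> < (\<bar>A2\<bar> + 1) * \<epsilon>" using that n1 by (intro mult_strict_left_mono) auto
    also have "\<dots> = \<bar>D\<bar>" using n1 by (simp add: \<epsilon>_def)
    finally have lt: "\<bar>A2 * (s - t)\<bar> < \<bar>D\<bar>" .
    show ?thesis
    proof (cases "D > 0")
      case True then show ?thesis using lt by (intro mult_pos_pos) auto
    next
      case False then show ?thesis using lt D by (intro mult_neg_neg) auto
    qed
  qed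
  have "(A0 + A1 * s + A2 * s\<^sup>2) * (A0 + A1 * s' + A2 * s'\<^sup>2) < 0"
    if "t - \<epsilon> < s" "s < t" "t < s'" "s' < t + \<epsilon>" for s s'
  proof -
    have p: "D * (D + A2 * (s - t)) > 0" "D * (D + A2 * (s' - t)) > 0" using that by (auto intro!: pos)
    have "0 < (D * (D + A2 * (s - t))) * (D * (D + A2 * (s' - t)))" using p by (rule mult_pos_pos)
    also have "\<dots> = D\<^sup>2 * ((D + A2 * (s - t)) * (D + A2 * (s' - t)))" by (simp add: power2_eq_square algebra_simps)
    finally have pp: "(D + A2 * (s - t)) * (D + A2 * (s' - t)) > 0" using D by (simp add: zero_less_mult_iff)
    have "(s - t) * (s' - t) < 0" using that by (simp add: mult_neg_pos)
    then have "((s - t) * (s' - t)) * ((D + A2 * (s - t)) * (D + A2 * (s' - t))) < 0"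
      using pp by (rule mult_neg_pos)
    then show ?thesis unfolding fac by (simp add: algebra_simps)
  qed
  then show ?thesis using e by blast
qed

section \<open>Stereographic coordinates and the quadratic forms of circles\<close>

text \<open>\<open>reflect P w\<close> is the image of \<open>P\<close> under the reflection in the plane orthogonal to \<open>w\<close>. It parametrizes
  the sphere by stereographic projection from \<open>P\<close>, so that along a segment of the \<open>w\<close>-space every
  circle is given by a quadratic equation.\<close>
definition reflect :: "real^3 \<Rightarrow> real^3 \<Rightarrow> real^3" where
  "reflect P w = P - (2 * (P \<bullet> w) / (w \<bullet> w)) *\<^sub>R w"

lemma norm_reflect: assumes "norm P = 1" shows "norm (reflect P w) = 1"
proof (cases "w = 0")
  case False
  define k where "k = 2 * (P \<bullet> w) / (w \<bullet> w)"
  have k: "k * (w \<bullet> w) = 2 * (P \<bullet> w)" using False by (simp add: k_def)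
  have "reflect P w \<bullet> reflect P w = P \<bullet> P - 2 * k * (P \<bullet> w) + k * (k * (w \<bullet> w))"
    unfolding reflect_def k_def[symmetric]
    by (simp add: inner_diff_left inner_diff_right inner_commute algebra_simps)
  also have "\<dots> = P \<bullet> P" unfolding k by simp
  finally show ?thesis using assms by (simp add: norm_eq_sqrt_inner)
qed (use assms in \<open>simp add: reflect_def\<close>)

lemma reflect_self:
  assumes "norm P = 1" "norm x = 1" "x \<noteq> P"
  shows "reflect P (x - P) = x"
proof -
  have 1: "(x - P) \<bullet> (x - P) = - 2 * (P \<bullet> (x - P))"
  proof -
    have "x \<bullet> x = 1" "P \<bullet> P = 1" using assms(1,2) by (simp_all add: dot_square_norm)
    then show ?thesis by (simp add: inner_diff_left inner_diff_right inner_commute)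
  qed
  have "(x - P) \<bullet> (x - P) \<noteq> 0" using assms(3) by simp
  then have "2 * (P \<bullet> (x - P)) / ((x - P) \<bullet> (x - P)) = -1" using 1 by (simp add: divide_eq_minus_1_iff)
  then show ?thesis by (simp add: reflect_def)
qed

text \<open>The numerator of \<open>N \<bullet> reflect P w - \<kappa>\<close>: the circle cut out
  by the plane \<open>N \<bullet> x = \<kappa>\<close>, pulled back to \<open>w\<close>-space as a
  quadratic cone.\<close>

definition qf :: "real^3 \<Rightarrow> real^3 \<Rightarrow> real \<Rightarrow> real^3 \<Rightarrow> real" where
  "qf P N \<kappa> w = (N \<bullet> P - \<kappa>) * (w \<bullet> w) - 2 * (P \<bullet> w) * (N \<bullet> w)"

text \<open>The symmetric bilinear form that polarizes \<open>qf\<close>.\<close>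

definition bf :: "real^3 \<Rightarrow> real^3 \<Rightarrow> real \<Rightarrow> real^3 \<Rightarrow> real^3 \<Rightarrow> real" where
  "bf P N \<kappa> w v = (N \<bullet> P - \<kappa>) * (w \<bullet> v) - (P \<bullet> w) * (N \<bullet> v) - (P \<bullet> v) * (N \<bullet> w)"

lemma qf_line: "qf P N \<kappa> (w + t *\<^sub>R v) = qf P N \<kappa> w + (2 * bf P N \<kappa> w v) * t + qf P N \<kappa> v * t\<^sup>2"
  unfolding qf_def bf_def
  by (simp add: inner_add_left inner_add_right inner_commute power2_eq_square algebra_simps)

lemma bf_line: "bf P N \<kappa> w (u + t *\<^sub>R v) = bf P N \<kappa> w u + bf P N \<kappa> w v * t"
  unfolding bf_def by (simp add: inner_add_left inner_add_right algebra_simps)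

lemma qf_reflect: "w \<noteq> 0 \<Longrightarrow> N \<bullet> reflect P w - \<kappa> = qf P N \<kappa> w / (w \<bullet> w)"
  unfolding qf_def reflect_def by (simp add: inner_diff_right diff_divide_distrib)

lemma orthogonal_to_two: "\<exists>v. v \<noteq> 0 \<and> v \<bullet> p = 0 \<and> v \<bullet> (q :: real^3) = 0"
proof (cases "cross3 p q = 0")
  case False
  then show ?thesis by (intro exI[of _ "cross3 p q"]) (simp add: dot_cross_self)
next
  case True
  obtain v where v: "v \<noteq> 0" "orthogonal p v"
    using orthogonal_to_vector_exists[of p] by auto
  show ?thesis
  proof (cases "p = 0")
    case True
    obtain v where "v \<noteq> 0" "orthogonal q v" using orthogonal_to_vector_exists[of q] by auto
    then show ?thesis using True by (auto simp: orthogonal_def inner_commute)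
  next
    case False
    then have "q = 0 \<or> (\<exists>c. q = c *\<^sub>R p)" using True unfolding cross_eq_0 collinear_lemma by blast
    then show ?thesis using v by (auto simp: orthogonal_def inner_commute)
  qed
qed

text \<open>The plane \<open>N \<bullet> x = \<kappa>\<close> is assumed not to be the tangent plane at \<open>P\<close>.\<close>
lemma disc_nonzero_ex:
  assumes P: "norm P = 1" and nt: "\<not> (N = \<kappa> *\<^sub>R P \<and> N \<bullet> P = \<kappa>)" and q: "qf P N \<kappa> w \<noteq> 0"
  shows "\<exists>v. (2 * bf P N \<kappa> w v)\<^sup>2 - 4 * qf P N \<kappa> w * qf P N \<kappa> v \<noteq> 0"
\<comment> \<open>For the tangent plane at \<open>P\<close> the form would be
  \<open>- 2 * \<kappa> * (P \<bullet> w)^2\<close>, whose discriminant vanishes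
  identically.\<close>
proof (cases "N \<bullet> P = \<kappa>")
  case False
  \<comment> \<open>In a direction orthogonal to \<open>P\<close> and \<open>l\<close> the bilinear
    term vanishes but the form does not, so only the product term of the discriminant is
    left.\<close>
  define l where "l = (N \<bullet> P - \<kappa>) *\<^sub>R w - (P \<bullet> w) *\<^sub>R N"
  obtain v where v: "v \<noteq> 0" "v \<bullet> P = 0" "v \<bullet> l = 0" using orthogonal_to_two by blast
  have Pv: "P \<bullet> v = 0" using v by (simp add: inner_commute)
  have "bf P N \<kappa> w v = v \<bullet> l" unfolding bf_def l_def Pv by (simp add: inner_diff_right inner_commute)
  moreover have "qf P N \<kappa> v = (N \<bullet> P - \<kappa>) * (v \<bullet> v)" unfolding qf_def Pv by simp
  ultimately show ?thesis using v q False by (intro exI[of _ v]) simp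
next
  case True
  \<comment> \<open>Here the plane passes through \<open>P\<close>. The part of \<open>N\<close>
    tangent to the sphere at \<open>P\<close> is isotropic for the form and pairs nontrivially with
    \<open>w\<close>, so only the square of the bilinear term remains.\<close>
  define v where "v = N - (N \<bullet> P) *\<^sub>R P"
  have v0: "v \<noteq> 0" using nt True by (auto simp: v_def)
  have PP: "P \<bullet> P = 1" using P by (simp add: dot_square_norm)
  have Pv: "P \<bullet> v = 0" unfolding v_def using PP by (simp add: inner_diff_right inner_commute)
  have "N \<bullet> v = v \<bullet> v + (N \<bullet> P) * (P \<bullet> v)" unfolding v_def by (simp add: inner_diff_left inner_diff_right inner_commute PP)
  then have Nv: "N \<bullet> v \<noteq> 0" using v0 Pv by simp
  have "P \<bullet> w \<noteq> 0" using q True by (auto simp: qf_def)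
  then have "bf P N \<kappa> w v \<noteq> 0" unfolding bf_def Pv using True Nv by simp
  moreover have "qf P N \<kappa> v = 0" unfolding qf_def Pv using True by simp
  ultimately show ?thesis by (intro exI[of _ v]) simp
qed

lemma qf_nonzero_ex:
  assumes P: "norm P = 1" and nt: "\<not> (N = \<kappa> *\<^sub>R P \<and> N \<bullet> P = \<kappa>)"
  shows "\<exists>v. qf P N \<kappa> v \<noteq> 0"
proof (cases "N \<bullet> P = \<kappa>")
  case False
  obtain v where v: "v \<noteq> 0" "v \<bullet> P = 0" using orthogonal_to_two by blast
  have "qf P N \<kappa> v = (N \<bullet> P - \<kappa>) * (v \<bullet> v)" unfolding qf_def using v by (simp add: inner_commute)
  then show ?thesis using v False by (intro exI[of _ v]) simp
next
  case True
  define v where "v = N - (N \<bullet> P) *\<^sub>R P"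
  have v0: "v \<noteq> 0" using nt True by (auto simp: v_def)
  have PP: "P \<bullet> P = 1" using P by (simp add: dot_square_norm)
  have Pv: "P \<bullet> v = 0" unfolding v_def using PP by (simp add: inner_diff_right inner_commute)
  have "N \<bullet> v = v \<bullet> v + (N \<bullet> P) * (P \<bullet> v)" unfolding v_def by (simp add: inner_diff_left inner_diff_right inner_commute PP)
  then have Nv: "N \<bullet> v \<noteq> 0" using v0 Pv by simp
  have qv: "qf P N \<kappa> (P + s *\<^sub>R v) = - 2 * (N \<bullet> P + s * (N \<bullet> v))" for s
    unfolding qf_def using True PP Pv by (simp add: inner_add_right)
  show ?thesis
  proof (cases "N \<bullet> P = 0")
    case True then show ?thesis using qv[of 1] Nv by (intro exI[of _ "P + 1 *\<^sub>R v"]) simp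
  next
    case False then show ?thesis using qv[of 0] by (intro exI[of _ "P + 0 *\<^sub>R v"]) simp
  qed
qed

lemma thin_qf:
  assumes "qf P N \<kappa> w0 \<noteq> 0" shows "thin {w. qf P N \<kappa> w = 0}"
proof (rule thin_quadratic[of "qf P N \<kappa>" w0, OF _ _ assms])
  show "continuous_on UNIV (qf P N \<kappa>)" unfolding qf_def by (intro continuous_intros)
  show "\<exists>a b c. \<forall>t. qf P N \<kappa> (w + t *\<^sub>R v) = a + b * t + c * t\<^sup>2" for w v using qf_line by blast
qed

lemma thin_disc:
  assumes P: "norm P = 1" and nt: "\<not> (N = \<kappa> *\<^sub>R P \<and> N \<bullet> P = \<kappa>)" and q: "qf P N \<kappa> w0 \<noteq> 0"
  shows "thin {w. (2 * bf P N \<kappa> w0 (w - w0))\<^sup>2 - 4 * qf P N \<kappa> w0 * qf P N \<kappa> (w - w0) = 0}"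
proof -
  obtain v where v: "(2 * bf P N \<kappa> w0 v)\<^sup>2 - 4 * qf P N \<kappa> w0 * qf P N \<kappa> v \<noteq> 0"
    using disc_nonzero_ex[OF assms] by blast
  show ?thesis
  proof (rule thin_quadratic[of _ "w0 + v"])
    show "continuous_on UNIV (\<lambda>w. (2 * bf P N \<kappa> w0 (w - w0))\<^sup>2 - 4 * qf P N \<kappa> w0 * qf P N \<kappa> (w - w0))"
      unfolding qf_def bf_def by (intro continuous_intros)
    show "(2 * bf P N \<kappa> w0 (w0 + v - w0))\<^sup>2 - 4 * qf P N \<kappa> w0 * qf P N \<kappa> (w0 + v - w0) \<noteq> 0"
      using v by simp
    fix w u :: "real^3"
    have e: "w + t *\<^sub>R u - w0 = (w - w0) + t *\<^sub>R u" for t by simp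
    have "(2 * bf P N \<kappa> w0 (w + t *\<^sub>R u - w0))\<^sup>2 - 4 * qf P N \<kappa> w0 * qf P N \<kappa> (w + t *\<^sub>R u - w0)
      = (4 * (bf P N \<kappa> w0 (w - w0))\<^sup>2 - 4 * qf P N \<kappa> w0 * qf P N \<kappa> (w - w0))
       + (8 * bf P N \<kappa> w0 (w - w0) * bf P N \<kappa> w0 u - 8 * qf P N \<kappa> w0 * bf P N \<kappa> (w - w0) u) * t
       + (4 * (bf P N \<kappa> w0 u)\<^sup>2 - 4 * qf P N \<kappa> w0 * qf P N \<kappa> u) * t\<^sup>2" for t
      unfolding e bf_line qf_line by (simp add: power2_eq_square algebra_simps)
    then show "\<exists>a b c. \<forall>t. (2 * bf P N \<kappa> w0 (w + t *\<^sub>R u - w0))\<^sup>2 - 4 * qf P N \<kappa> w0 * qf P N \<kappa> (w + t *\<^sub>R u - w0)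
       = a + b * t + c * t\<^sup>2" by blast
  qed
qed

lemma thin_plane:
  fixes n :: "'a::euclidean_space"
  assumes "n \<noteq> 0" shows "thin {w. n \<bullet> w = 0}"
proof (rule thin_quadratic[of _ n])
  show "continuous_on UNIV ((\<bullet>) n)" by (intro continuous_intros)
  have "n \<bullet> (w + t *\<^sub>R v) = n \<bullet> w + (n \<bullet> v) * t + 0 * t\<^sup>2" for w v t by (simp add: inner_add_right algebra_simps)
  then show "\<exists>a b c. \<forall>t. n \<bullet> (w + t *\<^sub>R v) = a + b * t + c * t\<^sup>2" for w v by blast
qed (use assms in simp)

section \<open>Replacing a single point and avoiding exceptional targets\<close>

definition upd :: "(real^3)^'n \<Rightarrow> 'n \<Rightarrow> real^3 \<Rightarrow> (real^3)^'n" where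
  "upd x i m = (\<chi> j. if j = i then m else x $ j)"

lemma upd_nth [simp]: "upd x i m $ i = m" "j \<noteq> i \<Longrightarrow> upd x i m $ j = x $ j"
  by (simp_all add: upd_def)

lemma upd_same [simp]: "upd x i (x $ i) = x"
  by (simp add: upd_def vec_eq_iff)

lemma nrm_upd: "a \<noteq> i \<Longrightarrow> b \<noteq> i \<Longrightarrow> c \<noteq> i \<Longrightarrow> nrm (upd x i m) a b c = nrm x a b c"
  by (simp add: nrm_def)

lemma vol_upd:
  "a \<noteq> i \<Longrightarrow> b \<noteq> i \<Longrightarrow> c \<noteq> i \<Longrightarrow> e \<noteq> i \<Longrightarrow> vol (upd x i m) a b c e = vol x a b c e"
  "a \<noteq> i \<Longrightarrow> b \<noteq> i \<Longrightarrow> c \<noteq> i \<Longrightarrow> vol (upd x i m) a b c i = nrm x a b c \<bullet> m - nrm x a b c \<bullet> x $ a"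
  by (simp_all add: vol_def nrm_upd inner_diff_right)

text \<open>The tangent plane at \<open>P\<close> meets the sphere only in \<open>P\<close>, whereas
  this plane contains two distinct points of the configuration.\<close>

lemma not_tangent:
  assumes x: "x \<in> configuration_space" and d: "j \<noteq> k" and P: "norm P = 1" and N: "N \<noteq> 0"
    and on: "N \<bullet> x $ j = \<kappa>" "N \<bullet> x $ k = \<kappa>"
  shows "\<not> (N = \<kappa> *\<^sub>R P \<and> N \<bullet> P = \<kappa>)"
proof
  assume h: "N = \<kappa> *\<^sub>R P \<and> N \<bullet> P = \<kappa>"
  then have k: "\<kappa> \<noteq> 0" using N by auto
  have "x $ l = P" if "N \<bullet> x $ l = \<kappa>" for l
  proof -
    have Pl: "P \<bullet> x $ l = 1" using that h k by (metis inner_scaleR_left mult_cancel_left1 mult.commute)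
    have "(x $ l - P) \<bullet> (x $ l - P) = x $ l \<bullet> x $ l - 2 * (P \<bullet> x $ l) + P \<bullet> P"
      by (simp add: inner_diff_left inner_diff_right inner_commute)
    also have "\<dots> = 0" using Pl conf_norm[OF x] P by (simp add: dot_square_norm)
    finally show ?thesis by simp
  qed
  then show False using on conf_inj[OF x] d by metis
qed

text \<open>Two circles with three common points lie in the same plane, which would put a vertex of
  one triple on the plane of the other.\<close>

lemma finite_plane_intersection:
  assumes x: "x \<in> configuration_space" and g: "general_position x"
    and d: "distinct [j, k, l]" "distinct [j', k', l']" and ne: "{j, k, l} \<noteq> {j', k', l'}"
  shows "finite {r. norm r = 1 \<and> nrm x j k l \<bullet> r = nrm x j k l \<bullet> x $ j \<and> nrm x j' k' l' \<bullet> r = nrm x j' k' l' \<bullet> x $ j'}"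
    (is "finite ?R")
proof (rule ccontr)
  assume "infinite ?R"
  then obtain T where T: "finite T" "card T = 3" "T \<subseteq> ?R" using infinite_arbitrarily_large by blast
  obtain r1 r2 r3 where r: "T = {r1, r2, r3}" "r1 \<noteq> r2" "r2 \<noteq> r3" "r1 \<noteq> r3" using T(2) card_3_iff by metis
  define N N' where "N = nrm x j k l" and "N' = nrm x j' k' l'"
  have n: "norm r1 = 1" "norm r2 = 1" "norm r3 = 1"
    and on: "N \<bullet> r1 = N \<bullet> x $ j" "N \<bullet> r2 = N \<bullet> x $ j" "N \<bullet> r3 = N \<bullet> x $ j"
    and on': "N' \<bullet> r1 = N' \<bullet> x $ j'" "N' \<bullet> r2 = N' \<bullet> x $ j'" "N' \<bullet> r3 = N' \<bullet> x $ j'"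
    using T(3) r(1) by (auto simp: N_def N'_def)
  define c where "c = cross3 (r2 - r1) (r3 - r1)"
  have c0: "c \<noteq> 0" unfolding c_def using n r by (intro cross3_sphere_nonzero) auto
  obtain a where a: "N = a *\<^sub>R c"
    using orthogonal_parallel_cross[of N "r2 - r1" "r3 - r1"] c0 on unfolding c_def by (auto simp: inner_diff_right)
  obtain b where b: "N' = b *\<^sub>R c"
    using orthogonal_parallel_cross[of N' "r2 - r1" "r3 - r1"] c0 on' unfolding c_def by (auto simp: inner_diff_right)
  have N0: "N \<noteq> 0" "N' \<noteq> 0" unfolding N_def N'_def using nrm_nonzero[OF x, of j k l] nrm_nonzero[OF x, of j' k' l'] d by auto
  have b0: "b \<noteq> 0" "a \<noteq> 0" using b a N0 by auto
  have "\<not> {j', k', l'} \<subseteq> {j, k, l}"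
  proof
    assume "{j', k', l'} \<subseteq> {j, k, l}"
    moreover have "card {j', k', l'} = card {j, k, l}" using d by auto
    ultimately show False using ne card_subset_eq[of "{j, k, l}" "{j', k', l'}"] by auto
  qed
  then obtain m where m: "m \<in> {j', k', l'}" "m \<notin> {j, k, l}" by blast
  have Nm: "N' \<bullet> x $ m = N' \<bullet> x $ j'" using m(1) nrm_inner[of x j' k' l'] by (auto simp: N'_def)
  have "c \<bullet> x $ m = c \<bullet> r1" using Nm on'(1) b b0 by simp
  then have "N \<bullet> x $ m = N \<bullet> r1" using a by simp
  then have "vol x j k l m = 0" using on(1) by (simp add: vol_def N_def inner_diff_right)
  moreover have "distinct [j, k, l, m]" using d m by auto
  ultimately show False using g unfolding general_position_def by blast
qed

lemma upd_conf:
  assumes "x \<in> configuration_space" "norm m = 1" "\<And>j. j \<noteq> i \<Longrightarrow> m \<noteq> x $ j"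
  shows "upd x i m \<in> configuration_space"
  using assms unfolding configuration_space_def upd_def by auto

lemma tuple_last:
  assumes "distinct [a, b, c, e]" "i \<in> {a, b, c, e}"
  obtains j k l where "{j, k, l, i} = {a, b, c, e}" "distinct [j, k, l, i]"
proof -
  consider "i = a" | "i = b" | "i = c" | "i = e" using assms by auto
  then show ?thesis
  proof cases
    case 1 then show ?thesis using assms by (intro that[of b c e]) auto
  next
    case 2 then show ?thesis using assms by (intro that[of a c e]) auto
  next
    case 3 then show ?thesis using assms by (intro that[of a b e]) auto
  next
    case 4 then show ?thesis using assms by (intro that[of a b c]) auto
  qed
qed

lemma vol_perm_zero:
  assumes "{p, q, r, s} = {a, b, c, e}" "distinct [p, q, r, s]"
  shows "vol z p q r s = 0 \<longleftrightarrow> vol z a b c e = 0"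
  using vol_product_perm[OF assms, of z z] by (metis mult_eq_0_iff)

lemma vol_upd_last:
  assumes "distinct [a, b, c, e]" "vol (upd x i m) a b c e = 0" "i \<notin> {a, b, c, e} \<Longrightarrow> vol x a b c e \<noteq> 0"
  obtains j k l where "{j, k, l, i} = {a, b, c, e}" "distinct [j, k, l, i]" "vol (upd x i m) j k l i = 0"
proof -
  have "i \<in> {a, b, c, e}"
  proof (rule ccontr)
    assume h: "i \<notin> {a, b, c, e}"
    then have "vol (upd x i m) a b c e = vol x a b c e" by (intro vol_upd(1)) auto
    then show False using assms h by simp
  qed
  from tuple_last[OF assms(1) this] obtain j k l where h: "{j, k, l, i} = {a, b, c, e}" "distinct [j, k, l, i]" .
  have "vol (upd x i m) j k l i = 0" using vol_perm_zero[OF h, of "upd x i m"] assms(2) by (rule iffD2)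
  then show ?thesis by (rule that[OF h])
qed

text \<open>Three kinds of targets are excluded for the segment from \<open>x $ i - P\<close>: those
  for which the quadratic of some circle has zero discriminant, so that the circle might be touched;
  those lying on a circle themselves; and those in the plane spanned by the start and
  \<open>r - P\<close> for a common point \<open>r\<close> of two circles, since
  \<open>reflect P w = r\<close> makes \<open>w\<close> parallel to \<open>r - P\<close>.\<close>

definition bad_targets :: "(real^3)^'n \<Rightarrow> 'n \<Rightarrow> real^3 \<Rightarrow> (real^3) set" where
  "bad_targets x i P =
     (\<Union>(j, k, l)\<in>{(j, k, l). distinct [j, k, l, i]}.
        {w. (2 * bf P (nrm x j k l) (nrm x j k l \<bullet> x $ j) (x $ i - P) (w - (x $ i - P)))\<^sup>2
             - 4 * qf P (nrm x j k l) (nrm x j k l \<bullet> x $ j) (x $ i - P)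
                 * qf P (nrm x j k l) (nrm x j k l \<bullet> x $ j) (w - (x $ i - P)) = 0} \<union>
        {w. qf P (nrm x j k l) (nrm x j k l \<bullet> x $ j) w = 0}) \<union>
     (\<Union>(j, k, l, j', k', l')\<in>{(j, k, l, j', k', l'). distinct [j, k, l, i] \<and> distinct [j', k', l', i] \<and> {j, k, l} \<noteq> {j', k', l'}}.
        \<Union>r\<in>{r. norm r = 1 \<and> nrm x j k l \<bullet> r = nrm x j k l \<bullet> x $ j \<and> nrm x j' k' l' \<bullet> r = nrm x j' k' l' \<bullet> x $ j'} - {P}.
          {w. cross3 (x $ i - P) (r - P) \<bullet> w = 0})"

context
  fixes x :: "(real^3)^'n" and i :: 'n and P :: "real^3"
  assumes x: "x \<in> configuration_space" and g: "general_position x" and P: "norm P = 1" and xP: "x $ i \<noteq> P"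
    and n5: "CARD('n) \<ge> 5"
begin

lemma qf_start:
  assumes d: "distinct [j, k, l, i]"
  shows "qf P (nrm x j k l) (nrm x j k l \<bullet> x $ j) (x $ i - P) \<noteq> 0"
proof -
  have "nrm x j k l \<bullet> reflect P (x $ i - P) - nrm x j k l \<bullet> x $ j = vol x j k l i"
    unfolding reflect_self[OF P conf_norm'[OF x] xP] vol_def by (simp add: inner_diff_right)
  moreover have "vol x j k l i \<noteq> 0" using g d unfolding general_position_def by blast
  ultimately show ?thesis using qf_reflect[of "x $ i - P" "nrm x j k l" P] xP by force
qed

lemma thin_bad_targets: "thin (bad_targets x i P)"
  unfolding bad_targets_def
proof (rule thin_Un)
  show "thin (\<Union>(j, k, l)\<in>{(j, k, l). distinct [j, k, l, i]}.
        {w. (2 * bf P (nrm x j k l) (nrm x j k l \<bullet> x $ j) (x $ i - P) (w - (x $ i - P)))\<^sup>2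
             - 4 * qf P (nrm x j k l) (nrm x j k l \<bullet> x $ j) (x $ i - P)
                 * qf P (nrm x j k l) (nrm x j k l \<bullet> x $ j) (w - (x $ i - P)) = 0} \<union>
        {w. qf P (nrm x j k l) (nrm x j k l \<bullet> x $ j) w = 0})"
  proof (rule thin_UN)
    fix T assume "T \<in> {(j, k, l). distinct [j, k, l, i]}"
    then obtain j k l where T: "T = (j, k, l)" "distinct [j, k, l, i]" by auto
    have d: "j \<noteq> k" "k \<noteq> l" "j \<noteq> l" using T by auto
    have nt: "\<not> (nrm x j k l = (nrm x j k l \<bullet> x $ j) *\<^sub>R P \<and> nrm x j k l \<bullet> P = nrm x j k l \<bullet> x $ j)"
      using nrm_inner(1) by (intro not_tangent[OF x d(1) P nrm_nonzero[OF x d]]) auto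
    show "thin (case T of (j, k, l) \<Rightarrow>
        {w. (2 * bf P (nrm x j k l) (nrm x j k l \<bullet> x $ j) (x $ i - P) (w - (x $ i - P)))\<^sup>2
             - 4 * qf P (nrm x j k l) (nrm x j k l \<bullet> x $ j) (x $ i - P)
                 * qf P (nrm x j k l) (nrm x j k l \<bullet> x $ j) (w - (x $ i - P)) = 0} \<union>
        {w. qf P (nrm x j k l) (nrm x j k l \<bullet> x $ j) w = 0})"
      unfolding T(1) prod.case
      by (intro thin_Un thin_disc[OF P nt qf_start[OF T(2)]] thin_qf[OF qf_start[OF T(2)]])
  qed simp
  show "thin (\<Union>(j, k, l, j', k', l')\<in>{(j, k, l, j', k', l'). distinct [j, k, l, i] \<and> distinct [j', k', l', i] \<and> {j, k, l} \<noteq> {j', k', l'}}.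
        \<Union>r\<in>{r. norm r = 1 \<and> nrm x j k l \<bullet> r = nrm x j k l \<bullet> x $ j \<and> nrm x j' k' l' \<bullet> r = nrm x j' k' l' \<bullet> x $ j'} - {P}.
          {w. cross3 (x $ i - P) (r - P) \<bullet> w = 0})"
  proof (rule thin_UN)
    fix T assume Tm: "T \<in> {(j, k, l, j', k', l'). distinct [j, k, l, i] \<and> distinct [j', k', l', i] \<and> {j, k, l} \<noteq> {j', k', l'}}"
    obtain j k l j' k' l' where T1: "T = (j, k, l, j', k', l')" by (cases T)
    have T: "T = (j, k, l, j', k', l')" "distinct [j, k, l, i]" "distinct [j', k', l', i]" "{j, k, l} \<noteq> {j', k', l'}"
      using Tm unfolding T1 mem_Collect_eq prod.case by blast+
    have d: "distinct [j, k, l]" "distinct [j', k', l']" using T by auto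
    show "thin (case T of (j, k, l, j', k', l') \<Rightarrow>
        \<Union>r\<in>{r. norm r = 1 \<and> nrm x j k l \<bullet> r = nrm x j k l \<bullet> x $ j \<and> nrm x j' k' l' \<bullet> r = nrm x j' k' l' \<bullet> x $ j'} - {P}.
          {w. cross3 (x $ i - P) (r - P) \<bullet> w = 0})"
      unfolding T(1) prod.case
    proof (rule thin_UN)
      show "finite ({r. norm r = 1 \<and> nrm x j k l \<bullet> r = nrm x j k l \<bullet> x $ j \<and> nrm x j' k' l' \<bullet> r = nrm x j' k' l' \<bullet> x $ j'} - {P})"
        using finite_plane_intersection[OF x g d T(4)] by blast
      fix r assume r: "r \<in> {r. norm r = 1 \<and> nrm x j k l \<bullet> r = nrm x j k l \<bullet> x $ j \<and> nrm x j' k' l' \<bullet> r = nrm x j' k' l' \<bullet> x $ j'} - {P}"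
      have "vol x j k l i \<noteq> 0" using g T(2) unfolding general_position_def by blast
      then have "r \<noteq> x $ i" using r by (auto simp: vol_def inner_diff_right)
      then have "cross3 (x $ i - P) (r - P) \<noteq> 0"
        using r xP P conf_norm'[OF x] by (intro cross3_sphere_nonzero) auto
      then show "thin {w. cross3 (x $ i - P) (r - P) \<bullet> w = 0}" by (rule thin_plane)
    qed
  qed simp
qed

text \<open>The condition \<open>neg\<close> keeps \<open>w\<close> nonzero along the segment and
  the moving point away from the centre of projection \<open>P\<close>.\<close>

lemma transversal_move:
  assumes M: "M \<notin> bad_targets x i P"
    and neg: "\<And>t. t \<in> {0..1} \<Longrightarrow> P \<bullet> ((x $ i - P) + t *\<^sub>R (M - (x $ i - P))) < 0"
  shows "transversal (\<lambda>t. upd x i (reflect P ((x $ i - P) + t *\<^sub>R (M - (x $ i - P))))) 0 1"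
proof -
  define w0 where "w0 = x $ i - P"
  define w where "w t = w0 + t *\<^sub>R (M - w0)" for t
  define \<gamma> where "\<gamma> t = upd x i (reflect P (w t))" for t
  define A0 where "A0 j k l = qf P (nrm x j k l) (nrm x j k l \<bullet> x $ j) w0" for j k l
  define A1 where "A1 j k l = 2 * bf P (nrm x j k l) (nrm x j k l \<bullet> x $ j) w0 (M - w0)" for j k l
  define A2 where "A2 j k l = qf P (nrm x j k l) (nrm x j k l \<bullet> x $ j) (M - w0)" for j k l
  have neg': "P \<bullet> w t < 0" if "t \<in> {0..1}" for t using neg[OF that] by (simp add: w_def w0_def)
  then have wn: "w t \<noteq> 0" if "t \<in> {0..1}" for t using that by force
  have ww: "w t \<bullet> w t > 0" if "t \<in> {0..1}" for t using wn[OF that] by simp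
  have vq: "vol (\<gamma> t) j k l i = (A0 j k l + A1 j k l * t + A2 j k l * t\<^sup>2) / (w t \<bullet> w t)"
    if t: "t \<in> {0..1}" and d: "distinct [j, k, l, i]" for t j k l
  proof -
    have "vol (\<gamma> t) j k l i = nrm x j k l \<bullet> reflect P (w t) - nrm x j k l \<bullet> x $ j"
      unfolding \<gamma>_def using d by (intro vol_upd(2)) auto
    also have "\<dots> = qf P (nrm x j k l) (nrm x j k l \<bullet> x $ j) (w t) / (w t \<bullet> w t)" by (rule qf_reflect[OF wn[OF t]])
    finally show ?thesis unfolding w_def qf_line A0_def A1_def A2_def .
  qed
  have g0: "\<gamma> 0 = x" unfolding \<gamma>_def w_def w0_def by (simp add: reflect_self[OF P conf_norm'[OF x] xP])
  have disc: "(A1 j k l)\<^sup>2 - 4 * A0 j k l * A2 j k l \<noteq> 0" and end1: "qf P (nrm x j k l) (nrm x j k l \<bullet> x $ j) M \<noteq> 0"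
    if "distinct [j, k, l, i]" for j k l
    using M that unfolding bad_targets_def A0_def A1_def A2_def w0_def by blast+
  \<comment> \<open>The moving point never lies on two circles at once: it would be one of the
    common points \<open>r\<close>, and the plane attached to \<open>r\<close> contains the start
    but not \<open>M\<close>, so it meets the segment only at time 0.\<close>
  have nc: "{j, k, l} = {j', k', l'}" if t: "t \<in> {0..1}" and d: "distinct [j, k, l, i]" "distinct [j', k', l', i]"
    and v: "vol (\<gamma> t) j k l i = 0" "vol (\<gamma> t) j' k' l' i = 0" for t j k l j' k' l'
  proof (rule ccontr)
    assume ne: "{j, k, l} \<noteq> {j', k', l'}"
    define r where "r = reflect P (w t)"
    define c where "c = 2 * (P \<bullet> w t) / (w t \<bullet> w t)"
    have c: "c \<noteq> 0" using neg'[OF t] ww[OF t] by (simp add: c_def)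
    have rP: "r - P = - c *\<^sub>R w t" by (simp add: r_def reflect_def c_def)
    then have "r \<noteq> P" using c wn[OF t] by auto
    have on: "nrm x j k l \<bullet> r = nrm x j k l \<bullet> x $ j" "nrm x j' k' l' \<bullet> r = nrm x j' k' l' \<bullet> x $ j'"
      using v d vol_upd(2)[of j i k l x r] vol_upd(2)[of j' i k' l' x r] by (auto simp: \<gamma>_def r_def)
    define n where "n = cross3 w0 (r - P)"
    have nM: "n \<bullet> M \<noteq> 0"
      using M d ne on norm_reflect[OF P] \<open>r \<noteq> P\<close> unfolding bad_targets_def n_def w0_def r_def by blast
    have nw0: "n \<bullet> w0 = 0" by (simp add: n_def dot_cross_self)
    have "n \<bullet> (r - P) = 0" by (simp add: n_def dot_cross_self)
    then have "n \<bullet> w t = 0" using c by (simp add: rP)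
    then have "t * (n \<bullet> M) = 0" using nw0 by (simp add: w_def inner_add_right inner_diff_right)
    then have "t = 0" using nM by simp
    then have "vol x j k l i = 0" using v(1) g0 by simp
    then show False using g d(1) unfolding general_position_def by blast
  qed
  have gp: "\<not> general_position (\<gamma> t) \<Longrightarrow> \<exists>j k l. distinct [j, k, l, i] \<and> vol (\<gamma> t) j k l i = 0" for t
  proof -
    assume "\<not> general_position (\<gamma> t)"
    then obtain a b c e where abce: "distinct [a, b, c, e]" "vol (\<gamma> t) a b c e = 0" unfolding general_position_def by blast
    then have "vol x a b c e \<noteq> 0" using g unfolding general_position_def by blast
    then show ?thesis using vol_upd_last[OF abce(1) abce(2)[unfolded \<gamma>_def]] unfolding \<gamma>_def by metis
  qed
  have cont: "continuous_on {0..1} \<gamma>"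
  proof -
    have cw: "continuous_on {0..1} w" unfolding w_def by (intro continuous_intros)
    have "continuous_on {0..1} (\<lambda>t. reflect P (w t))"
      unfolding reflect_def using ww by (intro continuous_intros cw) force
    then have "continuous_on {0..1} (\<lambda>t. if j = i then reflect P (w t) else x $ j)" for j
      by (cases "j = i") auto
    then show ?thesis unfolding \<gamma>_def upd_def by (intro continuous_on_vec_lambda)
  qed
  have conf: "\<gamma> t \<in> configuration_space" if t: "t \<in> {0..1}" for t
    unfolding \<gamma>_def
  proof (rule upd_conf[OF x norm_reflect[OF P]])
    fix j assume j: "j \<noteq> i"
    \<comment> \<open>A collision with the point \<open>j\<close> would put the moving point on two
      different circles through \<open>x $ j\<close>. Choosing these takes three points besides
      \<open>i\<close> and \<open>j\<close>, hence five points in all.\<close>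
    have "card (UNIV - {i, j}) \<ge> 3" using n5 j by (simp add: card_Diff_subset)
    then obtain S where S: "S \<subseteq> UNIV - {i, j}" "card S = 3" using obtain_subset_with_card_n by metis
    then obtain k l q where S': "S = {k, l, q}" "k \<noteq> l" "l \<noteq> q" "k \<noteq> q" using card_3_iff by metis
    have d: "distinct [j, k, l, i]" "distinct [j, k, q, i]" using S S' j by auto
    show "reflect P (w t) \<noteq> x $ j"
    proof
      assume h: "reflect P (w t) = x $ j"
      have "vol (\<gamma> t) j k l i = 0" "vol (\<gamma> t) j k q i = 0"
        using d vol_upd(2)[of j i k l x "x $ j"] vol_upd(2)[of j i k q x "x $ j"] unfolding \<gamma>_def h by auto
      then have "{j, k, l} = {j, k, q}" using nc[OF t d] by blast
      then show False using S' S by auto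
    qed
  qed
  have bad: "t \<in> {0<..<1}" if t: "t \<in> {0..1}" "\<not> general_position (\<gamma> t)" for t
  proof -
    obtain j k l where d: "distinct [j, k, l, i]" and v: "vol (\<gamma> t) j k l i = 0" using gp t by blast
    have "t \<noteq> 0" using t(2) g0 g by auto
    moreover have "t \<noteq> 1"
    proof
      assume "t = 1"
      have "vol (\<gamma> t) j k l i = nrm x j k l \<bullet> reflect P M - nrm x j k l \<bullet> x $ j"
        unfolding \<gamma>_def \<open>t = 1\<close> w_def using d vol_upd(2)[of j i k l x] by auto
      moreover have "M \<noteq> 0" using wn[of 1] by (simp add: w_def)
      ultimately show False using v end1[OF d] qf_reflect[of M "nrm x j k l" P "nrm x j k l \<bullet> x $ j"] by simp
    qed
    ultimately show ?thesis using t by auto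
  qed
  have fin: "finite {t \<in> {0..1}. \<not> general_position (\<gamma> t)}"
  proof (rule finite_subset)
    show "{t \<in> {0..1}. \<not> general_position (\<gamma> t)} \<subseteq>
      (\<Union>(j, k, l)\<in>{(j, k, l). distinct [j, k, l, i]}. {t. A0 j k l + A1 j k l * t + A2 j k l * t\<^sup>2 = 0})"
    proof
      fix t assume t: "t \<in> {t \<in> {0..1}. \<not> general_position (\<gamma> t)}"
      then obtain j k l where d: "distinct [j, k, l, i]" and v: "vol (\<gamma> t) j k l i = 0" using gp by blast
      then have "A0 j k l + A1 j k l * t + A2 j k l * t\<^sup>2 = 0" using vq[of t j k l] t ww[of t] by simp
      then show "t \<in> (\<Union>(j, k, l)\<in>{(j, k, l). distinct [j, k, l, i]}. {t. A0 j k l + A1 j k l * t + A2 j k l * t\<^sup>2 = 0})"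
        using d by blast
    qed
    show "finite (\<Union>(j, k, l)\<in>{(j, k, l). distinct [j, k, l, i]}. {t. A0 j k l + A1 j k l * t + A2 j k l * t\<^sup>2 = 0})"
      using qf_start by (intro finite_UN_I) (auto intro!: quadratic_zeros_finite simp: A0_def w0_def)
  qed
  have crs: "cross \<gamma> t" if t: "t \<in> {0..1}" "\<not> general_position (\<gamma> t)" for t
  proof -
    obtain j k l where d: "distinct [j, k, l, i]" and v: "vol (\<gamma> t) j k l i = 0" using gp t by blast
    have unq: "{a, b, c, e} = {j, k, l, i}" if abce: "distinct [a, b, c, e]" "vol (\<gamma> t) a b c e = 0" for a b c e
    proof -
      have "vol x a b c e \<noteq> 0" using g abce(1) unfolding general_position_def by blast
      then obtain j' k' l' where j': "{j', k', l', i} = {a, b, c, e}" "distinct [j', k', l', i]" "vol (\<gamma> t) j' k' l' i = 0"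
        using vol_upd_last[OF abce(1) abce(2)[unfolded \<gamma>_def]] unfolding \<gamma>_def by metis
      have "{j', k', l'} = {j, k, l}" using nc[OF t(1) j'(2) d j'(3) v] .
      then have "{j', k', l', i} = {j, k, l, i}" by blast
      then show ?thesis using j'(1) by simp
    qed
    have root: "A0 j k l + A1 j k l * t + A2 j k l * t\<^sup>2 = 0" using vq[OF t(1) d] v ww[OF t(1)] by simp
    obtain \<epsilon> where eps: "\<epsilon> > 0" "\<And>s s'. t - \<epsilon> < s \<Longrightarrow> s < t \<Longrightarrow> t < s' \<Longrightarrow> s' < t + \<epsilon> \<Longrightarrow>
       (A0 j k l + A1 j k l * s + A2 j k l * s\<^sup>2) * (A0 j k l + A1 j k l * s' + A2 j k l * s'\<^sup>2) < 0"
      using quadratic_sign_change[OF root disc[OF d]] by blast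
    define \<eta> where "\<eta> = min \<epsilon> (min t (1 - t))"
    have \<eta>: "\<eta> > 0" "\<eta> \<le> \<epsilon>" "\<eta> \<le> t" "\<eta> \<le> 1 - t" using eps(1) bad[OF t] by (auto simp: \<eta>_def)
    have "vol (\<gamma> s) j k l i * vol (\<gamma> s') j k l i < 0"
      if h: "t - \<eta> < s" "s < t" "t < s'" "s' < t + \<eta>" for s s'
    proof -
      have s: "s \<in> {0..1}" "s' \<in> {0..1}" using h \<eta> by auto
      have "(A0 j k l + A1 j k l * s + A2 j k l * s\<^sup>2) * (A0 j k l + A1 j k l * s' + A2 j k l * s'\<^sup>2) < 0"
        using h \<eta>(2) by (intro eps(2)) auto
      then have "((A0 j k l + A1 j k l * s + A2 j k l * s\<^sup>2) * (A0 j k l + A1 j k l * s' + A2 j k l * s'\<^sup>2))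
         / ((w s \<bullet> w s) * (w s' \<bullet> w s')) < 0"
        using ww[OF s(1)] ww[OF s(2)] by (intro divide_neg_pos mult_pos_pos)
      then show ?thesis unfolding vq[OF s(1) d] vq[OF s(2) d] by simp
    qed
    then show ?thesis unfolding cross_def using d unq \<eta>(1) by metis
  qed
  have "general_position (\<gamma> 1)" using bad[of 1] by auto
  moreover have "general_position (\<gamma> 0)" using g g0 by simp
  moreover have "\<gamma> ` {0..1} \<subseteq> configuration_space" using conf by blast
  ultimately have "transversal \<gamma> 0 1" unfolding transversal_def using cont fin crs by blast
  then show ?thesis unfolding \<gamma>_def w_def w0_def .
qed

end

section \<open>Connecting nearby configurations\<close>

text \<open>With the antipode of \<open>q\<close> as centre of projection, \<open>q\<close> has the
  coordinate vector \<open>q - (- q) = 2 *\<^sub>R q\<close>; the rest is continuity there.\<close>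

lemma reflect_local:
  fixes q :: "real^3"
  assumes q: "norm q = 1" and r: "r > 0"
  shows "\<exists>\<delta>>0. \<forall>w\<in>ball (2 *\<^sub>R q) \<delta>. dist (reflect (- q) w) q < r \<and> - q \<bullet> w < 0"
proof -
  have qq: "q \<bullet> q = 1" using q by (simp add: dot_square_norm)
  have c: "isCont (reflect (- q)) (2 *\<^sub>R q)" unfolding reflect_def using qq by (intro continuous_intros) auto
  have v: "reflect (- q) (2 *\<^sub>R q) = q" unfolding reflect_def using qq by (simp add: algebra_simps flip: scaleR_2)
  obtain d where d: "d > 0" "\<And>w. dist w (2 *\<^sub>R q) < d \<Longrightarrow> dist (reflect (- q) w) q < r"
    using c r unfolding continuous_at_eps_delta v by blast
  have "- q \<bullet> w < 0" if "dist w (2 *\<^sub>R q) < 1" for w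
  proof -
    have "\<bar>q \<bullet> (w - 2 *\<^sub>R q)\<bar> \<le> norm q * norm (w - 2 *\<^sub>R q)" by (rule Cauchy_Schwarz_ineq2)
    then have "\<bar>q \<bullet> w - 2\<bar> < 1" using that q qq by (simp add: dist_norm inner_diff_right)
    then show ?thesis by simp
  qed
  then show ?thesis using d by (intro exI[of _ "min d 1"]) (auto simp: dist_commute)
qed

lemma thin_ball:
  fixes S :: "'a::metric_space set"
  assumes "thin S" "\<delta> > 0" shows "\<exists>w\<in>ball a \<delta>. w \<notin> S"
proof (rule ccontr)
  assume "\<not> ?thesis"
  then have "ball a \<delta> \<subseteq> S" by blast
  then have "ball a \<delta> \<subseteq> interior S" by (intro interior_maximal) auto
  then show False using assms by (auto simp: thin_def)
qed

text \<open>A single target \<open>M\<close>, outside the exceptional sets of both configurations,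
  moves the points with index \<open>i\<close> of \<open>x\<close> and \<open>y\<close> to the same
  place. The radius depends only on \<open>q\<close> and \<open>r\<close>, not on the other
  points.\<close>

lemma one_move:
  fixes z :: "(real^3)^'n"
  assumes q: "norm q = 1" and r: "r > 0" and n5: "CARD('n) \<ge> 5"
  shows "\<exists>\<delta>>0. \<forall>x y :: (real^3)^'n. x \<in> configuration_space \<longrightarrow> y \<in> configuration_space \<longrightarrow>
     general_position x \<longrightarrow> general_position y \<longrightarrow> dist (x $ i) q < \<delta> \<longrightarrow> dist (y $ i) q < \<delta> \<longrightarrow>
     (\<exists>m c c'. transversal (\<lambda>t. upd x i (c t)) 0 1 \<and> transversal (\<lambda>t. upd y i (c' t)) 0 1 \<and>
        c 0 = x $ i \<and> c' 0 = y $ i \<and> c 1 = m \<and> c' 1 = m \<and>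
        (\<forall>t\<in>{0..1}. dist (c t) q < r \<and> dist (c' t) q < r))"
proof -
  obtain \<delta> where \<delta>: "\<delta> > 0" "\<And>w. w \<in> ball (2 *\<^sub>R q) \<delta> \<Longrightarrow> dist (reflect (- q) w) q < r \<and> - q \<bullet> w < 0"
    using reflect_local[OF q r] by blast
  have P: "norm (- q) = 1" using q by simp
  show ?thesis
  proof (intro exI[of _ \<delta>] conjI allI impI \<delta>(1))
    fix x y :: "(real^3)^'n"
    assume C: "x \<in> configuration_space" "y \<in> configuration_space" and g: "general_position x" "general_position y"
      and d: "dist (x $ i) q < \<delta>" "dist (y $ i) q < \<delta>"
    have b: "x $ i - (- q) \<in> ball (2 *\<^sub>R q) \<delta>" "y $ i - (- q) \<in> ball (2 *\<^sub>R q) \<delta>"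
      using d by (simp_all add: dist_norm scaleR_2 norm_minus_commute)
    have ne: "x $ i \<noteq> - q" "y $ i \<noteq> - q" using \<delta>(2)[OF b(1)] \<delta>(2)[OF b(2)] by auto
    have "thin (bad_targets x i (- q) \<union> bad_targets y i (- q))"
      by (intro thin_Un thin_bad_targets[OF C(1) g(1) P ne(1) n5] thin_bad_targets[OF C(2) g(2) P ne(2) n5])
    from thin_ball[OF this \<delta>(1)] obtain M where M: "M \<in> ball (2 *\<^sub>R q) \<delta>" "M \<notin> bad_targets x i (- q)" "M \<notin> bad_targets y i (- q)" by blast
    have seg: "w + t *\<^sub>R (M - w) \<in> ball (2 *\<^sub>R q) \<delta>" if "w \<in> ball (2 *\<^sub>R q) \<delta>" "t \<in> {0..1}" for w t
    proof -
      have "(1 - t) *\<^sub>R w + t *\<^sub>R M \<in> ball (2 *\<^sub>R q) \<delta>"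
        using that M(1) by (intro convexD[OF convex_ball]) auto
      then show ?thesis by (simp add: algebra_simps)
    qed
    define c where "c z t = reflect (- q) ((z $ i - (- q)) + t *\<^sub>R (M - (z $ i - (- q))))" for z :: "(real^3)^'n" and t
    have "transversal (\<lambda>t. upd x i (c x t)) 0 1" unfolding c_def
      using seg[OF b(1)] \<delta>(2) by (intro transversal_move[OF C(1) g(1) P ne(1) n5 M(2)]) blast
    moreover have "transversal (\<lambda>t. upd y i (c y t)) 0 1" unfolding c_def
      using seg[OF b(2)] \<delta>(2) by (intro transversal_move[OF C(2) g(2) P ne(2) n5 M(3)]) blast
    moreover have "c x 0 = x $ i" "c y 0 = y $ i"
      unfolding c_def using reflect_self[OF P conf_norm'[OF C(1)] ne(1)] reflect_self[OF P conf_norm'[OF C(2)] ne(2)] by simp_all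
    moreover have "c x 1 = reflect (- q) M" "c y 1 = reflect (- q) M" unfolding c_def by simp_all
    moreover have "dist (c x t) q < r \<and> dist (c y t) q < r" if "t \<in> {0..1}" for t
      unfolding c_def using \<delta>(2)[OF seg[OF b(1) that]] \<delta>(2)[OF seg[OF b(2) that]] by blast
    ultimately show "\<exists>m c c'. transversal (\<lambda>t. upd x i (c t)) 0 1 \<and> transversal (\<lambda>t. upd y i (c' t)) 0 1 \<and>
        c 0 = x $ i \<and> c' 0 = y $ i \<and> c 1 = m \<and> c' 1 = m \<and>
        (\<forall>t\<in>{0..1}. dist (c t) q < r \<and> dist (c' t) q < r)" by blast
  qed
qed

definition connectable :: "(real^3)^'n \<Rightarrow> real \<Rightarrow> (real^3)^'n \<Rightarrow> (real^3)^'n \<Rightarrow> bool" where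
  "connectable z r a b \<longleftrightarrow> (\<exists>\<gamma>. transversal \<gamma> 0 1 \<and> \<gamma> 0 = a \<and> \<gamma> 1 = b \<and> (\<forall>t\<in>{0..1}. \<forall>i. dist (\<gamma> t $ i) (z $ i) < r))"

lemma connectable_refl:
  assumes "a \<in> configuration_space" "general_position a" "\<And>i. dist (a $ i) (z $ i) < r"
  shows "connectable z r a a"
  unfolding connectable_def transversal_def using assms by (intro exI[of _ "\<lambda>_. a"]) auto

lemma connectable_sym: "connectable z r a b \<Longrightarrow> connectable z r b a"
  unfolding connectable_def by (elim exE conjE) (rule exI, rule conjI, erule transversal_reverse, auto)

lemma connectable_trans:
  assumes "connectable z r a b" "connectable z r b c" shows "connectable z r a c"
proof -
  obtain \<gamma>1 where 1: "transversal \<gamma>1 0 1" "\<gamma>1 0 = a" "\<gamma>1 1 = b" "\<And>t i. t \<in> {0..1} \<Longrightarrow> dist (\<gamma>1 t $ i) (z $ i) < r"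
    using assms(1) unfolding connectable_def by blast
  obtain \<gamma>2 where 2: "transversal \<gamma>2 0 1" "\<gamma>2 0 = b" "\<gamma>2 1 = c" "\<And>t i. t \<in> {0..1} \<Longrightarrow> dist (\<gamma>2 t $ i) (z $ i) < r"
    using assms(2) unfolding connectable_def by blast
  define \<gamma> where "\<gamma> = (\<lambda>t. if t \<le> 1/2 then \<gamma>1 ((t - 0) / (1/2 - 0)) else \<gamma>2 ((t - 1/2) / (1 - 1/2)))"
  have "transversal \<gamma> 0 1" unfolding \<gamma>_def
    using 1 2 by (intro transversal_join transversal_rescale) auto
  moreover have "\<gamma> 0 = a" "\<gamma> 1 = c" using 1 2 by (auto simp: \<gamma>_def)
  moreover have "dist (\<gamma> t $ i) (z $ i) < r" if "t \<in> {0..1}" for t i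
    using that 1(4)[of "t * 2" i] 2(4)[of "t * 2 - 1" i] by (auto simp: \<gamma>_def algebra_simps)
  ultimately show ?thesis unfolding connectable_def by blast
qed

lemma connectable_facts:
  assumes "connectable z r a b"
  shows "b \<in> configuration_space" "general_position b" "dist (b $ i) (z $ i) < r"
  using assms unfolding connectable_def transversal_def by (fastforce simp: image_subset_iff)+

text \<open>Both configurations are deformed until they coincide; the set \<open>S\<close> in the
  induction collects the points already brought together.\<close>

lemma connect_nearby:
  fixes z :: "(real^3)^'n"
  assumes z: "z \<in> configuration_space" and r: "r > 0" and n5: "CARD('n) \<ge> 5"
  shows "\<exists>\<delta>>0. \<forall>x y. x \<in> configuration_space \<longrightarrow> y \<in> configuration_space \<longrightarrow> general_position x \<longrightarrow> general_position y \<longrightarrow>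
    (\<forall>i. dist (x $ i) (z $ i) < \<delta> \<and> dist (y $ i) (z $ i) < \<delta>) \<longrightarrow> connectable z r x y"
proof -
  define Q where "Q i x y \<longleftrightarrow> (\<exists>m c c'. transversal (\<lambda>t. upd x i (c t)) 0 1 \<and> transversal (\<lambda>t. upd y i (c' t)) 0 1 \<and>
        c 0 = x $ i \<and> c' 0 = y $ i \<and> c 1 = m \<and> c' 1 = m \<and>
        (\<forall>t\<in>{0..1}. dist (c t) (z $ i) < r \<and> dist (c' t) (z $ i) < r))" for i and x y :: "(real^3)^'n"
  define R where "R i \<delta> \<longleftrightarrow> \<delta> > 0 \<and> (\<forall>x y. x \<in> configuration_space \<longrightarrow> y \<in> configuration_space \<longrightarrow>
     general_position x \<longrightarrow> general_position y \<longrightarrow> dist (x $ i) (z $ i) < \<delta> \<longrightarrow> dist (y $ i) (z $ i) < \<delta> \<longrightarrow> Q i x y)"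
    for i \<delta>
  have "\<forall>i. \<exists>\<delta>. R i \<delta>"
    unfolding R_def Q_def using one_move[OF conf_norm'[OF z] r n5] by blast
  then obtain D where "\<forall>i. R i (D i)" by metis
  then have D: "\<And>i. D i > 0" "\<And>i x y. x \<in> configuration_space \<Longrightarrow> y \<in> configuration_space \<Longrightarrow>
     general_position x \<Longrightarrow> general_position y \<Longrightarrow> dist (x $ i) (z $ i) < D i \<Longrightarrow> dist (y $ i) (z $ i) < D i \<Longrightarrow> Q i x y"
    unfolding R_def by blast+
  define \<delta> where "\<delta> = min r (Min (range D))"
  have \<delta>: "\<delta> > 0" "\<delta> \<le> r" "\<And>i. \<delta> \<le> D i" using D(1) r by (auto simp: \<delta>_def min_le_iff_disj)
  have "connectable z r x y" if C: "x \<in> configuration_space" "y \<in> configuration_space" and g: "general_position x" "general_position y"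
    and nr: "\<And>i. dist (x $ i) (z $ i) < \<delta> \<and> dist (y $ i) (z $ i) < \<delta>" for x y
  proof -
    have nr': "dist (x $ i) (z $ i) < r" "dist (y $ i) (z $ i) < r" "dist (x $ i) (z $ i) < D i" "dist (y $ i) (z $ i) < D i" for i
      using nr[of i] \<delta>(2) \<delta>(3)[of i] by auto
    have "\<exists>x' y'. connectable z r x x' \<and> connectable z r y y' \<and> (\<forall>i\<in>S. x' $ i = y' $ i) \<and> (\<forall>i. i \<notin> S \<longrightarrow> x' $ i = x $ i \<and> y' $ i = y $ i)"
      if "finite S" for S
      using that
    proof (induction S rule: finite_induct)
      case empty
      show ?case using connectable_refl[OF C(1) g(1) nr'(1)] connectable_refl[OF C(2) g(2) nr'(2)] by blast
    next
      case (insert i S)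
      then obtain x' y' where xy: "connectable z r x x'" "connectable z r y y'" "\<forall>i\<in>S. x' $ i = y' $ i"
        "\<forall>i. i \<notin> S \<longrightarrow> x' $ i = x $ i \<and> y' $ i = y $ i" by blast
      have i: "x' $ i = x $ i" "y' $ i = y $ i" using xy(4) insert by blast+
      have "Q i x' y'"
        using nr'(3,4) by (intro D(2) connectable_facts[OF xy(1)] connectable_facts[OF xy(2)]) (simp_all add: i)
      then obtain m c c' where mc: "transversal (\<lambda>t. upd x' i (c t)) 0 1" "transversal (\<lambda>t. upd y' i (c' t)) 0 1"
        "c 0 = x' $ i" "c' 0 = y' $ i" "c 1 = m" "c' 1 = m"
        "\<And>t. t \<in> {0..1} \<Longrightarrow> dist (c t) (z $ i) < r \<and> dist (c' t) (z $ i) < r"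
        unfolding Q_def by blast
      have "connectable z r x' (upd x' i m)" unfolding connectable_def
      proof (intro exI[of _ "\<lambda>t. upd x' i (c t)"] conjI ballI allI)
        fix t :: real and j assume "t \<in> {0..1}"
        then show "dist (upd x' i (c t) $ j) (z $ j) < r" using mc(7) connectable_facts(3)[OF xy(1)] by (cases "j = i") auto
      qed (use mc in auto)
      moreover have "connectable z r y' (upd y' i m)" unfolding connectable_def
      proof (intro exI[of _ "\<lambda>t. upd y' i (c' t)"] conjI ballI allI)
        fix t :: real and j assume "t \<in> {0..1}"
        then show "dist (upd y' i (c' t) $ j) (z $ j) < r" using mc(7) connectable_facts(3)[OF xy(2)] by (cases "j = i") auto
      qed (use mc in auto)
      ultimately have "connectable z r x (upd x' i m)" "connectable z r y (upd y' i m)" using connectable_trans xy(1,2) by blast+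
      moreover have "\<forall>j\<in>insert i S. upd x' i m $ j = upd y' i m $ j" using xy(3) by (auto simp: upd_def)
      moreover have "\<forall>j. j \<notin> insert i S \<longrightarrow> upd x' i m $ j = x $ j \<and> upd y' i m $ j = y $ j" using xy(4) by (auto simp: upd_def)
      ultimately show ?case by blast
    qed
    from this[of UNIV] obtain x' y' where xy: "connectable z r x x'" "connectable z r y y'" "\<forall>i. x' $ i = y' $ i" by auto
    have "x' = y'" using xy(3) vec_eq_iff by blast
    then show ?thesis using connectable_trans[OF xy(1)] connectable_sym[OF xy(2)] by simp
  qed
  then show ?thesis using \<delta>(1) by blast
qed

text \<open>Points are perturbed one at a time. Quadruples not contained in \<open>S\<close> may
  still be degenerate, so the existence of a good target rests on \<open>qf_nonzero_ex\<close> and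
  not on the starting position.\<close>

lemma general_position_dense:
  fixes z :: "(real^3)^'n"
  assumes z: "z \<in> configuration_space" and r: "r > 0"
  shows "\<exists>x\<in>configuration_space. general_position x \<and> (\<forall>i. dist (x $ i) (z $ i) < r)"
proof -
  have "\<exists>x\<in>configuration_space. (\<forall>i. dist (x $ i) (z $ i) < r) \<and> (\<forall>i. i \<notin> S \<longrightarrow> x $ i = z $ i) \<and>
     (\<forall>a b c e. distinct [a, b, c, e] \<longrightarrow> {a, b, c, e} \<subseteq> S \<longrightarrow> vol x a b c e \<noteq> 0)" if "finite S" for S
    using that
  proof (induction S rule: finite_induct)
    case empty
    show ?case using z r by (intro bexI[of _ z]) auto
  next
    case (insert i S)
    then obtain x where x: "x \<in> configuration_space" "\<And>i. dist (x $ i) (z $ i) < r" "\<And>i. i \<notin> S \<Longrightarrow> x $ i = z $ i"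
     "\<And>a b c e. distinct [a, b, c, e] \<Longrightarrow> {a, b, c, e} \<subseteq> S \<Longrightarrow> vol x a b c e \<noteq> 0" by blast
    define q where "q = z $ i"
    have q: "norm q = 1" using conf_norm'[OF z] by (simp add: q_def)
    have xi: "x $ i = q" using x(3) insert by (simp add: q_def)
    \<comment> \<open>This radius also keeps the new position away from all other points.\<close>
    define \<rho> where "\<rho> = Min (insert r ((\<lambda>j. dist (x $ j) q) ` (UNIV - {i})))"
    have \<rho>: "\<rho> > 0" "\<rho> \<le> r" "\<And>j. j \<noteq> i \<Longrightarrow> \<rho> \<le> dist (x $ j) q"
      using r conf_inj[OF x(1), of _ i] xi by (auto simp: \<rho>_def)
    obtain \<delta> where \<delta>: "\<delta> > 0" "\<And>w. w \<in> ball (2 *\<^sub>R q) \<delta> \<Longrightarrow> dist (reflect (- q) w) q < \<rho> \<and> - q \<bullet> w < 0"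
      using reflect_local[OF q \<rho>(1)] by blast
    define B where "B = (\<Union>(j, k, l)\<in>{(j, k, l). distinct [j, k, l, i]}. {w. qf (- q) (nrm x j k l) (nrm x j k l \<bullet> x $ j) w = 0})"
    have "thin B" unfolding B_def
    proof (rule thin_UN)
      fix T assume "T \<in> {(j, k, l). distinct [j, k, l, i]}"
      then obtain j k l where T: "T = (j, k, l)" "distinct [j, k, l, i]" by auto
      have d: "j \<noteq> k" "k \<noteq> l" "j \<noteq> l" using T by auto
      have P: "norm (- q) = 1" using q by simp
      have "\<not> (nrm x j k l = (nrm x j k l \<bullet> x $ j) *\<^sub>R (- q) \<and> nrm x j k l \<bullet> (- q) = nrm x j k l \<bullet> x $ j)"
        by (rule not_tangent[OF x(1) d(1) P nrm_nonzero[OF x(1) d] refl nrm_inner(1)])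
      then obtain v where "qf (- q) (nrm x j k l) (nrm x j k l \<bullet> x $ j) v \<noteq> 0" using qf_nonzero_ex[OF P] by blast
      then show "thin (case T of (j, k, l) \<Rightarrow> {w. qf (- q) (nrm x j k l) (nrm x j k l \<bullet> x $ j) w = 0})"
        unfolding T(1) prod.case by (rule thin_qf)
    qed simp
    from thin_ball[OF this \<delta>(1)] obtain M where M: "M \<in> ball (2 *\<^sub>R q) \<delta>" "M \<notin> B" by blast
    define m where "m = reflect (- q) M"
    have M0: "M \<noteq> 0" using \<delta>(2)[OF M(1)] by auto
    have m: "dist m q < \<rho>" "norm m = 1" using \<delta>(2)[OF M(1)] norm_reflect[of "- q"] q by (auto simp: m_def)
    have mj: "m \<noteq> x $ j" if "j \<noteq> i" for j using \<rho>(3)[OF that] m(1) by auto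
    have vm: "vol (upd x i m) j k l i \<noteq> 0" if d: "distinct [j, k, l, i]" for j k l
    proof -
      have "vol (upd x i m) j k l i = nrm x j k l \<bullet> m - nrm x j k l \<bullet> x $ j" using d by (intro vol_upd(2)) auto
      also have "\<dots> = qf (- q) (nrm x j k l) (nrm x j k l \<bullet> x $ j) M / (M \<bullet> M)" unfolding m_def by (rule qf_reflect[OF M0])
      finally show ?thesis using M(2) d M0 unfolding B_def by auto
    qed
    show ?case
    proof (intro bexI[of _ "upd x i m"] conjI allI impI)
      show "upd x i m \<in> configuration_space" using upd_conf[OF x(1) m(2) mj] .
      show "dist (upd x i m $ j) (z $ j) < r" for j using x(2)[of j] m(1) \<rho>(2) by (cases "j = i") (auto simp: q_def)
      show "upd x i m $ j = z $ j" if "j \<notin> insert i S" for j using that x(3) by auto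
      fix a b c e assume d: "distinct [a, b, c, e]" and S: "{a, b, c, e} \<subseteq> insert i S"
      show "vol (upd x i m) a b c e \<noteq> 0"
      proof
        assume v: "vol (upd x i m) a b c e = 0"
        have "vol x a b c e \<noteq> 0" if "i \<notin> {a, b, c, e}" using x(4)[OF d] S that by blast
        then show False using vol_upd_last[OF d v] vm by metis
      qed
    qed
  qed
  from this[of UNIV] show ?thesis unfolding general_position_def by auto
qed

section \<open>Density of generic braids\<close>

lemma dist_config_le:
  assumes "\<And>i. dist (x $ i) (z $ i) \<le> r"
  shows "dist x (z :: (real^3)^'n) \<le> real CARD('n) * r"
proof -
  have "dist x z \<le> (\<Sum>i\<in>UNIV. dist (x $ i) (z $ i))"
    unfolding dist_vec_def by (rule L2_set_le_sum) auto
  also have "\<dots> \<le> real CARD('n) * r" using sum_bounded_above[of UNIV "\<lambda>i. dist (x $ i) (z $ i)" r] assms by simp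
  finally show ?thesis .
qed

lemma connect_ball:
  fixes z :: "(real^3)^'n"
  assumes z: "z \<in> configuration_space" and e: "\<epsilon> > 0" and n5: "CARD('n) \<ge> 5"
  shows "\<exists>\<delta>>0. \<forall>x y. x \<in> configuration_space \<longrightarrow> y \<in> configuration_space \<longrightarrow> general_position x \<longrightarrow> general_position y \<longrightarrow>
    dist x z < \<delta> \<longrightarrow> dist y z < \<delta> \<longrightarrow> (\<exists>\<eta>. transversal \<eta> 0 1 \<and> \<eta> 0 = x \<and> \<eta> 1 = y \<and> (\<forall>t\<in>{0..1}. dist (\<eta> t) z < \<epsilon>))"
proof -
  define r where "r = \<epsilon> / (2 * real CARD('n))"
  have r: "r > 0" "real CARD('n) * r < \<epsilon>" using e by (auto simp: r_def)
  obtain \<delta> where \<delta>: "\<delta> > 0" "\<forall>x y. x \<in> configuration_space \<longrightarrow> y \<in> configuration_space \<longrightarrow> general_position x \<longrightarrow> general_position y \<longrightarrow>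
    (\<forall>i. dist (x $ i) (z $ i) < \<delta> \<and> dist (y $ i) (z $ i) < \<delta>) \<longrightarrow> connectable z r x y"
    using connect_nearby[OF z r(1) n5] by blast
  have "\<exists>\<eta>. transversal \<eta> 0 1 \<and> \<eta> 0 = x \<and> \<eta> 1 = y \<and> (\<forall>t\<in>{0..1}. dist (\<eta> t) z < \<epsilon>)"
    if xy: "x \<in> configuration_space" "y \<in> configuration_space" "general_position x" "general_position y"
      "dist x z < \<delta>" "dist y z < \<delta>" for x y
  proof -
    have "dist (x $ i) (z $ i) < \<delta> \<and> dist (y $ i) (z $ i) < \<delta>" for i
      using dist_vec_nth_le[of x i z] dist_vec_nth_le[of y i z] xy by linarith
    then have "connectable z r x y" using \<delta>(2) xy by blast
    then obtain \<eta> where h: "transversal \<eta> 0 1" "\<eta> 0 = x" "\<eta> 1 = y" "\<forall>t\<in>{0..1}. \<forall>i. dist (\<eta> t $ i) (z $ i) < r"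
      unfolding connectable_def by blast
    have "dist (\<eta> t) z < \<epsilon>" if "t \<in> {0..1}" for t
      using dist_config_le[of "\<eta> t" z r] h(4) that r(2) by (meson less_imp_le order_le_less_trans)
    then show ?thesis using h by blast
  qed
  then show ?thesis using \<delta>(1) by blast
qed

lemma general_position_near:
  fixes z :: "(real^3)^'n"
  assumes z: "z \<in> configuration_space" and e: "\<epsilon> > 0"
  shows "\<exists>x\<in>configuration_space. general_position x \<and> dist x z < \<epsilon>"
proof -
  define r where "r = \<epsilon> / (2 * real CARD('n))"
  have r: "r > 0" "real CARD('n) * r < \<epsilon>" using e by (auto simp: r_def)
  obtain x where x: "x \<in> configuration_space" "general_position x" "\<forall>i. dist (x $ i) (z $ i) < r"
    using general_position_dense[OF z r(1)] by blast
  then have "dist x z < \<epsilon>" using dist_config_le[of x z r] r(2) by (meson less_imp_le order_le_less_trans)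
  then show ?thesis using x by blast
qed

lemma path_local:
  fixes \<gamma> :: "real \<Rightarrow> 'a::metric_space"
  assumes "path \<gamma>" "t \<in> {0..1}" "e > 0"
  obtains d where "d > 0" "\<And>s. s \<in> {0..1} \<Longrightarrow> \<bar>s - t\<bar> < d \<Longrightarrow> dist (\<gamma> s) (\<gamma> t) < e"
  using assms unfolding path_def continuous_on_iff dist_real_def by blast

text \<open>\<open>P a b\<close> quantifies over all endpoints in general position close to
  \<open>\<gamma> a\<close> and \<open>\<gamma> b\<close>, so that adjacent pieces can be made to
  meet in a common intermediate configuration.\<close>

lemma transversal_path_dense:
  fixes \<gamma> :: "real \<Rightarrow> (real^3)^'n"
  assumes g: "path \<gamma>" "path_image \<gamma> \<subseteq> configuration_space" and e: "\<epsilon> > 0" and n5: "CARD('n) \<ge> 5"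
    and ge: "general_position (\<gamma> 0)" "general_position (\<gamma> 1)"
  shows "\<exists>\<beta>. transversal \<beta> 0 1 \<and> \<beta> 0 = \<gamma> 0 \<and> \<beta> 1 = \<gamma> 1 \<and> (\<forall>t\<in>{0..1}. dist (\<beta> t) (\<gamma> t) < \<epsilon>)"
proof -
  have C: "\<gamma> t \<in> configuration_space" if "t \<in> {0..1}" for t using path_conf[OF g(2) that] .
  define W where "W \<delta> a x \<longleftrightarrow> x \<in> configuration_space \<and> general_position x \<and> dist x (\<gamma> a) < \<delta>" for \<delta> a x
  define G where "G a b x y \<longleftrightarrow> (\<exists>\<beta>. transversal \<beta> a b \<and> \<beta> a = x \<and> \<beta> b = y \<and> (\<forall>t\<in>{a..b}. dist (\<beta> t) (\<gamma> t) < \<epsilon>))" for a b x y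
  define P where "P a b \<longleftrightarrow> (0 \<le> a \<longrightarrow> b \<le> 1 \<longrightarrow> a < b \<longrightarrow> (\<exists>\<delta>>0. \<forall>x y. W \<delta> a x \<longrightarrow> W \<delta> b y \<longrightarrow> G a b x y))" for a b
  have "P 0 1"
  proof (rule Bolzano)
    show "(0::real) \<le> 1" by simp
    fix a b c assume ab: "P a b" and bc: "P b c" and le: "a \<le> b" "b \<le> c"
    show "P a c"
    proof (cases "a = b \<or> b = c")
      case True then show ?thesis using ab bc by auto
    next
      case False
      then have lt: "a < b" "b < c" using le by auto
      show ?thesis unfolding P_def
      proof (intro impI)
        assume h: "0 \<le> a" "c \<le> 1" "a < c"
        obtain d1 where d1: "d1 > 0" "\<And>x y. W d1 a x \<Longrightarrow> W d1 b y \<Longrightarrow> G a b x y" using ab h lt unfolding P_def by auto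
        obtain d2 where d2: "d2 > 0" "\<And>x y. W d2 b x \<Longrightarrow> W d2 c y \<Longrightarrow> G b c x y" using bc h lt unfolding P_def by auto
        have b01: "b \<in> {0..1}" using h lt by auto
        have "min d1 d2 > 0" using d1 d2 by simp
        from general_position_near[OF C[OF b01] this] obtain w where w: "W d1 b w" "W d2 b w" unfolding W_def by auto
        have "G a c x y" if xy: "W (min d1 d2) a x" "W (min d1 d2) c y" for x y
        proof -
          have "W d1 a x" "W d2 c y" using xy unfolding W_def by auto
          then have "G a b x w" "G b c w y" using d1(2) d2(2) w by blast+
          then obtain \<beta>1 \<beta>2 where 1: "transversal \<beta>1 a b" "\<beta>1 a = x" "\<beta>1 b = w" "\<And>t. t \<in> {a..b} \<Longrightarrow> dist (\<beta>1 t) (\<gamma> t) < \<epsilon>"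
            and 2: "transversal \<beta>2 b c" "\<beta>2 b = w" "\<beta>2 c = y" "\<And>t. t \<in> {b..c} \<Longrightarrow> dist (\<beta>2 t) (\<gamma> t) < \<epsilon>"
            unfolding G_def by blast
          define \<beta> where "\<beta> = (\<lambda>t. if t \<le> b then \<beta>1 t else \<beta>2 t)"
          have "transversal \<beta> a c" unfolding \<beta>_def using 1 2 le by (intro transversal_join) auto
          moreover have "\<beta> a = x" "\<beta> c = y" using 1 2 lt by (auto simp: \<beta>_def)
          moreover have "dist (\<beta> t) (\<gamma> t) < \<epsilon>" if "t \<in> {a..c}" for t using that 1(4)[of t] 2(4)[of t] by (auto simp: \<beta>_def)
          ultimately show ?thesis unfolding G_def by blast
        qed
        then show "\<exists>\<delta>>0. \<forall>x y. W \<delta> a x \<longrightarrow> W \<delta> c y \<longrightarrow> G a c x y" using \<open>min d1 d2 > 0\<close> by blast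
      qed
    qed
  next
    fix x0 :: real assume x0: "0 \<le> x0" "x0 \<le> 1"
    define z where "z = \<gamma> x0"
    have x01: "x0 \<in> {0..1}" using x0 by simp
    have z: "z \<in> configuration_space" using C[OF x01] by (simp add: z_def)
    have e2: "\<epsilon> / 2 > 0" using e by simp
    obtain \<delta> where \<delta>: "\<delta> > 0" "\<And>x y. x \<in> configuration_space \<Longrightarrow> y \<in> configuration_space \<Longrightarrow> general_position x \<Longrightarrow> general_position y \<Longrightarrow>
      dist x z < \<delta> \<Longrightarrow> dist y z < \<delta> \<Longrightarrow> \<exists>\<eta>. transversal \<eta> 0 1 \<and> \<eta> 0 = x \<and> \<eta> 1 = y \<and> (\<forall>t\<in>{0..1}. dist (\<eta> t) z < \<epsilon> / 2)"
      using connect_ball[OF z e2 n5] by blast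
    have m: "min (\<delta> / 2) (\<epsilon> / 2) > 0" using \<delta> e by simp
    obtain d where d: "d > 0" "\<And>s. s \<in> {0..1} \<Longrightarrow> \<bar>s - x0\<bar> < d \<Longrightarrow> dist (\<gamma> s) z < min (\<delta> / 2) (\<epsilon> / 2)"
      using path_local[OF g(1) x01 m] unfolding z_def by blast
    have "P a b" if ab: "a \<le> x0" "x0 \<le> b" "b - a < d" for a b
      unfolding P_def
    proof (intro impI exI[of _ "\<delta> / 2"] conjI allI)
      show "\<delta> / 2 > 0" using \<delta> by simp
      assume h: "0 \<le> a" "b \<le> 1" "a < b"
      have cl: "dist (\<gamma> s) z < min (\<delta> / 2) (\<epsilon> / 2)" if "s \<in> {a..b}" for s using that h ab by (intro d(2)) auto
      fix x y assume xy: "W (\<delta> / 2) a x" "W (\<delta> / 2) b y"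
      have "dist x z < \<delta>" using xy(1) cl[of a] h dist_triangle[of x z "\<gamma> a"] unfolding W_def by auto
      moreover have "dist y z < \<delta>" using xy(2) cl[of b] h dist_triangle[of y z "\<gamma> b"] unfolding W_def by auto
      ultimately obtain \<eta> where \<eta>: "transversal \<eta> 0 1" "\<eta> 0 = x" "\<eta> 1 = y" "\<And>t. t \<in> {0..1} \<Longrightarrow> dist (\<eta> t) z < \<epsilon> / 2"
        using \<delta>(2)[of x y] xy unfolding W_def by blast
      show "G a b x y" unfolding G_def
      proof (intro exI[of _ "\<lambda>t. \<eta> ((t - a) / (b - a))"] conjI ballI)
        show "transversal (\<lambda>t. \<eta> ((t - a) / (b - a))) a b" using transversal_rescale[OF \<eta>(1) h(3)] .
        fix t assume t: "t \<in> {a..b}"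
        have "(t - a) / (b - a) \<in> {0..1}" using t h by (auto simp: divide_le_eq)
        then have "dist (\<eta> ((t - a) / (b - a))) z < \<epsilon> / 2" by (rule \<eta>(4))
        then show "dist (\<eta> ((t - a) / (b - a))) (\<gamma> t) < \<epsilon>"
          using cl[OF t] dist_triangle2[of "\<eta> ((t - a) / (b - a))" "\<gamma> t" z] by auto
      qed (use \<eta> h in auto)
    qed
    then show "\<exists>d>0. \<forall>a b. a \<le> x0 \<and> x0 \<le> b \<and> b - a < d \<longrightarrow> P a b" using d(1) by blast
  qed
  then obtain \<delta> where \<delta>: "\<delta> > 0" "\<And>x y. W \<delta> 0 x \<Longrightarrow> W \<delta> 1 y \<Longrightarrow> G 0 1 x y" unfolding P_def by auto
  have "W \<delta> 0 (\<gamma> 0)" "W \<delta> 1 (\<gamma> 1)" using \<delta>(1) ge C by (auto simp: W_def)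
  then show ?thesis using \<delta>(2) unfolding G_def by blast
qed

lemma generic_braid_dense:
  fixes \<gamma> :: "real \<Rightarrow> (real^3)^'n"
  assumes g: "pure_braid p \<gamma>" and e: "\<epsilon> > 0" and n5: "CARD('n) \<ge> 5" and gp: "general_position p"
  shows "\<exists>\<beta>. generic_braid p \<beta> \<and> (\<forall>t\<in>{0..1}. dist (\<beta> t) (\<gamma> t) < \<epsilon>)"
proof -
  have e01: "\<gamma> 0 = p" "\<gamma> 1 = p" using g by (auto simp: pure_braid_def pathstart_def pathfinish_def)
  obtain \<beta> where b: "transversal \<beta> 0 1" "\<beta> 0 = \<gamma> 0" "\<beta> 1 = \<gamma> 1" "\<forall>t\<in>{0..1}. dist (\<beta> t) (\<gamma> t) < \<epsilon>"
    using transversal_path_dense[of \<gamma>, OF _ _ e n5] g gp e01 unfolding pure_braid_def by auto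
  have "generic_braid p \<beta>" using transversal_generic_braid[OF b(1) n5] b(2,3) e01 by simp
  then show ?thesis using b(4) by blast
qed

lemma open_Collect_all_finite:
  fixes P :: "'i::finite \<Rightarrow> 'a::topological_space \<Rightarrow> bool"
  assumes "\<And>i. open {z. P i z}" shows "open {z. \<forall>i. P i z}"
proof -
  have "{z. \<forall>i. P i z} = (\<Inter>i. {z. P i z})" by auto
  then show ?thesis using assms by (simp add: open_INT)
qed

definition normalize_config :: "(real^3)^'n \<Rightarrow> (real^3)^'n" where
  "normalize_config z = (\<chi> i. sgn (z $ i))"

text \<open>The configuration space is a retract of an open set, hence nearby braids are isotopic.\<close>
lemma close_isotopic:
  fixes \<gamma> :: "real \<Rightarrow> (real^3)^'n"
  assumes g: "pure_braid p \<gamma>"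
  shows "\<exists>\<epsilon>>0. \<forall>\<beta>. pure_braid p \<beta> \<longrightarrow> (\<forall>t\<in>{0..1}. dist (\<beta> t) (\<gamma> t) < \<epsilon>) \<longrightarrow> isotopic \<gamma> \<beta>"
proof -
  define N where "N = {z :: (real^3)^'n. \<forall>i. z $ i \<noteq> 0}"
  define D where "D = {z :: (real^3)^'n. \<forall>i j. i \<noteq> j \<longrightarrow> z $ i \<noteq> z $ j}"
  \<comment> \<open>The radially projected points have to remain distinct, so that
    \<open>normalize_config\<close> maps \<open>U\<close> into the configuration space.\<close>
  define U where "U = {z \<in> N. normalize_config z \<in> D}"
  have N: "open N" unfolding N_def by (intro open_Collect_all_finite open_Collect_neq continuous_intros)
  have D: "open D"
  proof -
    have "open {z :: (real^3)^'n. i \<noteq> j \<longrightarrow> z $ i \<noteq> z $ j}" for i j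
      by (cases "i = j") (auto intro!: open_Collect_neq continuous_intros)
    then show ?thesis unfolding D_def by (intro open_Collect_all_finite)
  qed
  have cn: "continuous_on N normalize_config"
    unfolding normalize_config_def by (intro continuous_on_vec_lambda continuous_on_sgn continuous_intros) (auto simp: N_def)
  have "open (N \<inter> normalize_config -` D)" by (rule continuous_open_preimage[OF cn N D])
  moreover have "U = N \<inter> normalize_config -` D" unfolding U_def by blast
  ultimately have U: "open U" by simp
  have id: "normalize_config z = z" if "z \<in> configuration_space" for z :: "(real^3)^'n"
    using conf_norm'[OF that] by (simp add: normalize_config_def vec_eq_iff sgn_div_norm)
  have sub: "configuration_space \<subseteq> U"
  proof
    fix z :: "(real^3)^'n" assume z: "z \<in> configuration_space"
    have "z $ i \<noteq> 0" for i using conf_norm'[OF z, of i] by auto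
    then show "z \<in> U" using id[OF z] z by (auto simp: U_def N_def D_def configuration_space_def)
  qed
  have im: "normalize_config \<in> U \<rightarrow> configuration_space"
  proof
    fix z assume z: "z \<in> U"
    then have "norm (normalize_config z $ i) = 1" for i by (simp add: U_def N_def normalize_config_def norm_sgn)
    then show "normalize_config z \<in> configuration_space" using z by (auto simp: U_def D_def configuration_space_def)
  qed
  have cU: "continuous_on U normalize_config" using cn by (rule continuous_on_subset) (auto simp: U_def)
  have pg: "path \<gamma>" "path_image \<gamma> \<subseteq> configuration_space" "path_image \<gamma> \<subseteq> U" using g sub by (auto simp: pure_braid_def)
  obtain \<epsilon> where \<epsilon>: "\<epsilon> > 0" "\<And>h. path h \<Longrightarrow> pathstart h = pathstart \<gamma> \<Longrightarrow> pathfinish h = pathfinish \<gamma> \<Longrightarrow>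
     (\<forall>t\<in>{0..1}. norm (h t - \<gamma> t) < \<epsilon>) \<Longrightarrow> homotopic_paths U \<gamma> h"
    using homotopic_nearby_paths[OF pg(1) U pg(3)] by blast
  have "isotopic \<gamma> \<beta>" if b: "pure_braid p \<beta>" "\<forall>t\<in>{0..1}. dist (\<beta> t) (\<gamma> t) < \<epsilon>" for \<beta>
  proof -
    have pb: "path \<beta>" "path_image \<beta> \<subseteq> configuration_space" using b by (auto simp: pure_braid_def)
    have "homotopic_paths U \<gamma> \<beta>" using b g by (intro \<epsilon>(2)) (auto simp: pure_braid_def dist_norm)
    then have h: "homotopic_paths configuration_space (normalize_config \<circ> \<gamma>) (normalize_config \<circ> \<beta>)"
      by (rule homotopic_paths_continuous_image[OF _ cU im])
    have 1: "homotopic_paths configuration_space \<gamma> (normalize_config \<circ> \<gamma>)"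
      by (rule homotopic_paths_eq[OF pg(1,2)]) (simp add: id path_conf[OF pg(2)])
    have 2: "homotopic_paths configuration_space \<beta> (normalize_config \<circ> \<beta>)"
      by (rule homotopic_paths_eq[OF pb]) (simp add: id path_conf[OF pb(2)])
    show ?thesis unfolding isotopic_def
      using homotopic_paths_trans[OF homotopic_paths_trans[OF 1 h] homotopic_paths_sym[OF 2]] .
  qed
  then show ?thesis using \<epsilon>(1) by blast
qed

section \<open>Invariance\<close>

text \<open>The labels \<open>A\<close> at \<open>y\<close> and \<open>A'\<close> at \<open>y'\<close> correspond under transport near \<open>z\<close>.\<close>
definition link :: "(real^3)^'n \<Rightarrow> (real^3)^'n \<Rightarrow> ('n set \<Rightarrow> 'x::linordered_ab_group_add) \<Rightarrow> (real^3)^'n \<Rightarrow> ('n set \<Rightarrow> 'x) \<Rightarrow> bool" where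
  "link z y A y' A' \<longleftrightarrow> (\<exists>d. ptolemy_section z d \<and> restricts z d y A \<and> restricts z d y' A')"

text \<open>Changes the centre of comparison. Labels carried from \<open>y\<close> to
  \<open>y'\<close> along \<open>\<eta>\<close> restrict both sections; by the first section they
  agree with \<open>A'\<close> on the edges at \<open>y'\<close>, and therefore the second section
  restricts to \<open>A'\<close> as well.\<close>

lemma relink:
  fixes z1 z2 :: "(real^3)^'n" and A :: "'n set \<Rightarrow> 'x::linordered_ab_group_add"
  assumes z: "z1 \<in> configuration_space" "z2 \<in> configuration_space" and n5: "CARD('n) \<ge> 5"
    and h: "transversal \<eta> 0 1" "\<eta> 0 = y" "\<eta> 1 = y'" and nr: "\<And>t. t \<in> {0..1} \<Longrightarrow> near z1 (\<eta> t) \<and> near z2 (\<eta> t)"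
    and l: "link z1 y A y' A'"
  shows "link z2 y A y' A'"
proof -
  have g: "generic_path \<eta>" using transversal_generic_path[OF h(1) n5] .
  have n4: "CARD('n) \<ge> 4" using n5 by simp
  have k: "0 \<notin> critical_times \<eta>" "1 \<notin> critical_times \<eta>" using transversal_crit(2)[OF h(1)] by auto
  have y: "y \<in> configuration_space" "general_position y" using h unfolding transversal_def by auto
  obtain d1 where d1: "ptolemy_section z1 d1" "restricts z1 d1 y A" "restricts z1 d1 y' A'" using l unfolding link_def by blast
  have nr0: "near z2 y" using nr[of 0] h(2) by simp
  obtain d2 where d2: "ptolemy_section z2 d2" "restricts z2 d2 y A" using section_exists[OF z(2) y(1) nr0 y(2) n4] by blast
  define B where "B = label_at \<eta> A 1"
  have 1: "restricts z1 d1 y' B"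
    using restricts_flat[OF g n5 z(1) d1(1), of 0 1 A] k nr d1(2) h label_at_0[OF g n5, of A] unfolding B_def by auto
  have 2: "restricts z2 d2 y' B"
    using restricts_flat[OF g n5 z(2) d2(1), of 0 1 A] k nr d2(2) h label_at_0[OF g n5, of A] unfolding B_def by auto
  have "restricts z2 d2 y' A'" using 1 2 d1(3) unfolding restricts_def by metis
  then show ?thesis unfolding link_def using d2 by blast
qed

text \<open>\<open>P a b\<close> says that a link of the two braids relative to the centre
  \<open>\<gamma> a\<close> at a time near \<open>a\<close> implies one relative to
  \<open>\<gamma> b\<close> at a time near \<open>b\<close>. The times may vary because the braids
  need not be in general position at \<open>a\<close> or \<open>b\<close>.\<close>

lemma braid_stable:
  fixes \<gamma> :: "real \<Rightarrow> (real^3)^'n" and A :: "'n set \<Rightarrow> 'x::linordered_ab_group_add"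
  assumes g: "pure_braid p \<gamma>" and n5: "CARD('n) \<ge> 5" and gp: "general_position p"
  shows "\<exists>\<delta>>0. \<forall>\<beta> \<beta>' a b c. generic_braid p \<beta> \<longrightarrow> generic_braid p \<beta>' \<longrightarrow>
     (\<forall>t\<in>{0..1}. dist (\<beta> t) (\<gamma> t) < \<delta> \<and> dist (\<beta>' t) (\<gamma> t) < \<delta>) \<longrightarrow>
     otri p a b c \<longrightarrow> label_at \<beta> A 1 {a, b} = label_at \<beta>' A 1 {a, b}"
proof -
  have n4: "CARD('n) \<ge> 4" using n5 by simp
  have pg: "path \<gamma>" "path_image \<gamma> \<subseteq> configuration_space" and e01: "\<gamma> 0 = p" "\<gamma> 1 = p"
    using g by (auto simp: pure_braid_def pathstart_def pathfinish_def)
  have C: "\<gamma> t \<in> configuration_space" if "t \<in> {0..1}" for t using path_conf[OF pg(2) that] .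
  define W where "W \<delta> \<beta> \<longleftrightarrow> generic_braid p \<beta> \<and> (\<forall>t\<in>{0..1}. dist (\<beta> t) (\<gamma> t) < \<delta>)" for \<delta> \<beta>
  have bC: "\<beta> t \<in> configuration_space" if "W \<delta> \<beta>" "t \<in> {0..1}" for \<delta> \<beta> t
    using that path_conf unfolding W_def generic_braid_def pure_braid_def by blast
  have bG: "generic_path \<beta>" if "W \<delta> \<beta>" for \<delta> \<beta> using that generic_braid_path[OF _ n5] unfolding W_def by blast
  have bK: "t \<notin> critical_times \<beta>" if "W \<delta> \<beta>" "t \<in> {0..1}" "general_position (\<beta> t)" for \<delta> \<beta> t
    using general_position_not_crit[OF bC[OF that(1,2)] that(3)] critical_times_iff by blast
  have bF: "finite {t \<in> {0..1}. \<not> general_position (\<beta> t)}" if "W \<delta> \<beta>" for \<delta> \<beta>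
  proof -
    have "{t \<in> {0..1}. \<not> no_four_cocircular (\<beta> t)} = {t \<in> {0..1}. \<not> general_position (\<beta> t)}"
      using no_four_cocircular_iff[OF bC[OF that]] by blast
    then show ?thesis using that unfolding W_def generic_braid_def by simp
  qed
  define L where "L z \<beta> \<beta>' t \<longleftrightarrow> link z (\<beta> t) (label_at \<beta> A t) (\<beta>' t) (label_at \<beta>' A t)" for z \<beta> \<beta>' t
  define T where "T \<delta> \<beta> \<beta>' a t \<longleftrightarrow> t \<in> {0..1} \<and> \<bar>t - a\<bar> < \<delta> \<and> general_position (\<beta> t) \<and> general_position (\<beta>' t)"
    for \<delta> a t and \<beta> \<beta>' :: "real \<Rightarrow> (real^3)^'n"
  define P where "P a b \<longleftrightarrow> (0 \<le> a \<longrightarrow> b \<le> 1 \<longrightarrow> a < b \<longrightarrow> (\<exists>\<delta>>0. \<forall>\<beta> \<beta>' s t. W \<delta> \<beta> \<longrightarrow> W \<delta> \<beta>' \<longrightarrow>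
     T \<delta> \<beta> \<beta>' a s \<longrightarrow> T \<delta> \<beta> \<beta>' b t \<longrightarrow> L (\<gamma> a) \<beta> \<beta>' s \<longrightarrow> L (\<gamma> b) \<beta> \<beta>' t))" for a b
  have Wm: "W \<delta> \<beta>" if "W \<delta>' \<beta>" "\<delta>' \<le> \<delta>" for \<delta> \<delta>' \<beta> using that unfolding W_def by force
  have Tm: "T \<delta> \<beta> \<beta>' a t" if "T \<delta>' \<beta> \<beta>' a t" "\<delta>' \<le> \<delta>" for \<delta> \<delta>' \<beta> \<beta>' a t using that unfolding T_def by force
  have "P 0 1"
  proof (rule Bolzano)
    show "(0::real) \<le> 1" by simp
    fix a b c assume ab: "P a b" and bc: "P b c" and le: "a \<le> b" "b \<le> c"
    show "P a c"
    proof (cases "a = b \<or> b = c")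
      case True then show ?thesis using ab bc by auto
    next
      case False
      then have lt: "a < b" "b < c" using le by auto
      show ?thesis unfolding P_def
      proof (intro impI)
        assume h: "0 \<le> a" "c \<le> 1" "a < c"
        obtain d1 where d1: "d1 > 0" "\<And>\<beta> \<beta>' s t. W d1 \<beta> \<Longrightarrow> W d1 \<beta>' \<Longrightarrow> T d1 \<beta> \<beta>' a s \<Longrightarrow> T d1 \<beta> \<beta>' b t \<Longrightarrow> L (\<gamma> a) \<beta> \<beta>' s \<Longrightarrow> L (\<gamma> b) \<beta> \<beta>' t"
          using ab h lt unfolding P_def by auto
        obtain d2 where d2: "d2 > 0" "\<And>\<beta> \<beta>' s t. W d2 \<beta> \<Longrightarrow> W d2 \<beta>' \<Longrightarrow> T d2 \<beta> \<beta>' b s \<Longrightarrow> T d2 \<beta> \<beta>' c t \<Longrightarrow> L (\<gamma> b) \<beta> \<beta>' s \<Longrightarrow> L (\<gamma> c) \<beta> \<beta>' t"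
          using bc h lt unfolding P_def by auto
        define \<delta> where "\<delta> = min d1 d2"
        have \<delta>: "\<delta> > 0" "\<delta> \<le> d1" "\<delta> \<le> d2" using d1 d2 by (auto simp: \<delta>_def)
        have "L (\<gamma> c) \<beta> \<beta>' t" if w: "W \<delta> \<beta>" "W \<delta> \<beta>'" and t: "T \<delta> \<beta> \<beta>' a s" "T \<delta> \<beta> \<beta>' c t" and l: "L (\<gamma> a) \<beta> \<beta>' s" for \<beta> \<beta>' s t
        proof -
          \<comment> \<open>Each braid leaves general position at finitely many times only, so a
            good time for both exists just after \<open>b\<close>.\<close>
          have "infinite {b<..<min c (b + \<delta>)}" using lt \<delta> by (intro infinite_Ioo) auto
          moreover have "finite ({t \<in> {0..1}. \<not> general_position (\<beta> t)} \<union> {t \<in> {0..1}. \<not> general_position (\<beta>' t)})"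
            using bF w by blast
          ultimately obtain r where r: "r \<in> {b<..<min c (b + \<delta>)}"
            "r \<notin> {t \<in> {0..1}. \<not> general_position (\<beta> t)} \<union> {t \<in> {0..1}. \<not> general_position (\<beta>' t)}"
            by (meson finite_subset subsetI)
          have Tr: "T \<delta> \<beta> \<beta>' b r" using r h lt unfolding T_def by auto
          have "L (\<gamma> b) \<beta> \<beta>' r"
            using d1(2)[OF Wm[OF w(1) \<delta>(2)] Wm[OF w(2) \<delta>(2)] Tm[OF t(1) \<delta>(2)] Tm[OF Tr \<delta>(2)] l] .
          then show ?thesis
            using d2(2)[OF Wm[OF w(1) \<delta>(3)] Wm[OF w(2) \<delta>(3)] Tm[OF Tr \<delta>(3)] Tm[OF t(2) \<delta>(3)]] by blast
        qed
        then show "\<exists>\<delta>>0. \<forall>\<beta> \<beta>' s t. W \<delta> \<beta> \<longrightarrow> W \<delta> \<beta>' \<longrightarrow> T \<delta> \<beta> \<beta>' a s \<longrightarrow> T \<delta> \<beta> \<beta>' c t \<longrightarrow> L (\<gamma> a) \<beta> \<beta>' s \<longrightarrow> L (\<gamma> c) \<beta> \<beta>' t"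
          using \<delta>(1) by blast
      qed
    qed
  next
    fix x0 :: real assume x0: "0 \<le> x0" "x0 \<le> 1"
    define z where "z = \<gamma> x0"
    have x01: "x0 \<in> {0..1}" using x0 by simp
    have z: "z \<in> configuration_space" using C[OF x01] by (simp add: z_def)
    obtain R where R: "R > 0" "\<And>w. dist w z < R \<Longrightarrow> near z w" using near_ball[of z] by blast
    have R2: "R / 2 > 0" using R by simp
    obtain d where d: "d > 0" "\<And>s. s \<in> {0..1} \<Longrightarrow> \<bar>s - x0\<bar> < d \<Longrightarrow> dist (\<gamma> s) z < R / 2"
      using path_local[OF pg(1) x01 R2] unfolding z_def by blast
    \<comment> \<open>Exchange of the centres \<open>\<gamma> e\<close> and \<open>z\<close>: the
      configurations of the two braids at time \<open>s\<close> are joined by a short transversal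
      path that is near both centres, and \<open>relink\<close> applies in both directions.\<close>
    have conv: "\<exists>\<delta>>0. \<forall>\<beta> \<beta>' s. W \<delta> \<beta> \<longrightarrow> W \<delta> \<beta>' \<longrightarrow> T \<delta> \<beta> \<beta>' e s \<longrightarrow> (L (\<gamma> e) \<beta> \<beta>' s \<longleftrightarrow> L z \<beta> \<beta>' s)"
      if e: "e \<in> {0..1}" "\<bar>e - x0\<bar> < d" for e
    proof -
      obtain Re where Re: "Re > 0" "\<And>w. dist w (\<gamma> e) < Re \<Longrightarrow> near (\<gamma> e) w" using near_ball[of "\<gamma> e"] by blast
      have r: "min Re (R / 2) > 0" using Re R by simp
      obtain \<delta>1 where \<delta>1: "\<delta>1 > 0" "\<And>x y. x \<in> configuration_space \<Longrightarrow> y \<in> configuration_space \<Longrightarrow> general_position x \<Longrightarrow> general_position y \<Longrightarrow>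
          dist x (\<gamma> e) < \<delta>1 \<Longrightarrow> dist y (\<gamma> e) < \<delta>1 \<Longrightarrow> \<exists>\<eta>. transversal \<eta> 0 1 \<and> \<eta> 0 = x \<and> \<eta> 1 = y \<and> (\<forall>t\<in>{0..1}. dist (\<eta> t) (\<gamma> e) < min Re (R / 2))"
        using connect_ball[OF C[OF e(1)] r n5] by blast
      have d12: "\<delta>1 / 2 > 0" using \<delta>1 by simp
      obtain dc where dc: "dc > 0" "\<And>s. s \<in> {0..1} \<Longrightarrow> \<bar>s - e\<bar> < dc \<Longrightarrow> dist (\<gamma> s) (\<gamma> e) < \<delta>1 / 2"
        using path_local[OF pg(1) e(1) d12] by blast
      define \<delta> where "\<delta> = min (\<delta>1 / 2) dc"
      have \<delta>: "\<delta> > 0" "\<delta> \<le> \<delta>1 / 2" "\<delta> \<le> dc" using d12 dc by (auto simp: \<delta>_def)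
      have "L (\<gamma> e) \<beta> \<beta>' s \<longleftrightarrow> L z \<beta> \<beta>' s" if w: "W \<delta> \<beta>" "W \<delta> \<beta>'" and t: "T \<delta> \<beta> \<beta>' e s" for \<beta> \<beta>' s
      proof -
        have s: "s \<in> {0..1}" "\<bar>s - e\<bar> < dc" "general_position (\<beta> s)" "general_position (\<beta>' s)" using t \<delta> unfolding T_def by auto
        have "dist (\<beta> s) (\<gamma> s) < \<delta>1 / 2" "dist (\<beta>' s) (\<gamma> s) < \<delta>1 / 2" using w s(1) \<delta>(2) unfolding W_def by force+
        then have "dist (\<beta> s) (\<gamma> e) < \<delta>1" "dist (\<beta>' s) (\<gamma> e) < \<delta>1"
          using dc(2)[OF s(1,2)] dist_triangle[of "\<beta> s" "\<gamma> e" "\<gamma> s"] dist_triangle[of "\<beta>' s" "\<gamma> e" "\<gamma> s"] by auto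
        from \<delta>1(2)[OF bC[OF w(1) s(1)] bC[OF w(2) s(1)] s(3,4) this]
        obtain \<eta> where \<eta>: "transversal \<eta> 0 1" "\<eta> 0 = \<beta> s" "\<eta> 1 = \<beta>' s" "\<And>t. t \<in> {0..1} \<Longrightarrow> dist (\<eta> t) (\<gamma> e) < min Re (R / 2)" by blast
        have nr: "near (\<gamma> e) (\<eta> t) \<and> near z (\<eta> t)" if "t \<in> {0..1}" for t
        proof -
          have "dist (\<eta> t) z < R" using \<eta>(4)[OF that] d(2)[OF e] dist_triangle[of "\<eta> t" z "\<gamma> e"] by auto
          then show ?thesis using Re(2) R(2) \<eta>(4)[OF that] by auto
        qed
        show ?thesis unfolding L_def
          using relink[OF C[OF e(1)] z n5 \<eta>(1-3) nr] relink[OF z C[OF e(1)] n5 \<eta>(1-3)] nr by blast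
      qed
      then show ?thesis using \<delta>(1) by blast
    qed
    have "P a b" if ab: "a \<le> x0" "x0 \<le> b" "b - a < d / 2" for a b
      unfolding P_def
    proof (intro impI)
      assume h: "0 \<le> a" "b \<le> 1" "a < b"
      have a: "a \<in> {0..1}" "\<bar>a - x0\<bar> < d" and b: "b \<in> {0..1}" "\<bar>b - x0\<bar> < d" using h ab d(1) by auto
      obtain da where da: "da > 0" "\<And>\<beta> \<beta>' s. W da \<beta> \<Longrightarrow> W da \<beta>' \<Longrightarrow> T da \<beta> \<beta>' a s \<Longrightarrow> L (\<gamma> a) \<beta> \<beta>' s \<longleftrightarrow> L z \<beta> \<beta>' s"
        using conv[OF a] by blast
      obtain db where db: "db > 0" "\<And>\<beta> \<beta>' s. W db \<beta> \<Longrightarrow> W db \<beta>' \<Longrightarrow> T db \<beta> \<beta>' b s \<Longrightarrow> L (\<gamma> b) \<beta> \<beta>' s \<longleftrightarrow> L z \<beta> \<beta>' s"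
        using conv[OF b] by blast
      \<comment> \<open>\<open>(b - a) / 2\<close> ensures \<open>s \<le> t\<close>;
        \<open>d / 2\<close> and \<open>R / 2\<close> keep both braids within distance
        \<open>R\<close> of \<open>z\<close> from \<open>s\<close> to \<open>t\<close>.\<close>
      define \<delta> where "\<delta> = Min {da, db, (b - a) / 2, d / 2, R / 2}"
      have "\<delta> > 0" using da(1) db(1) h(3) d(1) R(1) by (simp add: \<delta>_def)
      moreover have "\<delta> \<le> x" if "x \<in> {da, db, (b - a) / 2, d / 2, R / 2}" for x
        unfolding \<delta>_def using that by (intro Min_le) auto
      ultimately have \<delta>: "\<delta> > 0" "\<delta> \<le> da" "\<delta> \<le> db" "\<delta> \<le> (b - a) / 2" "\<delta> \<le> d / 2" "\<delta> \<le> R / 2"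
        by blast+
      have "L (\<gamma> b) \<beta> \<beta>' t" if w: "W \<delta> \<beta>" "W \<delta> \<beta>'" and st: "T \<delta> \<beta> \<beta>' a s" "T \<delta> \<beta> \<beta>' b t" and l: "L (\<gamma> a) \<beta> \<beta>' s" for \<beta> \<beta>' s t
      proof -
        have s: "s \<in> {0..1}" "\<bar>s - a\<bar> < \<delta>" "general_position (\<beta> s)" "general_position (\<beta>' s)" using st(1) unfolding T_def by auto
        have t: "t \<in> {0..1}" "\<bar>t - b\<bar> < \<delta>" "general_position (\<beta> t)" "general_position (\<beta>' t)" using st(2) unfolding T_def by auto
        have slt: "s \<le> t" using s(2) t(2) \<delta>(4) by (auto simp: abs_less_iff field_simps)
        have nr: "near z (\<alpha> r)" if "W \<delta> \<alpha>" "r \<in> {s..t}" for \<alpha> r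
        proof -
          have r: "r \<in> {0..1}" using that s t by auto
          have "\<bar>r - x0\<bar> < d" using that(2) s(2) t(2) \<delta>(5) ab by (auto simp: abs_less_iff)
          then have "dist (\<gamma> r) z < R / 2" using d(2) r by blast
          moreover have "dist (\<alpha> r) (\<gamma> r) < R / 2" using that(1) r \<delta>(6) unfolding W_def by force
          ultimately have "dist (\<alpha> r) z < R" using dist_triangle[of "\<alpha> r" z "\<gamma> r"] by auto
          then show ?thesis by (rule R(2))
        qed
        have "L z \<beta> \<beta>' s"
          using da(2)[OF Wm[OF w(1) \<delta>(2)] Wm[OF w(2) \<delta>(2)] Tm[OF st(1) \<delta>(2)]] l by blast
        then obtain D where D: "ptolemy_section z D" "restricts z D (\<beta> s) (label_at \<beta> A s)" "restricts z D (\<beta>' s) (label_at \<beta>' A s)"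
          unfolding L_def link_def by blast
        have s0: "0 \<le> s" and t1: "t \<le> 1" using s t by auto
        have "restricts z D (\<beta> t) (label_at \<beta> A t)"
          by (rule restricts_flat[OF bG[OF w(1)] n5 z D(1) s0 slt t1 bK[OF w(1) s(1,3)] bK[OF w(1) t(1,3)] nr[OF w(1)] D(2)])
        moreover have "restricts z D (\<beta>' t) (label_at \<beta>' A t)"
          by (rule restricts_flat[OF bG[OF w(2)] n5 z D(1) s0 slt t1 bK[OF w(2) s(1,4)] bK[OF w(2) t(1,4)] nr[OF w(2)] D(3)])
        ultimately have "L z \<beta> \<beta>' t" unfolding L_def link_def using D(1) by blast
        then show ?thesis
          using db(2)[OF Wm[OF w(1) \<delta>(3)] Wm[OF w(2) \<delta>(3)] Tm[OF st(2) \<delta>(3)]] by blast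
      qed
      then show "\<exists>\<delta>>0. \<forall>\<beta> \<beta>' s t. W \<delta> \<beta> \<longrightarrow> W \<delta> \<beta>' \<longrightarrow> T \<delta> \<beta> \<beta>' a s \<longrightarrow> T \<delta> \<beta> \<beta>' b t \<longrightarrow> L (\<gamma> a) \<beta> \<beta>' s \<longrightarrow> L (\<gamma> b) \<beta> \<beta>' t"
        using \<delta>(1) by blast
    qed
    moreover have "d / 2 > 0" using d(1) by simp
    ultimately show "\<exists>d>0. \<forall>a b. a \<le> x0 \<and> x0 \<le> b \<and> b - a < d \<longrightarrow> P a b" by blast
  qed
  then obtain \<delta> where \<delta>: "\<delta> > 0" "\<And>\<beta> \<beta>' s t. W \<delta> \<beta> \<Longrightarrow> W \<delta> \<beta>' \<Longrightarrow> T \<delta> \<beta> \<beta>' 0 s \<Longrightarrow> T \<delta> \<beta> \<beta>' 1 t \<Longrightarrow> L (\<gamma> 0) \<beta> \<beta>' s \<Longrightarrow> L (\<gamma> 1) \<beta> \<beta>' t"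
    unfolding P_def by auto
  have "label_at \<beta> A 1 {a, b} = label_at \<beta>' A 1 {a, b}"
    if gb: "generic_braid p \<beta>" "generic_braid p \<beta>'" and cl: "\<forall>t\<in>{0..1}. dist (\<beta> t) (\<gamma> t) < \<delta> \<and> dist (\<beta>' t) (\<gamma> t) < \<delta>"
      and o: "otri p a b c" for \<beta> \<beta>' a b c
  proof -
    have w: "W \<delta> \<beta>" "W \<delta> \<beta>'" using gb cl unfolding W_def by auto
    have b01: "\<beta> 0 = p" "\<beta> 1 = p" "\<beta>' 0 = p" "\<beta>' 1 = p"
      using gb by (auto simp: generic_braid_def pure_braid_def pathstart_def pathfinish_def)
    have p: "p \<in> configuration_space" using C[of 0] e01 by simp
    have np: "near p p" by (simp add: near_def)
    \<comment> \<open>Both braids start at \<open>p\<close> with the labels \<open>A\<close>, so one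
      section at \<open>p\<close> through these labels is the initial link.\<close>
    obtain d where d: "ptolemy_section p d" "restricts p d p A" using section_exists[OF p p np gp n4] by blast
    have "L (\<gamma> 0) \<beta> \<beta>' 0"
      unfolding L_def link_def e01 b01 label_at_0[OF bG[OF w(1)] n5] label_at_0[OF bG[OF w(2)] n5] using d by blast
    then have "L (\<gamma> 1) \<beta> \<beta>' 1" using \<delta>(1) gp b01 by (intro \<delta>(2)[OF w, of 0 1]) (auto simp: T_def)
    then show ?thesis using o unfolding L_def link_def e01 b01 restricts_def by metis
  qed
  then show ?thesis using \<delta>(1) by blast
qed

lemma f_n_stable:
  fixes \<gamma> :: "real \<Rightarrow> (real^3)^'n" and A1 :: "nat \<Rightarrow> 'x::linordered_ab_group_add"
  assumes g: "pure_braid p \<gamma>" and n5: "CARD('n) \<ge> 5" and gp: "general_position p"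
    and e: "bij_betw e {..<N} (delaunay_edges p)"
  shows "\<exists>\<delta>>0. \<forall>\<beta> \<beta>'. generic_braid p \<beta> \<longrightarrow> generic_braid p \<beta>' \<longrightarrow>
     (\<forall>t\<in>{0..1}. dist (\<beta> t) (\<gamma> t) < \<delta> \<and> dist (\<beta>' t) (\<gamma> t) < \<delta>) \<longrightarrow> f_n N e A1 \<beta> = f_n N e A1 \<beta>'"
proof -
  define A where "A = (\<lambda>E. A1 (inv_into {..<N} e E))"
  have p: "p \<in> configuration_space" using g path_conf[of \<gamma> 0] by (auto simp: pure_braid_def pathstart_def)
  have n4: "CARD('n) \<ge> 4" using n5 by simp
  obtain \<delta> where \<delta>: "\<delta> > 0" "\<And>\<beta> \<beta>' a b c. generic_braid p \<beta> \<Longrightarrow> generic_braid p \<beta>' \<Longrightarrow>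
     (\<forall>t\<in>{0..1}. dist (\<beta> t) (\<gamma> t) < \<delta> \<and> dist (\<beta>' t) (\<gamma> t) < \<delta>) \<Longrightarrow>
     otri p a b c \<Longrightarrow> label_at \<beta> A 1 {a, b} = label_at \<beta>' A 1 {a, b}"
    using braid_stable[OF g n5 gp, of A] by blast
  have f: "f_n N e A1 \<beta> = (\<lambda>k\<in>{..<N}. label_at \<beta> A 1 (e k))" if "generic_braid p \<beta>" for \<beta>
    unfolding f_n_def label_at_1[OF generic_braid_path[OF that n5] n5] A_def ..
  have "f_n N e A1 \<beta> = f_n N e A1 \<beta>'" if b: "generic_braid p \<beta>" "generic_braid p \<beta>'"
    "\<forall>t\<in>{0..1}. dist (\<beta> t) (\<gamma> t) < \<delta> \<and> dist (\<beta>' t) (\<gamma> t) < \<delta>" for \<beta> \<beta>'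
    unfolding f[OF b(1)] f[OF b(2)]
  proof (rule restrict_ext)
    fix k assume "k \<in> {..<N}"
    then have "e k \<in> delaunay_edges p" using e by (auto simp: bij_betw_def)
    then obtain a b c where abc: "e k = {a, b}" "otri p a b c"
      using delaunay_edges_eq[OF p general_position_not_crit[OF p gp] n4] by blast
    show "label_at \<beta> A 1 (e k) = label_at \<beta>' A 1 (e k)" unfolding abc(1) by (rule \<delta>(2)[OF b abc(2)])
  qed
  then show ?thesis using \<delta>(1) by blast
qed

text \<open>Intermediate braids of the homotopy may be nongeneric. \<open>V s v\<close> therefore
  attaches to the parameter \<open>s\<close> the common value \<open>v\<close> of the generic braids
  close to \<open>\<gamma> s\<close>.\<close>

lemma f_n_isotopic:
  fixes p :: "(real^3)^'n" and A1 :: "nat \<Rightarrow> 'x::linordered_ab_group_add"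
  assumes n5: "CARD('n) \<ge> 5" and gp: "general_position p"
    and e: "bij_betw e {..<N} (delaunay_edges p)"
    and b: "generic_braid p \<beta>" "generic_braid p \<beta>'" "isotopic \<beta> \<beta>'"
  shows "f_n N e A1 \<beta> = f_n N e A1 \<beta>'"
proof -
  obtain h where h: "continuous_on ({0..1} \<times> {0..1}) h" "h \<in> ({0..1} \<times> {0..1}) \<rightarrow> configuration_space"
    "\<And>t. t \<in> {0..1} \<Longrightarrow> h (0, t) = \<beta> t" "\<And>t. t \<in> {0..1} \<Longrightarrow> h (1, t) = \<beta>' t"
    "\<And>s :: real. s \<in> {0..1} \<Longrightarrow> pathstart (h \<circ> Pair s) = pathstart \<beta> \<and> pathfinish (h \<circ> Pair s) = pathfinish \<beta>"
    using b(3) unfolding isotopic_def homotopic_paths by blast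
  define \<gamma> where "\<gamma> s = (\<lambda>t :: real. h (s :: real, t))" for s
  have pb: "pure_braid p (\<gamma> s)" if s: "s \<in> {0..1}" for s
  proof -
    have "continuous_on {0..1} (\<lambda>t. h (s, t))"
      using s by (intro continuous_on_compose2[OF h(1)] continuous_intros) auto
    moreover have "h (s, 0) = p" "h (s, 1) = p"
      using h(5)[OF s] b(1) by (auto simp: pathstart_def pathfinish_def generic_braid_def pure_braid_def)
    moreover have "path_image (\<gamma> s) \<subseteq> configuration_space" using h(2) s by (auto simp: path_image_def \<gamma>_def)
    ultimately show ?thesis by (simp add: pure_braid_def path_def \<gamma>_def pathstart_def pathfinish_def)
  qed
  have uc: "uniformly_continuous_on ({0..1} \<times> {0..1}) h"
    using h(1) by (intro compact_uniformly_continuous compact_Times) auto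
  define cl where "cl \<delta> s \<alpha> \<longleftrightarrow> generic_braid p \<alpha> \<and> (\<forall>t\<in>{0..1}. dist (\<alpha> t) (\<gamma> s t) < \<delta>)" for \<delta> s \<alpha>
  define V where "V s v \<longleftrightarrow> (\<exists>\<delta>>0. \<forall>\<alpha>. cl \<delta> s \<alpha> \<longrightarrow> f_n N e A1 \<alpha> = v)" for s v
  define P where "P a b \<longleftrightarrow> (0 \<le> a \<longrightarrow> b \<le> 1 \<longrightarrow> (\<forall>v. V a v \<longrightarrow> V b v))" for a b
  have st: "\<exists>\<delta>>0. \<forall>\<alpha> \<alpha>'. cl \<delta> s \<alpha> \<longrightarrow> cl \<delta> s \<alpha>' \<longrightarrow> f_n N e A1 \<alpha> = f_n N e A1 \<alpha>'" if s01: "s \<in> {0..1}" for s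
  proof -
    obtain \<delta> where \<delta>: "\<delta> > 0" "\<And>\<alpha> \<alpha>'. generic_braid p \<alpha> \<Longrightarrow> generic_braid p \<alpha>' \<Longrightarrow>
       \<forall>t\<in>{0..1}. dist (\<alpha> t) (\<gamma> s t) < \<delta> \<and> dist (\<alpha>' t) (\<gamma> s t) < \<delta> \<Longrightarrow> f_n N e A1 \<alpha> = f_n N e A1 \<alpha>'"
      using f_n_stable[OF pb[OF s01] n5 gp e, of A1] by (elim exE conjE) (metis (no_types, lifting))
    show ?thesis
    proof (intro exI[of _ \<delta>] conjI allI impI \<delta>)
      fix \<alpha> \<alpha>' assume c: "cl \<delta> s \<alpha>" "cl \<delta> s \<alpha>'"
      show "generic_braid p \<alpha>" "generic_braid p \<alpha>'" using c by (simp_all add: cl_def)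
      show "\<forall>t\<in>{0..1}. dist (\<alpha> t) (\<gamma> s t) < \<delta> \<and> dist (\<alpha>' t) (\<gamma> s t) < \<delta>" using c by (simp add: cl_def)
    qed
  qed
  have "P 0 1"
  proof (rule Bolzano)
    show "(0::real) \<le> 1" by simp
    show "P a c" if "P a b" "P b c" "a \<le> b" "b \<le> c" for a b c using that unfolding P_def by auto
    fix x0 :: real assume x0: "0 \<le> x0" "x0 \<le> 1"
    obtain \<delta> where \<delta>: "\<delta> > 0" "\<And>\<alpha> \<alpha>'. cl \<delta> x0 \<alpha> \<Longrightarrow> cl \<delta> x0 \<alpha>' \<Longrightarrow> f_n N e A1 \<alpha> = f_n N e A1 \<alpha>'"
      using st[of x0] x0 by auto
    have d2: "\<delta> / 2 > 0" using \<delta> by simp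
    obtain d where d: "d > 0" "\<And>x x'. x \<in> {0..1} \<times> {0..1} \<Longrightarrow> x' \<in> {0..1} \<times> {0..1} \<Longrightarrow> dist x' x < d \<Longrightarrow> dist (h x') (h x) < \<delta> / 2"
      using uc d2 unfolding uniformly_continuous_on_def by metis
    have nb: "cl \<delta> x0 \<alpha>" if "cl (\<delta> / 2) s \<alpha>" "s \<in> {0..1}" "\<bar>s - x0\<bar> < d" for s \<alpha>
      unfolding cl_def
    proof (intro conjI ballI)
      show "generic_braid p \<alpha>" using that by (simp add: cl_def)
      fix t :: real assume t: "t \<in> {0..1}"
      have "dist (h (s, t)) (h (x0, t)) < \<delta> / 2"
        using that x0 t by (intro d(2)) (auto simp: dist_Pair_Pair dist_real_def)
      moreover have "dist (\<alpha> t) (h (s, t)) < \<delta> / 2" using that(1) t by (auto simp: cl_def \<gamma>_def)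
      ultimately show "dist (\<alpha> t) (\<gamma> x0 t) < \<delta>"
        using dist_triangle[of "\<alpha> t" "h (x0, t)" "h (s, t)"] by (simp add: \<gamma>_def)
    qed
    have "P a b" if ab: "a \<le> x0" "x0 \<le> b" "b - a < d" for a b
      unfolding P_def
    proof (intro impI allI)
      fix v assume h0: "0 \<le> a" "b \<le> 1" and V: "V a v"
      have a: "a \<in> {0..1}" "\<bar>a - x0\<bar> < d" and bb: "b \<in> {0..1}" "\<bar>b - x0\<bar> < d" using h0 ab x0 by auto
      obtain \<delta>a where \<delta>a: "\<delta>a > 0" "\<And>\<alpha>. cl \<delta>a a \<alpha> \<Longrightarrow> f_n N e A1 \<alpha> = v" using V unfolding V_def by blast
      \<comment> \<open>Density keeps \<open>V a v\<close> from being vacuous: some generic braid is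
        close enough to stage \<open>a\<close> to have the value \<open>v\<close>, and close enough
        to stage \<open>x0\<close> to share its value with generic braids near stage
        \<open>b\<close>.\<close>
      have "min \<delta>a (\<delta> / 2) > 0" using \<delta>a d2 by simp
      from generic_braid_dense[OF pb[OF a(1)] this n5 gp] obtain \<alpha> where al: "cl \<delta>a a \<alpha>" "cl (\<delta> / 2) a \<alpha>"
        unfolding cl_def by auto
      have "f_n N e A1 \<alpha>' = v" if "cl (\<delta> / 2) b \<alpha>'" for \<alpha>'
        using \<delta>(2)[OF nb[OF that bb] nb[OF al(2) a]] \<delta>a(2)[OF al(1)] by simp
      then show "V b v" unfolding V_def using d2 by blast
    qed
    then show "\<exists>d>0. \<forall>a b. a \<le> x0 \<and> x0 \<le> b \<and> b - a < d \<longrightarrow> P a b" using d(1) by blast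
  qed
  have c0: "cl \<delta> 0 \<beta>" and c1: "cl \<delta> 1 \<beta>'" if "\<delta> > 0" for \<delta> using that b h(3,4) by (auto simp: cl_def \<gamma>_def)
  obtain \<delta> where "\<delta> > 0" "\<And>\<alpha> \<alpha>'. cl \<delta> 0 \<alpha> \<Longrightarrow> cl \<delta> 0 \<alpha>' \<Longrightarrow> f_n N e A1 \<alpha> = f_n N e A1 \<alpha>'"
    using st[of 0] by auto
  then have "V 0 (f_n N e A1 \<beta>)" unfolding V_def using c0 by blast
  then have "V 1 (f_n N e A1 \<beta>)" using \<open>P 0 1\<close> unfolding P_def by simp
  then show ?thesis unfolding V_def using c1 by metis
qed

theorem theorem1:
  fixes p :: "(real^3)^'n"
    and N :: nat
    and e :: "nat \<Rightarrow> 'n set"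
    and A1 :: "nat \<Rightarrow> 'x::linordered_ab_group_add"
  assumes "CARD('n) \<ge> 5"
    and "N = 3 * CARD('n) - 6"
    and "p \<in> configuration_space"
    and "no_four_cocircular p"
    and "bij_betw e {..<N} (delaunay_edges p)"
    and "A1 \<in> {..<N} \<rightarrow>\<^sub>E UNIV"
  shows "(\<forall>\<beta> \<beta>'. generic_braid p \<beta> \<and> generic_braid p \<beta>' \<and> isotopic \<beta> \<beta>' \<longrightarrow>
            f_n N e A1 \<beta> = f_n N e A1 \<beta>') \<and>
         (\<exists>!F. F \<in> carrier (SPB p) \<rightarrow>\<^sub>E ({..<N} \<rightarrow>\<^sub>E (UNIV :: 'x set)) \<and>
            (\<forall>\<beta>. generic_braid p \<beta> \<longrightarrow> F (isotopy_class \<beta>) = f_n N e A1 \<beta>))"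
proof -
  have gp: "general_position p" using no_four_cocircular_iff assms by blast
  have inv: "f_n N e A1 \<beta> = f_n N e A1 \<beta>'"
    if "generic_braid p \<beta>" "generic_braid p \<beta>'" "isotopic \<beta> \<beta>'" for \<beta> \<beta>'
    using f_n_isotopic[OF assms(1) gp assms(5) that] .
  have pure: "pure_braid p \<beta>" if "generic_braid p \<beta>" for \<beta> using that by (simp add: generic_braid_def)
  \<comment> \<open>Every class contains a generic braid, since a close generic approximation of a
    representative is isotopic to it. This gives values of \<open>F\<close> on all classes and makes
    them unique.\<close>
  have rep: "\<exists>\<beta>. generic_braid p \<beta> \<and> isotopy_class \<beta> = c" if c: "c \<in> carrier (SPB p)" for c
  proof -
    obtain \<gamma> where g: "pure_braid p \<gamma>" "c = isotopy_class \<gamma>" using c by (auto simp: SPB_def)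
    obtain \<epsilon> where \<epsilon>: "\<epsilon> > 0" "\<And>\<beta>. pure_braid p \<beta> \<Longrightarrow> (\<forall>t\<in>{0..1}. dist (\<beta> t) (\<gamma> t) < \<epsilon>) \<Longrightarrow> isotopic \<gamma> \<beta>"
      using close_isotopic[OF g(1)] by blast
    obtain \<beta> where b: "generic_braid p \<beta>" "\<forall>t\<in>{0..1}. dist (\<beta> t) (\<gamma> t) < \<epsilon>"
      using generic_braid_dense[OF g(1) \<epsilon>(1) assms(1) gp] by blast
    have "isotopic \<gamma> \<beta>" using \<epsilon>(2)[OF pure[OF b(1)] b(2)] .
    then have "isotopy_class \<gamma> = isotopy_class \<beta>" using isotopy_class_eq_iff[OF g(1)] by blast
    then show ?thesis using b(1) g(2) by auto
  qed
  have car: "isotopy_class \<beta> \<in> carrier (SPB p)" if "generic_braid p \<beta>" for \<beta>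
    using pure[OF that] by (auto simp: SPB_def)
  define R where "R c = (SOME \<beta>. generic_braid p \<beta> \<and> isotopy_class \<beta> = c)" for c
  have R: "generic_braid p (R c)" "isotopy_class (R c) = c" if "c \<in> carrier (SPB p)" for c
    using someI_ex[OF rep[OF that]] unfolding R_def by auto
  define F where "F = (\<lambda>c\<in>carrier (SPB p). f_n N e A1 (R c))"
  have "\<exists>!F. F \<in> carrier (SPB p) \<rightarrow>\<^sub>E ({..<N} \<rightarrow>\<^sub>E (UNIV :: 'x set)) \<and>
            (\<forall>\<beta>. generic_braid p \<beta> \<longrightarrow> F (isotopy_class \<beta>) = f_n N e A1 \<beta>)"
  proof (rule ex1I[of _ F])
    have "F (isotopy_class \<beta>) = f_n N e A1 \<beta>" if b: "generic_braid p \<beta>" for \<beta>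
    proof -
      have "isotopic (R (isotopy_class \<beta>)) \<beta>"
        using R[OF car[OF b]] isotopy_class_eq_iff[OF pure] by blast
      then show ?thesis using inv[OF R(1)[OF car[OF b]] b] car[OF b] by (simp add: F_def)
    qed
    moreover have "F \<in> carrier (SPB p) \<rightarrow>\<^sub>E ({..<N} \<rightarrow>\<^sub>E (UNIV :: 'x set))"
      unfolding F_def by (auto simp: f_n_def)
    ultimately show "F \<in> carrier (SPB p) \<rightarrow>\<^sub>E ({..<N} \<rightarrow>\<^sub>E (UNIV :: 'x set)) \<and>
            (\<forall>\<beta>. generic_braid p \<beta> \<longrightarrow> F (isotopy_class \<beta>) = f_n N e A1 \<beta>)" by blast
    fix F' assume F': "F' \<in> carrier (SPB p) \<rightarrow>\<^sub>E ({..<N} \<rightarrow>\<^sub>E (UNIV :: 'x set)) \<and>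
            (\<forall>\<beta>. generic_braid p \<beta> \<longrightarrow> F' (isotopy_class \<beta>) = f_n N e A1 \<beta>)"
    show "F' = F"
    proof
      fix c
      show "F' c = F c"
      proof (cases "c \<in> carrier (SPB p)")
        case True
        then have "F' c = f_n N e A1 (R c)" using F' R[OF True] by metis
        then show ?thesis using True by (simp add: F_def)
      next
        case False then show ?thesis using F' by (auto simp: F_def PiE_def extensional_def)
      qed
    qed
  qed
  then show ?thesis using inv by blast
qed

end
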